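(* Let $D,\Omega,a,g,y_D,\psi,\alpha,Y,X_1,C_1,C_2$ and problems $(\mathrm{P}')$ and $(\mathrm{P}'_s)$ (the latter depending on a parameter $\alpha'>0$) be as defined in the context. Assume that $0\in C_2$, that problem $(\mathrm{P}')$ has at least one optimal solution $(x_1,y)\in X_1\times L^\infty(\Omega,Y)$, and let $(x_1^{\alpha'},y^{\alpha'},z^{\alpha'})\in X_1\times L^\infty(\Omega,Y)\times L^\infty(\Omega,Y)$ be solutions to problem $(\mathrm{P}'_s)$ with parameter $\alpha'$. Then for any sequence $\{\alpha_n'\}$ with $\alpha_n'\to\infty$, the sequence $\{(x_1^{\alpha_n'},y^{\alpha_n'})\}$ has a (weak, strong) accumulation point $(x_1^\infty,y^\infty)$, i.e., along a subsequence $x_1^{\alpha_n'}\rightharpoonup x_1^\infty$ weakly in $X_1$ and $y^{\alpha_n'}\to y^\infty$ strongly in $L^\infty(\Omega,Y)$, and each such accumulation point solves problem $(\mathrm{P}')$.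
   Context: Setting. $(\Omega,\mathcal{F},\mathbb{P})$ is a complete probability space and $D\subset\mathbb{R}^2$ a bounded Lipschitz domain. The random fields satisfy: $g\in L^\infty(\Omega,L^2(D))$; there are $a_{\min},a_{\max}$ with $0<a_{\min}\le a(s,\omega)\le a_{\max}<\infty$ a.e. on $D\times\Omega$; and $a\in L^\infty(\Omega,C^t(D))$ for some $t\in(0,1]$. $X_1=L^2(D)$ and $Y=W_0^{1,p}(D)$ for a suitable $p>2$, namely one such that, a.s., the operator $\mathcal{A}(\omega):W_0^{1,p}(D)\to W^{-1,p}(D)$, $\mathcal{A}(\omega)y=\big(\phi\mapsto\int_D a(\cdot,\omega)\nabla y\cdot\nabla\phi\,ds\big)$, is an isomorphism with inverse bounded uniformly in $\omega$ (such $p$ exists under these hypotheses); here $W^{-1,p}(D)$ is the dual of $W_0^{1,p'}(D)$, $1/p+1/p'=1$. $C_1\subset X_1$ and $C_2\subset Y$ are nonempty, closed and convex; $y_D\in X_1$, $\alpha>0$, $\psi\in L^\infty(\Omega,Y)$. Problem $(\mathrm{P}')$: minimize $\tfrac12\mathbb{E}[\|y-y_D\|_{X_1}^2]+\tfrac{\alpha}{2}\|x_1\|_{X_1}^2$ over $(x_1,y)\in X_1\times L^\infty(\Omega,Y)$ subject to $x_1\in C_1$; $y(\cdot,\omega)\in C_2$ a.s.; $-\nabla\cdot(a(s,\omega)\nabla y(s,\omega))=x_1(s)+g(s,\omega)$ on $D\times\Omega$ a.e.; $y(s,\omega)=0$ on $\partial D\times\Omega$ a.e. (the PDE understood as $\mathcal{A}(\omega)y_\omega=x_1+g(\cdot,\omega)$);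 and $y(s,\omega)\le\psi(s,\omega)$ on $D\times\Omega$ a.e. Problem $(\mathrm{P}'_s)$ (parameter $\alpha'>0$): minimize $\tfrac12\mathbb{E}[\|y-y_D\|_{X_1}^2+\alpha'\|z\|_{X_1}^2]+\tfrac{\alpha}{2}\|x_1\|_{X_1}^2$ over $(x_1,y,z)\in X_1\times L^\infty(\Omega,Y)\times L^\infty(\Omega,Y)$ subject to $x_1\in C_1$; $y(\cdot,\omega)\in C_2$ and $z(\cdot,\omega)\in C_2$ a.s.; the same PDE and boundary condition for $y$; and $y(s,\omega)\le\psi(s,\omega)+z(s,\omega)$ on $D\times\Omega$ a.e. *)

theory Defs
  imports "HOL-Probability.Probability"
begin

section \<open>Seminormed function spaces\<close>

text \<open>
  Spaces of equivalence classes of functions are represented by the seminormed space of their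
  representatives: a carrier together with a seminorm, where two elements \<open>u\<close>, \<open>v\<close> are the same
  point iff \<open>nrm V (u - v) = 0\<close>.  All notions below respect this identification.  In particular a
  set that is closed in the sense of \<open>closed_in\<close> is a union of equivalence classes.
\<close>

record 'b fspace =
  carr :: "('b \<Rightarrow> real) set"
  nrm :: "('b \<Rightarrow> real) \<Rightarrow> real"

definition closed_in :: "'b fspace \<Rightarrow> ('b \<Rightarrow> real) set \<Rightarrow> bool" where
  "closed_in V C \<longleftrightarrow> C \<subseteq> carr V \<and>
     (\<forall>u\<in>carr V. (\<forall>e>0. \<exists>v\<in>C. nrm V (u - v) < e) \<longrightarrow> u \<in> C)"

definition convex_set :: "('b \<Rightarrow> real) set \<Rightarrow> bool" where
  "convex_set C \<longleftrightarrow>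
     (\<forall>u\<in>C. \<forall>v\<in>C. \<forall>c\<in>{0..1}. (\<lambda>s. (1 - c) * u s + c * v s) \<in> C)"

text \<open>
  The topological dual.  Only the values of a functional on \<open>carr V\<close> are meaningful.
\<close>

definition dual :: "'b fspace \<Rightarrow> ('b \<Rightarrow> real) fspace" where
  "dual V = \<lparr>
     carr = {l. (\<forall>u\<in>carr V. \<forall>v\<in>carr V. l (\<lambda>s. u s + v s) = l u + l v) \<and>
                (\<forall>c. \<forall>u\<in>carr V. l (\<lambda>s. c * u s) = c * l u) \<and>
                (\<exists>B. \<forall>u\<in>carr V. \<bar>l u\<bar> \<le> B * nrm V u)},
     nrm = (\<lambda>l. Sup {\<bar>l u\<bar> | u. u \<in> carr V \<and> nrm V u \<le> 1}) \<rparr>"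

definition weakly_converges ::
  "'b fspace \<Rightarrow> (nat \<Rightarrow> 'b \<Rightarrow> real) \<Rightarrow> ('b \<Rightarrow> real) \<Rightarrow> bool" where
  "weakly_converges V u x \<longleftrightarrow> (\<forall>l\<in>carr (dual V). (\<lambda>n. l (u n)) \<longlonglongrightarrow> l x)"

text \<open>
  \<open>T\<close> is an isomorphism of the normed spaces \<open>V\<close> and \<open>W\<close> whose inverse has norm at most \<open>K\<close>.
  The last conjunct expresses both injectivity and the bound on the inverse.
\<close>

definition iso_inverse_bound ::
  "'b fspace \<Rightarrow> 'c fspace \<Rightarrow> (('b \<Rightarrow> real) \<Rightarrow> ('c \<Rightarrow> real)) \<Rightarrow> real \<Rightarrow> bool" where
  "iso_inverse_bound V W T K \<longleftrightarrow>
     (\<forall>u\<in>carr V. T u \<in> carr W) \<and>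
     (\<forall>u\<in>carr V. \<forall>v\<in>carr V. \<forall>b c.
        nrm W (T (\<lambda>s. b * u s + c * v s) - (\<lambda>r. b * T u r + c * T v r)) = 0) \<and>
     (\<exists>B. \<forall>u\<in>carr V. nrm W (T u) \<le> B * nrm V u) \<and>
     (\<forall>w\<in>carr W. \<exists>u\<in>carr V. nrm W (T u - w) = 0) \<and>
     (\<forall>u\<in>carr V. nrm V u \<le> K * nrm W (T u))"


section \<open>The Bochner spaces of essentially bounded functions\<close>

definition strongly_measurable :: "'w measure \<Rightarrow> 'b fspace \<Rightarrow> ('w \<Rightarrow> 'b \<Rightarrow> real) \<Rightarrow> bool" where
  "strongly_measurable M V f \<longleftrightarrow>
     (\<exists>\<sigma>. (\<forall>n. simple_function M (\<sigma> n) \<and> (\<forall>\<omega>\<in>space M. \<sigma> n \<omega> \<in> carr V)) \<and>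
          (AE \<omega> in M. (\<lambda>n. nrm V (\<sigma> n \<omega> - f \<omega>)) \<longlonglongrightarrow> 0))"

definition Linf :: "'w measure \<Rightarrow> 'b fspace \<Rightarrow> ('w \<Rightarrow> 'b \<Rightarrow> real) set" where
  "Linf M V = {f. (AE \<omega> in M. f \<omega> \<in> carr V) \<and> strongly_measurable M V f \<and>
                  (\<exists>B. AE \<omega> in M. nrm V (f \<omega>) \<le> B)}"

definition Linf_norm :: "'w measure \<Rightarrow> 'b fspace \<Rightarrow> ('w \<Rightarrow> 'b \<Rightarrow> real) \<Rightarrow> ereal" where
  "Linf_norm M V f = esssup M (\<lambda>\<omega>. ereal (nrm V (f \<omega>)))"


section \<open>Domains, Lebesgue, Hoelder and Sobolev spaces in the plane\<close>

definition lipschitz_domain :: "(real^2) set \<Rightarrow> bool" where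
  "lipschitz_domain D \<longleftrightarrow> open D \<and> connected D \<and> D \<noteq> {} \<and>
     (\<forall>x\<in>frontier D. \<exists>r>0. \<exists>R::real^2 \<Rightarrow> real^2. \<exists>\<gamma>::real \<Rightarrow> real. \<exists>L.
        orthogonal_transformation R \<and> L-lipschitz_on UNIV \<gamma> \<and>
        D \<inter> ball x r = {y \<in> ball x r. R y $ 2 > \<gamma> (R y $ 1)})"

definition Lp_space :: "(real^2) set \<Rightarrow> real \<Rightarrow> (real^2) fspace" where
  "Lp_space D p = \<lparr>
     carr = {f \<in> borel_measurable (lebesgue_on D).
               integrable (lebesgue_on D) (\<lambda>s. \<bar>f s\<bar> powr p)},
     nrm = (\<lambda>f. (\<integral>s. \<bar>f s\<bar> powr p \<partial>lebesgue_on D) powr (1 / p)) \<rparr>"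

text \<open>For \<open>t = 1\<close> this is the space of bounded Lipschitz functions.\<close>

definition holder_space :: "(real^2) set \<Rightarrow> real \<Rightarrow> (real^2) fspace" where
  "holder_space D t = \<lparr>
     carr = {f. \<exists>B. (\<forall>x\<in>D. \<bar>f x\<bar> \<le> B) \<and>
                    (\<forall>x\<in>D. \<forall>y\<in>D. \<bar>f x - f y\<bar> \<le> B * dist x y powr t)},
     nrm = (\<lambda>f. Sup {\<bar>f x\<bar> | x. x \<in> D} +
                Sup {\<bar>f x - f y\<bar> / dist x y powr t | x y. x \<in> D \<and> y \<in> D \<and> x \<noteq> y}) \<rparr>"

definition partial_deriv :: "2 \<Rightarrow> (real^2 \<Rightarrow> real) \<Rightarrow> real^2 \<Rightarrow> real" where
  "partial_deriv i f s = frechet_derivative f (at s) (axis i 1)"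

primrec Ck :: "nat \<Rightarrow> (real^2 \<Rightarrow> real) \<Rightarrow> bool" where
  "Ck 0 f \<longleftrightarrow> continuous_on UNIV f"
| "Ck (Suc k) f \<longleftrightarrow> (\<forall>s. f differentiable (at s)) \<and> (\<forall>i. Ck k (partial_deriv i f))"

definition test_functions :: "(real^2) set \<Rightarrow> (real^2 \<Rightarrow> real) set" where
  "test_functions D = {\<phi>. (\<forall>k. Ck k \<phi>) \<and>
     compact (closure {s. \<phi> s \<noteq> 0}) \<and> closure {s. \<phi> s \<noteq> 0} \<subseteq> D}"

definition has_weak_grad ::
  "(real^2) set \<Rightarrow> (real^2 \<Rightarrow> real) \<Rightarrow> (real^2 \<Rightarrow> real^2) \<Rightarrow> bool" where
  "has_weak_grad D u G \<longleftrightarrow>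
     (\<forall>K. compact K \<and> K \<subseteq> D \<longrightarrow> u absolutely_integrable_on K \<and> G absolutely_integrable_on K) \<and>
     (\<forall>\<phi>\<in>test_functions D. \<forall>i.
        (\<integral>s. u s * partial_deriv i \<phi> s \<partial>lebesgue_on D) = - (\<integral>s. (G s $ i) * \<phi> s \<partial>lebesgue_on D))"

text \<open>The weak gradient is unique up to equality almost everywhere.\<close>

definition weak_grad :: "(real^2) set \<Rightarrow> (real^2 \<Rightarrow> real) \<Rightarrow> real^2 \<Rightarrow> real^2" where
  "weak_grad D u = (SOME G. has_weak_grad D u G)"

definition W1p :: "(real^2) set \<Rightarrow> real \<Rightarrow> (real^2) fspace" where
  "W1p D p = \<lparr>
     carr = {u \<in> carr (Lp_space D p).
               \<exists>G. has_weak_grad D u G \<and> (\<forall>i. (\<lambda>s. G s $ i) \<in> carr (Lp_space D p))},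
     nrm = (\<lambda>u. (nrm (Lp_space D p) u powr p +
                 (\<Sum>i\<in>UNIV. nrm (Lp_space D p) (\<lambda>s. weak_grad D u s $ i) powr p)) powr (1 / p)) \<rparr>"

definition W01p :: "(real^2) set \<Rightarrow> real \<Rightarrow> (real^2) fspace" where
  "W01p D p = \<lparr>
     carr = {u \<in> carr (W1p D p). \<forall>e>0. \<exists>\<phi>\<in>test_functions D. nrm (W1p D p) (u - \<phi>) < e},
     nrm = nrm (W1p D p) \<rparr>"

text \<open>\<open>Wm1p D p\<close> is \<open>W\<^sup>-\<^sup>1\<^sup>,\<^sup>p(D)\<close>, the dual of \<open>W\<^sub>0\<^sup>1\<^sup>,\<^sup>q(D)\<close> with \<open>1/p + 1/q = 1\<close>.\<close>

definition Wm1p :: "(real^2) set \<Rightarrow> real \<Rightarrow> (real^2 \<Rightarrow> real) fspace" where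
  "Wm1p D p = dual (W01p D (p / (p - 1)))"


section \<open>The state equation and the optimization problems\<close>

definition elliptic_op ::
  "(real^2) set \<Rightarrow> (real^2 \<Rightarrow> real) \<Rightarrow> (real^2 \<Rightarrow> real) \<Rightarrow> (real^2 \<Rightarrow> real) \<Rightarrow> real" where
  "elliptic_op D b y = (\<lambda>\<phi>. \<integral>s. b s * (weak_grad D y s \<bullet> weak_grad D \<phi> s) \<partial>lebesgue_on D)"

text \<open>
  The equation \<open>A y = f\<close> in \<open>W\<^sup>-\<^sup>1\<^sup>,\<^sup>p(D)\<close>, where \<open>f \<in> L\<^sup>2(D)\<close> is identified with the functional
  \<open>\<phi> \<mapsto> \<integral> f \<phi>\<close>.  The homogeneous boundary condition is part of \<open>y \<in> W\<^sub>0\<^sup>1\<^sup>,\<^sup>p(D)\<close>.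
\<close>

definition solves_pde ::
  "(real^2) set \<Rightarrow> real \<Rightarrow> (real^2 \<Rightarrow> real) \<Rightarrow> (real^2 \<Rightarrow> real) \<Rightarrow> (real^2 \<Rightarrow> real) \<Rightarrow> bool" where
  "solves_pde D p b f y \<longleftrightarrow> y \<in> carr (W01p D p) \<and>
     (\<forall>\<phi>\<in>carr (W01p D (p / (p - 1))). elliptic_op D b y \<phi> = (\<integral>s. f s * \<phi> s \<partial>lebesgue_on D))"

text \<open>
  Random fields are curried as \<open>\<omega> \<mapsto> s \<mapsto> y \<omega> s\<close>.  A relation between elements of a Bochner space
  that holds almost everywhere on \<open>D \<times> \<Omega>\<close> is written as an iterated almost-everywhere statement.
  By Fubini this is the same for jointly measurable representatives; unlike the statement for the
  product measure, it does not depend on the choice of the representative of each \<open>y \<omega>\<close>.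
\<close>

definition feasible_P ::
  "'w measure \<Rightarrow> (real^2) set \<Rightarrow> real \<Rightarrow> ('w \<Rightarrow> real^2 \<Rightarrow> real) \<Rightarrow> ('w \<Rightarrow> real^2 \<Rightarrow> real) \<Rightarrow>
   ('w \<Rightarrow> real^2 \<Rightarrow> real) \<Rightarrow> (real^2 \<Rightarrow> real) set \<Rightarrow> (real^2 \<Rightarrow> real) set \<Rightarrow>
   (real^2 \<Rightarrow> real) \<Rightarrow> ('w \<Rightarrow> real^2 \<Rightarrow> real) \<Rightarrow> bool" where
  "feasible_P M D p a g \<psi> C1 C2 x y \<longleftrightarrow>
     x \<in> carr (Lp_space D 2) \<and> y \<in> Linf M (W01p D p) \<and>
     x \<in> C1 \<and>
     (AE \<omega> in M. y \<omega> \<in> C2) \<and>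
     (AE \<omega> in M. solves_pde D p (a \<omega>) (\<lambda>s. x s + g \<omega> s) (y \<omega>)) \<and>
     (AE \<omega> in M. AE s in lebesgue_on D. y \<omega> s \<le> \<psi> \<omega> s)"

definition objective_P ::
  "'w measure \<Rightarrow> (real^2) set \<Rightarrow> (real^2 \<Rightarrow> real) \<Rightarrow> real \<Rightarrow>
   (real^2 \<Rightarrow> real) \<Rightarrow> ('w \<Rightarrow> real^2 \<Rightarrow> real) \<Rightarrow> real" where
  "objective_P M D yD \<alpha> x y =
     1 / 2 * (\<integral>\<omega>. (nrm (Lp_space D 2) (y \<omega> - yD))\<^sup>2 \<partial>M) + \<alpha> / 2 * (nrm (Lp_space D 2) x)\<^sup>2"

definition solution_P ::
  "'w measure \<Rightarrow> (real^2) set \<Rightarrow> real \<Rightarrow> ('w \<Rightarrow> real^2 \<Rightarrow> real) \<Rightarrow> ('w \<Rightarrow> real^2 \<Rightarrow> real) \<Rightarrow>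
   (real^2 \<Rightarrow> real) \<Rightarrow> ('w \<Rightarrow> real^2 \<Rightarrow> real) \<Rightarrow> (real^2 \<Rightarrow> real) set \<Rightarrow> (real^2 \<Rightarrow> real) set \<Rightarrow>
   real \<Rightarrow> (real^2 \<Rightarrow> real) \<Rightarrow> ('w \<Rightarrow> real^2 \<Rightarrow> real) \<Rightarrow> bool" where
  "solution_P M D p a g yD \<psi> C1 C2 \<alpha> x y \<longleftrightarrow>
     is_arg_min (\<lambda>(x, y). objective_P M D yD \<alpha> x y)
       (\<lambda>(x, y). feasible_P M D p a g \<psi> C1 C2 x y) (x, y)"

definition feasible_Ps ::
  "'w measure \<Rightarrow> (real^2) set \<Rightarrow> real \<Rightarrow> ('w \<Rightarrow> real^2 \<Rightarrow> real) \<Rightarrow> ('w \<Rightarrow> real^2 \<Rightarrow> real) \<Rightarrow>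
   ('w \<Rightarrow> real^2 \<Rightarrow> real) \<Rightarrow> (real^2 \<Rightarrow> real) set \<Rightarrow> (real^2 \<Rightarrow> real) set \<Rightarrow>
   (real^2 \<Rightarrow> real) \<Rightarrow> ('w \<Rightarrow> real^2 \<Rightarrow> real) \<Rightarrow> ('w \<Rightarrow> real^2 \<Rightarrow> real) \<Rightarrow> bool" where
  "feasible_Ps M D p a g \<psi> C1 C2 x y z \<longleftrightarrow>
     x \<in> carr (Lp_space D 2) \<and> y \<in> Linf M (W01p D p) \<and> z \<in> Linf M (W01p D p) \<and>
     x \<in> C1 \<and>
     (AE \<omega> in M. y \<omega> \<in> C2 \<and> z \<omega> \<in> C2) \<and>
     (AE \<omega> in M. solves_pde D p (a \<omega>) (\<lambda>s. x s + g \<omega> s) (y \<omega>)) \<and>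
     (AE \<omega> in M. AE s in lebesgue_on D. y \<omega> s \<le> \<psi> \<omega> s + z \<omega> s)"

definition objective_Ps ::
  "'w measure \<Rightarrow> (real^2) set \<Rightarrow> (real^2 \<Rightarrow> real) \<Rightarrow> real \<Rightarrow> real \<Rightarrow>
   (real^2 \<Rightarrow> real) \<Rightarrow> ('w \<Rightarrow> real^2 \<Rightarrow> real) \<Rightarrow> ('w \<Rightarrow> real^2 \<Rightarrow> real) \<Rightarrow> real" where
  "objective_Ps M D yD \<alpha> \<alpha>' x y z =
     1 / 2 * (\<integral>\<omega>. (nrm (Lp_space D 2) (y \<omega> - yD))\<^sup>2 + \<alpha>' * (nrm (Lp_space D 2) (z \<omega>))\<^sup>2 \<partial>M) +
     \<alpha> / 2 * (nrm (Lp_space D 2) x)\<^sup>2"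

definition solution_Ps ::
  "'w measure \<Rightarrow> (real^2) set \<Rightarrow> real \<Rightarrow> ('w \<Rightarrow> real^2 \<Rightarrow> real) \<Rightarrow> ('w \<Rightarrow> real^2 \<Rightarrow> real) \<Rightarrow>
   (real^2 \<Rightarrow> real) \<Rightarrow> ('w \<Rightarrow> real^2 \<Rightarrow> real) \<Rightarrow> (real^2 \<Rightarrow> real) set \<Rightarrow> (real^2 \<Rightarrow> real) set \<Rightarrow>
   real \<Rightarrow> real \<Rightarrow>
   (real^2 \<Rightarrow> real) \<Rightarrow> ('w \<Rightarrow> real^2 \<Rightarrow> real) \<Rightarrow> ('w \<Rightarrow> real^2 \<Rightarrow> real) \<Rightarrow> bool" where
  "solution_Ps M D p a g yD \<psi> C1 C2 \<alpha> \<alpha>' x y z \<longleftrightarrow>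
     is_arg_min (\<lambda>(x, y, z). objective_Ps M D yD \<alpha> \<alpha>' x y z)
       (\<lambda>(x, y, z). feasible_Ps M D p a g \<psi> C1 C2 x y z) (x, y, z)"

definition weak_strong_accumulation_point ::
  "'w measure \<Rightarrow> (real^2) set \<Rightarrow> real \<Rightarrow>
   (nat \<Rightarrow> real^2 \<Rightarrow> real) \<Rightarrow> (nat \<Rightarrow> 'w \<Rightarrow> real^2 \<Rightarrow> real) \<Rightarrow>
   (real^2 \<Rightarrow> real) \<Rightarrow> ('w \<Rightarrow> real^2 \<Rightarrow> real) \<Rightarrow> bool" where
  "weak_strong_accumulation_point M D p xs ys x y \<longleftrightarrow>
     x \<in> carr (Lp_space D 2) \<and> y \<in> Linf M (W01p D p) \<and>
     (\<exists>r::nat \<Rightarrow> nat. strict_mono r \<and>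
        weakly_converges (Lp_space D 2) (\<lambda>n. xs (r n)) x \<and>
        (\<lambda>n. Linf_norm M (W01p D p) (ys (r n) - y)) \<longlonglongrightarrow> 0)"

end

theory Submission
  imports Defs "HOL-Real_Asymp.Real_Asymp" "HOL-Complex_Analysis.Great_Picard"
begin

text \<open>
  Comparing the penalized minimizers with \<open>(x, y, 0)\<close>, where \<open>(x, y)\<close> solves the constrained problem,
  bounds the controls in \<open>L\<^sup>2\<close> and shows that the expectation of the squared slack is
  \<open>O(1/\<alpha>')\<close>.  A subsequence of the controls converges weakly.  Bounded weak null sequences of
  \<open>L\<^sup>2(D)\<close> converge to zero in \<open>W\<^sup>-\<^sup>1\<^sup>,\<^sup>p(D)\<close>, so by the uniform bound on the inverse operators the
  states converge in \<open>L\<^sup>\<infinity>(\<Omega>, Y)\<close>.  All constraints are closed under these convergences, and the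
  weak lower semicontinuity of the norm gives optimality of the limit.

  The compactness result comes from averaging over balls.  Pairing a function of \<open>L\<^sup>2\<close> with the
  difference of a test function \<open>\<phi>\<close> and its averages over balls of radius \<open>r\<close> costs at most
  \<open>C r\<^bsup>2/p\<^esup>\<close> times the norms, by Young's inequality for \<open>f \<in> L\<^sup>2\<close>, \<open>\<nabla>\<phi> \<in> L\<^sup>q\<close> and the indicator of the
  ball; moving the average to the other factor turns a weak null sequence into a strong one.
\<close>


section \<open>Seminormed function spaces\<close>

text \<open>Uniformity in \<omega> comes from one cancellation: at a fixed \<omega>, the states of
  two controls \<open>x\<close> and \<open>x'\<close> differ by the solution with right-hand side x
  - x', since \<open>g\<close> drops out. This functional is deterministic, so its norm in the dual
  of W_0^{1,q}, times the common bound \<open>K\<close> on the inverses, controls the states for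
  almost all \<omega> at once. Here q = p/(p-1) lies strictly between 1 and 2, and in the plane its
  Sobolev exponent 2q/(2-q) strictly exceeds 2; the exponent 2/p of the averaging rate measures this
  gap. Test functions extend by zero, so the averaging takes place on the whole plane, by Fubini,
  translations and dilations. Since points of a space are functions up to seminorm zero,
  convergence, measurability and linearity are always read off from norms of differences.
  Constraints are passed to the limit at each fixed \<omega>, after subsequences have turned the
  convergence of the states in L^\<infinity> and of the slacks in mean square into almost sure
  statements.\<close>

locale seminormed_fspace =
  fixes V :: "'b fspace"
  assumes zero_mem: "(\<lambda>s. 0) \<in> carr V"
    and add_mem: "u \<in> carr V \<Longrightarrow> v \<in> carr V \<Longrightarrow> (\<lambda>s. u s + v s) \<in> carr V"
    and scale_mem: "u \<in> carr V \<Longrightarrow> (\<lambda>s. c * u s) \<in> carr V"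
    and nrm_triangle: "u \<in> carr V \<Longrightarrow> v \<in> carr V \<Longrightarrow> nrm V (\<lambda>s. u s + v s) \<le> nrm V u + nrm V v"
    and nrm_scale: "u \<in> carr V \<Longrightarrow> nrm V (\<lambda>s. c * u s) = \<bar>c\<bar> * nrm V u"
begin

lemma diff_mem:
  assumes "u \<in> carr V" "v \<in> carr V"
  shows "u - v \<in> carr V"
  using add_mem[OF assms(1) scale_mem[OF assms(2), of "-1"]] by (simp add: fun_diff_def)

lemma nrm_zero: "nrm V (\<lambda>s. 0) = 0"
  using nrm_scale[OF zero_mem, of 0] by simp

lemma nrm_diff_commute:
  assumes "u \<in> carr V" "v \<in> carr V"
  shows "nrm V (u - v) = nrm V (v - u)"
  using nrm_scale[OF diff_mem[OF assms], of "-1"] by (simp add: fun_diff_def)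

text \<open>Since u + (-u) has seminorm zero, the triangle inequality and homogeneity give 0 \<le> 2
  |u|.\<close>

lemma nrm_nonneg:
  assumes "u \<in> carr V"
  shows "0 \<le> nrm V u"
  using nrm_triangle[OF assms scale_mem[OF assms, of "-1"]] nrm_scale[OF assms, of "-1"] nrm_zero
  by simp

lemma nrm_triangle_diff:
  assumes "u \<in> carr V" "v \<in> carr V" "w \<in> carr V"
  shows "nrm V (u - w) \<le> nrm V (u - v) + nrm V (v - w)"
  using nrm_triangle[OF diff_mem[OF assms(1,2)] diff_mem[OF assms(2,3)]]
  by (simp add: fun_diff_def)

lemma nrm_le_diff:
  assumes "u \<in> carr V" "v \<in> carr V"
  shows "nrm V u \<le> nrm V v + nrm V (u - v)"
  using nrm_triangle[OF assms(2) diff_mem[OF assms]] by (simp add: fun_diff_def)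

lemma nrm_diff_le:
  assumes "u \<in> carr V" "v \<in> carr V"
  shows "\<bar>nrm V u - nrm V v\<bar> \<le> nrm V (u - v)"
  using nrm_le_diff[OF assms] nrm_le_diff[OF assms(2,1)] nrm_diff_commute[OF assms] by linarith

end


section \<open>Bochner measurability\<close>

text \<open>The preimages under \<open>f\<close> and \<open>g\<close> differ by a subset of a null
  set, which completeness makes measurable. This covers objects fixed only up to null sets, such as
  weak gradients and limits of simple functions.\<close>

lemma (in complete_measure) borel_measurable_AE_eq:
  fixes f g :: "'a \<Rightarrow> real"
  assumes g: "g \<in> borel_measurable M" and "AE x in M. f x = g x"
  shows "f \<in> borel_measurable M"
proof (rule measurableI)
  fix A :: "real set" assume A: "A \<in> sets borel"
  have "AE x in M. x \<in> g -` A \<inter> space M \<longleftrightarrow> x \<in> f -` A \<inter> space M"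
    using assms(2) by eventually_elim auto
  then show "f -` A \<inter> space M \<in> sets M"
    using measurable_sets[OF g A] by (rule in_sets_AE) blast
qed simp

lemma (in complete_measure) borel_measurable_AE_lim:
  fixes f :: "'a \<Rightarrow> real"
  assumes [measurable]: "\<And>n. F n \<in> borel_measurable M" and "AE x in M. (\<lambda>n. F n x) \<longlonglongrightarrow> f x"
  shows "f \<in> borel_measurable M"
proof (rule borel_measurable_AE_eq)
  \<comment> \<open>\<open>lim\<close> is a total function, measurable whether or not the sequence
    converges at a given point.\<close>
  show "(\<lambda>x. lim (\<lambda>n. F n x)) \<in> borel_measurable M"
    by measurable
  show "AE x in M. f x = lim (\<lambda>n. F n x)"
    using assms(2) by eventually_elim (simp add: limI)
qed

lemma strongly_measurableE:
  assumes "strongly_measurable M V f"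
  obtains \<sigma> where "\<And>n. simple_function M (\<sigma> n)" "\<And>n \<omega>. \<omega> \<in> space M \<Longrightarrow> \<sigma> n \<omega> \<in> carr V"
    "AE \<omega> in M. (\<lambda>n. nrm V (\<sigma> n \<omega> - f \<omega>)) \<longlonglongrightarrow> 0"
  using assms unfolding strongly_measurable_def by blast

context seminormed_fspace
begin

lemma strongly_measurable_diff:
  assumes f: "strongly_measurable M V f" "AE \<omega> in M. f \<omega> \<in> carr V"
    and g: "strongly_measurable M V g" "AE \<omega> in M. g \<omega> \<in> carr V"
  shows "strongly_measurable M V (f - g)"
proof -
  obtain \<sigma> where s: "\<And>n. simple_function M (\<sigma> n)" "\<And>n \<omega>. \<omega> \<in> space M \<Longrightarrow> \<sigma> n \<omega> \<in> carr V"
      "AE \<omega> in M. (\<lambda>n. nrm V (\<sigma> n \<omega> - f \<omega>)) \<longlonglongrightarrow> 0"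
    by (rule strongly_measurableE[OF f(1)]) blast
  obtain \<tau> where t: "\<And>n. simple_function M (\<tau> n)" "\<And>n \<omega>. \<omega> \<in> space M \<Longrightarrow> \<tau> n \<omega> \<in> carr V"
      "AE \<omega> in M. (\<lambda>n. nrm V (\<tau> n \<omega> - g \<omega>)) \<longlonglongrightarrow> 0"
    by (rule strongly_measurableE[OF g(1)]) blast
  have "AE \<omega> in M. (\<lambda>n. nrm V ((\<sigma> n \<omega> - \<tau> n \<omega>) - (f - g) \<omega>)) \<longlonglongrightarrow> 0"
    using s(3) t(3) f(2) g(2) AE_space
  proof eventually_elim
    case (elim \<omega>)
    have le: "nrm V ((\<sigma> n \<omega> - \<tau> n \<omega>) - (f - g) \<omega>) \<le> nrm V (\<sigma> n \<omega> - f \<omega>) + nrm V (\<tau> n \<omega> - g \<omega>)" for n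
    proof -
      have "nrm V ((\<sigma> n \<omega> - \<tau> n \<omega>) - (f - g) \<omega>) \<le> nrm V (\<sigma> n \<omega> - f \<omega>) + nrm V (g \<omega> - \<tau> n \<omega>)"
        using nrm_triangle[OF diff_mem[of "\<sigma> n \<omega>" "f \<omega>"] diff_mem[of "g \<omega>" "\<tau> n \<omega>"]] elim s(2) t(2)
        by (simp add: fun_diff_def algebra_simps)
      then show ?thesis using nrm_diff_commute[of "g \<omega>" "\<tau> n \<omega>"] elim t(2) by simp
    qed
    have lim: "(\<lambda>n. nrm V (\<sigma> n \<omega> - f \<omega>) + nrm V (\<tau> n \<omega> - g \<omega>)) \<longlonglongrightarrow> 0"
      using tendsto_add[OF elim(1,2)] by simp
    show ?case
    proof (rule tendsto_sandwich[OF _ _ tendsto_const lim])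
      show "\<forall>\<^sub>F n in sequentially. 0 \<le> nrm V ((\<sigma> n \<omega> - \<tau> n \<omega>) - (f - g) \<omega>)"
        using elim s(2) t(2) by (auto intro!: always_eventually nrm_nonneg diff_mem)
    qed (use le in auto)
  qed
  moreover have "simple_function M (\<lambda>\<omega>. \<sigma> n \<omega> - \<tau> n \<omega>)" for n
    using simple_function_compose2[OF s(1) t(1), of "(-)"] by simp
  ultimately show ?thesis
    unfolding strongly_measurable_def
    using s(2) t(2) diff_mem by (intro exI[of _ "\<lambda>n \<omega>. \<sigma> n \<omega> - \<tau> n \<omega>"]) auto
qed

lemma nrm_measurable:
  assumes "complete_measure M" "strongly_measurable M V f" "AE \<omega> in M. f \<omega> \<in> carr V"
  shows "(\<lambda>\<omega>. nrm V (f \<omega>)) \<in> borel_measurable M"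
proof -
  obtain \<sigma> where s: "\<And>n. simple_function M (\<sigma> n)" "\<And>n \<omega>. \<omega> \<in> space M \<Longrightarrow> \<sigma> n \<omega> \<in> carr V"
      "AE \<omega> in M. (\<lambda>n. nrm V (\<sigma> n \<omega> - f \<omega>)) \<longlonglongrightarrow> 0"
    by (rule strongly_measurableE[OF assms(2)]) blast
  have "(\<lambda>\<omega>. nrm V (\<sigma> n \<omega>)) \<in> borel_measurable M" for n
    using simple_function_compose1[OF s(1), of "nrm V"] by (rule borel_measurable_simple_function)
  moreover have "AE \<omega> in M. (\<lambda>n. nrm V (\<sigma> n \<omega>)) \<longlonglongrightarrow> nrm V (f \<omega>)"
    using s(3) assms(3) AE_space
  proof eventually_elim
    case (elim \<omega>)
    have "norm (nrm V (\<sigma> n \<omega>) - nrm V (f \<omega>)) \<le> nrm V (\<sigma> n \<omega> - f \<omega>)" for n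
      using nrm_diff_le elim s(2) by auto
    then have "(\<lambda>n. nrm V (\<sigma> n \<omega>) - nrm V (f \<omega>)) \<longlonglongrightarrow> 0"
      by (intro Lim_null_comparison[OF _ elim(1)] always_eventually) simp
    then show ?case by (simp add: LIM_zero_iff)
  qed
  ultimately show ?thesis
    by (rule complete_measure.borel_measurable_AE_lim[OF assms(1), where F="\<lambda>n \<omega>. nrm V (\<sigma> n \<omega>)"])
qed

lemma strongly_measurable_const:
  assumes "h \<in> carr V"
  shows "strongly_measurable M V (\<lambda>_. h)"
  unfolding strongly_measurable_def
  using assms nrm_zero by (intro exI[of _ "\<lambda>_ _. h"]) (auto simp: fun_diff_def)

text \<open>Simple functions close in measure to \<open>f n\<close> have a subsequence that converges to \<open>h\<close> almost
  everywhere.\<close>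

lemma strongly_measurable_uniform_limit:
  assumes "prob_space M" "complete_measure M"
    and f: "\<And>n. strongly_measurable M V (f n)" "\<And>n. AE \<omega> in M. f n \<omega> \<in> carr V"
    and h: "AE \<omega> in M. h \<omega> \<in> carr V"
    and lim: "\<And>n. AE \<omega> in M. nrm V (f n \<omega> - h \<omega>) \<le> \<epsilon> n" "\<epsilon> \<longlonglongrightarrow> 0"
  shows "strongly_measurable M V h"
proof -
  interpret prob_space M by fact
  \<comment> \<open>Truncating the distance at 1 gives a dominated integrand on a probability space,
    so almost everywhere convergence of the simple functions supplies one that is close to
    \<open>f n\<close> in mean.\<close>
  have "\<exists>\<tau>. simple_function M \<tau> \<and> (\<forall>\<omega>\<in>space M. \<tau> \<omega> \<in> carr V) \<and>
      (\<lambda>\<omega>. nrm V (\<tau> \<omega> - f n \<omega>)) \<in> borel_measurable M \<and>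
      (\<integral>\<omega>. \<bar>min 1 \<bar>nrm V (\<tau> \<omega> - f n \<omega>)\<bar>\<bar> \<partial>M) \<le> 1 / Suc n" (is "\<exists>\<tau>. ?Q n \<tau>") for n
  proof -
    obtain \<sigma> where s: "\<And>k. simple_function M (\<sigma> k)" "\<And>k \<omega>. \<omega> \<in> space M \<Longrightarrow> \<sigma> k \<omega> \<in> carr V"
      "AE \<omega> in M. (\<lambda>k. nrm V (\<sigma> k \<omega> - f n \<omega>)) \<longlonglongrightarrow> 0"
      by (rule strongly_measurableE[OF f(1)[of n]]) blast
    have meas: "(\<lambda>\<omega>. nrm V (\<sigma> k \<omega> - f n \<omega>)) \<in> borel_measurable M" for k
    proof -
      have "strongly_measurable M V (\<sigma> k)"
        unfolding strongly_measurable_def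
        using s nrm_zero by (intro exI[of _ "\<lambda>_. \<sigma> k"]) (auto simp: fun_diff_def)
      moreover have "AE \<omega> in M. \<sigma> k \<omega> \<in> carr V" using s(2) by auto
      ultimately have "strongly_measurable M V (\<sigma> k - f n)"
        by (intro strongly_measurable_diff f)
      moreover have "AE \<omega> in M. (\<sigma> k - f n) \<omega> \<in> carr V"
        using \<open>AE \<omega> in M. \<sigma> k \<omega> \<in> carr V\<close> f(2)[of n] by eventually_elim (simp add: diff_mem)
      ultimately show ?thesis
        using nrm_measurable[OF assms(2), of "\<sigma> k - f n"] by simp
    qed
    have "(\<lambda>k. \<integral>\<omega>. \<bar>min 1 \<bar>nrm V (\<sigma> k \<omega> - f n \<omega>)\<bar>\<bar> \<partial>M) \<longlonglongrightarrow> (\<integral>\<omega>. 0 \<partial>M)"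
    proof (rule integral_dominated_convergence[where w="\<lambda>_. 1"])
      show "AE \<omega> in M. (\<lambda>k. \<bar>min 1 \<bar>nrm V (\<sigma> k \<omega> - f n \<omega>)\<bar>\<bar>) \<longlonglongrightarrow> 0"
        using s(3)
      proof eventually_elim
        case (elim \<omega>)
        have "(\<lambda>k. min 1 \<bar>nrm V (\<sigma> k \<omega> - f n \<omega>)\<bar>) \<longlonglongrightarrow> min 1 \<bar>0\<bar>"
          by (intro tendsto_intros elim)
        then show ?case by (simp add: tendsto_rabs_zero_iff)
      qed
    qed (use meas in auto)
    then have "\<forall>\<^sub>F k in sequentially. (\<integral>\<omega>. \<bar>min 1 \<bar>nrm V (\<sigma> k \<omega> - f n \<omega>)\<bar>\<bar> \<partial>M) < 1 / Suc n"
      by (intro order_tendstoD(2)[of _ 0]) auto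
    then obtain k where "(\<integral>\<omega>. \<bar>min 1 \<bar>nrm V (\<sigma> k \<omega> - f n \<omega>)\<bar>\<bar> \<partial>M) < 1 / Suc n"
      by (auto dest: eventually_happens)
    then show ?thesis
      using s meas by (intro exI[of _ "\<sigma> k"]) auto
  qed
  from choice[OF allI[OF this]] obtain \<tau> where t': "\<forall>n. ?Q n (\<tau> n)" ..
  have t: "\<And>n. simple_function M (\<tau> n)" "\<And>n \<omega>. \<omega> \<in> space M \<Longrightarrow> \<tau> n \<omega> \<in> carr V"
    "\<And>n. (\<lambda>\<omega>. nrm V (\<tau> n \<omega> - f n \<omega>)) \<in> borel_measurable M"
    "\<And>n. (\<integral>\<omega>. \<bar>min 1 \<bar>nrm V (\<tau> n \<omega> - f n \<omega>)\<bar>\<bar> \<partial>M) \<le> 1 / Suc n"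
    using t' by blast+
  have "(\<lambda>n. \<integral>\<omega>. norm (min 1 \<bar>nrm V (\<tau> n \<omega> - f n \<omega>)\<bar>) \<partial>M) \<longlonglongrightarrow> 0"
  proof (rule tendsto_sandwich[OF _ _ tendsto_const LIMSEQ_Suc[OF lim_inverse_n']])
    show "\<forall>\<^sub>F n in sequentially. (\<integral>\<omega>. norm (min 1 \<bar>nrm V (\<tau> n \<omega> - f n \<omega>)\<bar>) \<partial>M) \<le> 1 / Suc n"
      using t(4) by (simp add: always_eventually)
  qed auto
  moreover have "integrable M (\<lambda>\<omega>. min 1 \<bar>nrm V (\<tau> n \<omega> - f n \<omega>)\<bar>)" for n
    using t(3) by (intro integrable_const_bound[where B=1]) auto
  ultimately obtain r :: "nat \<Rightarrow> nat" where r: "strict_mono r"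
    "AE \<omega> in M. (\<lambda>n. min 1 \<bar>nrm V (\<tau> (r n) \<omega> - f (r n) \<omega>)\<bar>) \<longlonglongrightarrow> 0"
    using tendsto_L1_AE_subseq[of M "\<lambda>n \<omega>. min 1 \<bar>nrm V (\<tau> n \<omega> - f n \<omega>)\<bar>"] by auto
  have "AE \<omega> in M. \<forall>n. f n \<omega> \<in> carr V \<and> nrm V (f n \<omega> - h \<omega>) \<le> \<epsilon> n"
    using f(2) lim(1) by (simp add: AE_all_countable)
  then have "AE \<omega> in M. (\<lambda>n. nrm V (\<tau> (r n) \<omega> - h \<omega>)) \<longlonglongrightarrow> 0"
    using r(2) h AE_space
  proof eventually_elim
    case elim\<omega>: (elim \<omega>)
    \<comment> \<open>From some index on the truncation is inactive, so the truncated distances are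
      the true ones.\<close>
    have "\<forall>\<^sub>F n in sequentially. min 1 \<bar>nrm V (\<tau> (r n) \<omega> - f (r n) \<omega>)\<bar> < 1"
      using order_tendstoD(2)[OF elim\<omega>(2), of 1] by simp
    then have "\<forall>\<^sub>F n in sequentially. min 1 \<bar>nrm V (\<tau> (r n) \<omega> - f (r n) \<omega>)\<bar> + \<epsilon> (r n) \<ge> norm (nrm V (\<tau> (r n) \<omega> - h \<omega>))"
    proof eventually_elim
      case (elim n)
      then have "min 1 \<bar>nrm V (\<tau> (r n) \<omega> - f (r n) \<omega>)\<bar> = \<bar>nrm V (\<tau> (r n) \<omega> - f (r n) \<omega>)\<bar>" by linarith
      moreover have "nrm V (\<tau> (r n) \<omega> - h \<omega>) \<le> nrm V (\<tau> (r n) \<omega> - f (r n) \<omega>) + nrm V (f (r n) \<omega> - h \<omega>)"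
        by (rule nrm_triangle_diff) (use elim\<omega> t(2) in auto)
      moreover have "nrm V (\<tau> (r n) \<omega> - h \<omega>) \<ge> 0"
        by (intro nrm_nonneg diff_mem) (use elim\<omega> t(2) in auto)
      moreover have "nrm V (f (r n) \<omega> - h \<omega>) \<le> \<epsilon> (r n)" using elim\<omega>(1) by blast
      ultimately show ?case by simp
    qed
    moreover have "(\<lambda>n. min 1 \<bar>nrm V (\<tau> (r n) \<omega> - f (r n) \<omega>)\<bar> + \<epsilon> (r n)) \<longlonglongrightarrow> 0"
      using tendsto_add[OF elim\<omega>(2) LIMSEQ_subseq_LIMSEQ[OF lim(2) r(1)]] by (simp add: o_def)
    ultimately show ?case by (rule Lim_null_comparison)
  qed
  then show ?thesis
    unfolding strongly_measurable_def using t(1,2) by (intro exI[of _ "\<lambda>n. \<tau> (r n)"]) auto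
qed

end

section \<open>Dual spaces\<close>

context seminormed_fspace
begin

lemma carr_dual: "l \<in> carr (dual V) \<longleftrightarrow>
   (\<forall>u\<in>carr V. \<forall>v\<in>carr V. l (\<lambda>s. u s + v s) = l u + l v) \<and>
   (\<forall>c. \<forall>u\<in>carr V. l (\<lambda>s. c * u s) = c * l u) \<and> (\<exists>B. \<forall>u\<in>carr V. \<bar>l u\<bar> \<le> B * nrm V u)"
  by (simp add: dual_def)

lemma dual_add: "l \<in> carr (dual V) \<Longrightarrow> u \<in> carr V \<Longrightarrow> v \<in> carr V \<Longrightarrow> l (\<lambda>s. u s + v s) = l u + l v"
  and dual_scale: "l \<in> carr (dual V) \<Longrightarrow> u \<in> carr V \<Longrightarrow> l (\<lambda>s. c * u s) = c * l u"
  by (auto simp: carr_dual)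

lemma dual_diff:
  assumes "l \<in> carr (dual V)" "u \<in> carr V" "v \<in> carr V"
  shows "l (u - v) = l u - l v"
  using dual_add[OF assms(1,2) scale_mem[OF assms(3)], of "-1"] dual_scale[OF assms(1,3), of "-1"]
  by (simp add: fun_diff_def)

lemma dual_bound:
  assumes "l \<in> carr (dual V)"
  obtains B where "B \<ge> 0" "\<And>u. u \<in> carr V \<Longrightarrow> \<bar>l u\<bar> \<le> B * nrm V u"
proof -
  obtain B where B: "\<And>u. u \<in> carr V \<Longrightarrow> \<bar>l u\<bar> \<le> B * nrm V u"
    using assms unfolding carr_dual by blast
  have "\<bar>l u\<bar> \<le> \<bar>B\<bar> * nrm V u" if "u \<in> carr V" for u
    using B[OF that] mult_right_mono[OF abs_ge_self[of B] nrm_nonneg[OF that]] by linarith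
  then show ?thesis using that[of "\<bar>B\<bar>"] by simp
qed

lemma nrm_dual_le:
  assumes "\<And>u. u \<in> carr V \<Longrightarrow> nrm V u \<le> 1 \<Longrightarrow> \<bar>l u\<bar> \<le> B"
  shows "nrm (dual V) l \<le> B"
proof -
  have "Sup {\<bar>l u\<bar> | u. u \<in> carr V \<and> nrm V u \<le> 1} \<le> B"
    using assms zero_mem nrm_zero by (intro cSup_least) (auto intro!: exI[of _ "\<lambda>s. 0"])
  then show ?thesis by (simp add: dual_def)
qed

text \<open>Boundedness of the functional bounds the set of its values on the unit ball; without it
  \<open>Sup\<close> on the reals would carry no information.\<close>

lemma le_nrm_dual:
  assumes "l \<in> carr (dual V)" "u \<in> carr V" "nrm V u \<le> 1"
  shows "\<bar>l u\<bar> \<le> nrm (dual V) l"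
proof -
  obtain B where B: "B \<ge> 0" "\<And>u. u \<in> carr V \<Longrightarrow> \<bar>l u\<bar> \<le> B * nrm V u"
    by (rule dual_bound[OF assms(1)]) blast
  have "bdd_above {\<bar>l u\<bar> | u. u \<in> carr V \<and> nrm V u \<le> 1}"
  proof (rule bdd_aboveI)
    fix x assume "x \<in> {\<bar>l u\<bar> | u. u \<in> carr V \<and> nrm V u \<le> 1}"
    then obtain u where u: "x = \<bar>l u\<bar>" "u \<in> carr V" "nrm V u \<le> 1" by blast
    have "x \<le> B * nrm V u" using B(2) u by simp
    also have "\<dots> \<le> B * 1" using B(1) u by (intro mult_left_mono) auto
    finally show "x \<le> B" by simp
  qed
  then have "\<bar>l u\<bar> \<le> Sup {\<bar>l u\<bar> | u. u \<in> carr V \<and> nrm V u \<le> 1}"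
    by (rule cSup_upper[rotated]) (use assms in auto)
  then show ?thesis by (simp add: dual_def)
qed

text \<open>The added 1 permits a division: the seminorm of \<open>u\<close> may vanish, whereas u /
  (|u| + 1) always lies in the unit ball. The loss is harmless, because the bound only serves to
  show that values vanish or tend to zero.\<close>

lemma abs_le_nrm_dual:
  assumes "l \<in> carr (dual V)" "u \<in> carr V"
  shows "\<bar>l u\<bar> \<le> nrm (dual V) l * (nrm V u + 1)"
proof -
  have k: "nrm V u + 1 > 0" using nrm_nonneg[OF assms(2)] by simp
  define c where "c = inverse (nrm V u + 1)"
  have "\<bar>l (\<lambda>s. c * u s)\<bar> \<le> nrm (dual V) l"
  proof (rule le_nrm_dual[OF assms(1) scale_mem[OF assms(2)]])
    show "nrm V (\<lambda>s. c * u s) \<le> 1"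
    proof -
      have "nrm V (\<lambda>s. c * u s) = c * nrm V u"
        using nrm_scale[OF assms(2), of c] k by (simp add: c_def)
      also have "\<dots> \<le> c * (nrm V u + 1)"
        using k by (intro mult_left_mono) (auto simp: c_def)
      also have "\<dots> = 1" using k by (simp add: c_def)
      finally show ?thesis .
    qed
  qed
  then have "c * \<bar>l u\<bar> \<le> nrm (dual V) l"
    using dual_scale[OF assms, of c] k by (simp add: c_def abs_mult)
  then show ?thesis
    using k unfolding c_def by (simp add: field_simps)
qed

lemma diff_mem_dual:
  assumes "l \<in> carr (dual V)" "k \<in> carr (dual V)"
  shows "l - k \<in> carr (dual V)"
proof -
  obtain B where B: "\<And>u. u \<in> carr V \<Longrightarrow> \<bar>l u\<bar> \<le> B * nrm V u"
    by (rule dual_bound[OF assms(1)]) blast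
  obtain C where C: "\<And>u. u \<in> carr V \<Longrightarrow> \<bar>k u\<bar> \<le> C * nrm V u"
    by (rule dual_bound[OF assms(2)]) blast
  have "\<bar>(l - k) u\<bar> \<le> (B + C) * nrm V u" if "u \<in> carr V" for u
    using B[OF that] C[OF that] abs_triangle_ineq4[of "l u" "k u"] by (simp add: distrib_right)
  then show ?thesis
    using assms unfolding carr_dual by (auto simp: right_diff_distrib intro!: exI[of _ "B + C"])
qed

text \<open>Translates equality as points of the dual, which is the form supplied by
  \<open>iso_inverse_bound\<close>, into equality of values at each element.\<close>

lemma nrm_dual_zeroD:
  assumes "nrm (dual V) (l - k) = 0" "l \<in> carr (dual V)" "k \<in> carr (dual V)" "u \<in> carr V"
  shows "l u = k u"
  using abs_le_nrm_dual[OF diff_mem_dual[OF assms(2,3)] assms(4)] assms(1) by simp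

end

section \<open>Lebesgue spaces\<close>

text \<open>Convexity of t^p at the points x/c and y/(1-c) with weights c and 1-c. Keeping
  \<open>c\<close> free later allows the sharp triangle inequality to be recovered by a choice of
  \<open>c\<close>.\<close>

lemma abs_add_powr_le:
  fixes x y c p :: real
  assumes "p \<ge> 1" "0 < c" "c < 1"
  shows "\<bar>x + y\<bar> powr p \<le> c powr (1 - p) * \<bar>x\<bar> powr p + (1 - c) powr (1 - p) * \<bar>y\<bar> powr p"
proof -
  have pos: "(a + b) powr p \<le> c powr (1 - p) * a powr p + (1 - c) powr (1 - p) * b powr p"
    if "a > 0" "b > 0" for a b :: real
  proof -
    have "((1 - c) * (b / (1 - c)) + c * (a / c)) powr p
        \<le> (1 - c) * (b / (1 - c)) powr p + c * (a / c) powr p"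
      using convex_onD[OF powr_convex[OF assms(1)], of c "b / (1 - c)" "a / c"] assms that
      by simp
    moreover have "c * (a / c) powr p = c powr (1 - p) * a powr p"
      using assms that by (simp add: powr_divide powr_diff)
    moreover have "(1 - c) * (b / (1 - c)) powr p = (1 - c) powr (1 - p) * b powr p"
      using assms that by (simp add: powr_divide powr_diff)
    ultimately show ?thesis
      using assms by (simp add: add.commute)
  qed
  have ge1: "1 \<le> r powr (1 - p)" if "0 < r" "r < 1" for r :: real
    using powr_mono'[of "1 - p" 0 r] that assms by simp
  have "\<bar>x + y\<bar> powr p \<le> (\<bar>x\<bar> + \<bar>y\<bar>) powr p"
    using assms by (intro powr_mono2) auto
  also have "\<dots> \<le> c powr (1 - p) * \<bar>x\<bar> powr p + (1 - c) powr (1 - p) * \<bar>y\<bar> powr p"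
  proof (cases "x = 0 \<or> y = 0")
    case True
    then show ?thesis
      using mult_right_mono[OF ge1[of c], of "\<bar>x\<bar> powr p"]
        mult_right_mono[OF ge1[of "1 - c"], of "\<bar>y\<bar> powr p"] assms by auto
  qed (use pos in auto)
  finally show ?thesis .
qed

text \<open>Minimizing the right-hand side over \<open>c\<close> produces the p-th power of the sum
  of the two roots, attained when \<open>c\<close> is the share of the first root. Being stated for
  numbers, it applies alike to a single integral and to the sum of integrals in the Sobolev
  norm.\<close>

lemma Minkowski_root:
  fixes a b s p :: real
  assumes "p \<ge> 1" "a \<ge> 0" "b \<ge> 0" "s \<ge> 0"
    and le: "\<And>c. 0 < c \<Longrightarrow> c < 1 \<Longrightarrow> s \<le> c powr (1 - p) * a + (1 - c) powr (1 - p) * b"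
  shows "s powr (1 / p) \<le> a powr (1 / p) + b powr (1 / p)"
proof (rule field_le_epsilon)
  fix e :: real assume "e > 0"
  \<comment> \<open>The shift by e/2 keeps both roots positive, so that \<open>c\<close> lies
    strictly between 0 and 1 even when \<open>a\<close> or \<open>b\<close> is 0.\<close>
  define A where "A = a powr (1 / p) + e / 2"
  define B where "B = b powr (1 / p) + e / 2"
  have AB: "A > 0" "B > 0"
    using \<open>e > 0\<close> by (auto simp: A_def B_def add_nonneg_pos)
  have a: "a \<le> A powr p"
  proof -
    have "a = (a powr (1 / p)) powr p"
      using assms by (simp add: powr_powr)
    also have "\<dots> \<le> A powr p"
      using assms \<open>e > 0\<close> by (intro powr_mono2) (auto simp: A_def)
    finally show ?thesis .
  qed
  have b: "b \<le> B powr p"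
  proof -
    have "b = (b powr (1 / p)) powr p"
      using assms by (simp add: powr_powr)
    also have "\<dots> \<le> B powr p"
      using assms \<open>e > 0\<close> by (intro powr_mono2) (auto simp: B_def)
    finally show ?thesis .
  qed
  define c where "c = A / (A + B)"
  have c: "0 < c" "c < 1" "1 - c = B / (A + B)"
    using AB by (auto simp: c_def field_simps)
  have eq: "(X / (A + B)) powr (1 - p) * X powr p = X * (A + B) powr (p - 1)" if "X > 0" for X
  proof -
    have "X powr (1 - p) * X powr p = X"
      using that by (simp flip: powr_add)
    moreover have "1 / (A + B) powr (1 - p) = (A + B) powr (p - 1)"
      by (metis minus_diff_eq powr_minus_divide)
    ultimately show ?thesis
      using that AB by (simp add: powr_divide field_simps)
  qed
  have "s \<le> c powr (1 - p) * a + (1 - c) powr (1 - p) * b"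
    using le c(1,2) by simp
  also have "\<dots> \<le> c powr (1 - p) * A powr p + (1 - c) powr (1 - p) * B powr p"
    using a b by (intro add_mono mult_left_mono) auto
  also have "\<dots> = (A + B) * (A + B) powr (p - 1)"
    unfolding c(3) unfolding c_def using eq[OF AB(1)] eq[OF AB(2)] by (simp add: algebra_simps)
  also have "\<dots> = (A + B) powr p"
    using AB by (simp add: powr_mult_base)
  finally have "s powr (1 / p) \<le> ((A + B) powr p) powr (1 / p)"
    using assms by (intro powr_mono2) auto
  also have "\<dots> = A + B"
    using AB assms by (simp add: powr_powr)
  finally show "s powr (1 / p) \<le> a powr (1 / p) + b powr (1 / p) + e"
    by (simp add: A_def B_def)
qed

lemma carr_Lp: "f \<in> carr (Lp_space D p) \<longleftrightarrow> f \<in> borel_measurable (lebesgue_on D) \<and>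
    integrable (lebesgue_on D) (\<lambda>s. \<bar>f s\<bar> powr p)"
  by (simp add: Lp_space_def)

lemma nrm_Lp: "nrm (Lp_space D p) f = (\<integral>s. \<bar>f s\<bar> powr p \<partial>lebesgue_on D) powr (1 / p)"
  by (simp add: Lp_space_def)

lemma nrm_Lp_nonneg: "0 \<le> nrm (Lp_space D p) f"
  by (simp add: nrm_Lp)

lemma nrm_Lp_powr:
  assumes "p > 0"
  shows "nrm (Lp_space D p) f powr p = (\<integral>s. \<bar>f s\<bar> powr p \<partial>lebesgue_on D)"
  using assms by (simp add: nrm_Lp powr_powr)

lemma Lp_add:
  assumes "p \<ge> 1" "f \<in> carr (Lp_space D p)" "g \<in> carr (Lp_space D p)"
  shows "(\<lambda>s. f s + g s) \<in> carr (Lp_space D p)"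
proof -
  have "integrable (lebesgue_on D) (\<lambda>s. \<bar>f s + g s\<bar> powr p)"
  proof (rule Bochner_Integration.integrable_bound)
    show "integrable (lebesgue_on D)
        (\<lambda>s. (1/2) powr (1 - p) * \<bar>f s\<bar> powr p + (1/2) powr (1 - p) * \<bar>g s\<bar> powr p)"
      using assms by (auto simp: carr_Lp)
    show "AE s in lebesgue_on D. norm (\<bar>f s + g s\<bar> powr p)
       \<le> norm ((1/2) powr (1 - p) * \<bar>f s\<bar> powr p + (1/2) powr (1 - p) * \<bar>g s\<bar> powr p)"
    proof (rule AE_I2)
      fix s
      show "norm (\<bar>f s + g s\<bar> powr p)
         \<le> norm ((1/2) powr (1 - p) * \<bar>f s\<bar> powr p + (1/2) powr (1 - p) * \<bar>g s\<bar> powr p)"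
        using abs_add_powr_le[OF assms(1), of "1/2" "f s" "g s"] by simp
    qed
  qed (use assms in \<open>auto simp: carr_Lp\<close>)
  then show ?thesis using assms by (auto simp: carr_Lp)
qed

lemma Lp_scale:
  assumes "f \<in> carr (Lp_space D p)"
  shows "(\<lambda>s. c * f s) \<in> carr (Lp_space D p)"
  using assms by (auto simp: carr_Lp abs_mult powr_mult)

lemma Lp_integral_scale:
  fixes f :: "real^2 \<Rightarrow> real"
  shows "(\<integral>s. \<bar>c * f s\<bar> powr p \<partial>lebesgue_on D) = \<bar>c\<bar> powr p * (\<integral>s. \<bar>f s\<bar> powr p \<partial>lebesgue_on D)"
  by (simp add: abs_mult powr_mult)

lemma Lp_integral_add_le:
  assumes "p \<ge> 1" "f \<in> carr (Lp_space D p)" "g \<in> carr (Lp_space D p)" "0 < c" "c < 1"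
  shows "(\<integral>s. \<bar>f s + g s\<bar> powr p \<partial>lebesgue_on D) \<le>
    c powr (1 - p) * (\<integral>s. \<bar>f s\<bar> powr p \<partial>lebesgue_on D) +
    (1 - c) powr (1 - p) * (\<integral>s. \<bar>g s\<bar> powr p \<partial>lebesgue_on D)"
proof -
  have "(\<integral>s. \<bar>f s + g s\<bar> powr p \<partial>lebesgue_on D) \<le>
      (\<integral>s. c powr (1 - p) * \<bar>f s\<bar> powr p + (1 - c) powr (1 - p) * \<bar>g s\<bar> powr p \<partial>lebesgue_on D)"
    using assms Lp_add[OF assms(1-3)]
    by (intro integral_mono abs_add_powr_le) (auto simp: carr_Lp)
  also have "\<dots> = c powr (1 - p) * (\<integral>s. \<bar>f s\<bar> powr p \<partial>lebesgue_on D) +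
    (1 - c) powr (1 - p) * (\<integral>s. \<bar>g s\<bar> powr p \<partial>lebesgue_on D)"
    using assms by (subst Bochner_Integration.integral_add) (auto simp: carr_Lp)
  finally show ?thesis .
qed

lemma seminormed_Lp:
  assumes "p \<ge> 1"
  shows "seminormed_fspace (Lp_space D p)"
proof
  show "(\<lambda>s. 0) \<in> carr (Lp_space D p)"
    using assms by (simp add: carr_Lp)
  show "nrm (Lp_space D p) (\<lambda>s. c * u s) = \<bar>c\<bar> * nrm (Lp_space D p) u" for u c
    using assms unfolding nrm_Lp Lp_integral_scale by (simp add: powr_mult powr_powr)
  fix u v assume uv: "u \<in> carr (Lp_space D p)" "v \<in> carr (Lp_space D p)"
  show "nrm (Lp_space D p) (\<lambda>s. u s + v s) \<le> nrm (Lp_space D p) u + nrm (Lp_space D p) v"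
    unfolding nrm_Lp using assms
    by (intro Minkowski_root Lp_integral_add_le[OF assms uv]) auto
qed (use assms Lp_add Lp_scale in auto)

section \<open>Inclusions of Lebesgue spaces on sets of finite measure\<close>

lemma powr_le_one_plus_powr:
  fixes x p q :: real
  assumes "0 \<le> q" "q \<le> p" "0 \<le> x"
  shows "x powr q \<le> 1 + x powr p"
proof (cases "x \<le> 1")
  case True
  then have "x powr q \<le> 1" using assms by (simp add: powr_le1)
  then show ?thesis using powr_ge_zero[of x p] by linarith
next
  case False
  then show ?thesis using powr_mono[OF assms(2), of x] by linarith
qed

text \<open>Serves homogeneity arguments: dividing by the norm plus \<open>e\<close> instead of the
  norm avoids the case of a vanishing seminorm, and \<open>e\<close> is removed at the end.\<close>

lemma le_mult_if_le_mult_add: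
  fixes a b C :: real
  assumes "C \<ge> 0" "\<And>e. e > 0 \<Longrightarrow> a \<le> C * (b + e)"
  shows "a \<le> C * b"
proof (rule field_le_epsilon)
  fix e :: real assume e: "e > 0"
  have "a \<le> C * (b + e / (C + 1))"
    using assms e by (intro assms(2)) auto
  also have "\<dots> = C * b + C / (C + 1) * e" by (simp add: algebra_simps)
  also have "\<dots> \<le> C * b + 1 * e"
    using assms(1) e by (intro add_left_mono mult_right_mono) auto
  finally show "a \<le> C * b + e" by simp
qed

lemma Lp_subset:
  assumes "D \<in> lmeasurable" "1 \<le> q" "q \<le> p" "f \<in> carr (Lp_space D p)"
  shows "f \<in> carr (Lp_space D q)"
proof -
  interpret finite_measure "lebesgue_on D"
    using assms(1) by (rule finite_measure_lebesgue_on)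
  have "integrable (lebesgue_on D) (\<lambda>s. \<bar>f s\<bar> powr q)"
  proof (rule Bochner_Integration.integrable_bound)
    show "integrable (lebesgue_on D) (\<lambda>s. 1 + \<bar>f s\<bar> powr p)"
      using assms by (auto simp: carr_Lp)
    show "AE s in lebesgue_on D. norm (\<bar>f s\<bar> powr q) \<le> norm (1 + \<bar>f s\<bar> powr p)"
    proof (rule AE_I2)
      fix s
      show "norm (\<bar>f s\<bar> powr q) \<le> norm (1 + \<bar>f s\<bar> powr p)"
        using powr_le_one_plus_powr[of q p "\<bar>f s\<bar>"] assms by (simp add: add_nonneg_nonneg)
    qed
  qed (use assms in \<open>auto simp: carr_Lp\<close>)
  then show ?thesis using assms by (simp add: carr_Lp)
qed

text \<open>On the unit ball of L^p the inequality t^q \<le> 1 + t^p bounds the integral of the q-th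
  power by 1 + |D|, and the q-th root of a number that is at least 1 does not exceed it; scaling
  does the rest. The constant is cruder than Hoelder's, but only continuity of the inclusion
  matters.\<close>

lemma Lp_nrm_le:
  assumes "D \<in> lmeasurable" "1 \<le> q" "q \<le> p" "f \<in> carr (Lp_space D p)"
  shows "nrm (Lp_space D q) f \<le> (1 + measure lebesgue D) * nrm (Lp_space D p) f"
proof -
  interpret P: seminormed_fspace "Lp_space D p" using assms by (intro seminormed_Lp) auto
  interpret Q: seminormed_fspace "Lp_space D q" using assms by (intro seminormed_Lp) auto
  interpret finite_measure "lebesgue_on D"
    using assms(1) by (rule finite_measure_lebesgue_on)
  have D: "measure (lebesgue_on D) D = measure lebesgue D"
    using assms(1) by (simp add: measure_restrict_space fmeasurable_def)
  have unit: "nrm (Lp_space D q) g \<le> 1 + measure lebesgue D"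
    if g: "g \<in> carr (Lp_space D p)" "nrm (Lp_space D p) g \<le> 1" for g
  proof -
    have "(\<integral>s. \<bar>g s\<bar> powr p \<partial>lebesgue_on D) = nrm (Lp_space D p) g powr p"
      using assms by (simp add: nrm_Lp_powr)
    also have "\<dots> \<le> 1"
      using g assms by (intro powr_le1) (auto simp: nrm_Lp_nonneg)
    finally have *: "(\<integral>s. \<bar>g s\<bar> powr p \<partial>lebesgue_on D) \<le> 1" .
    have "(\<integral>s. \<bar>g s\<bar> powr q \<partial>lebesgue_on D) \<le> (\<integral>s. 1 + \<bar>g s\<bar> powr p \<partial>lebesgue_on D)"
      using g Lp_subset[OF assms(1-3) g(1)] assms
      by (intro integral_mono powr_le_one_plus_powr) (auto simp: carr_Lp)
    also have "\<dots> = measure lebesgue D + (\<integral>s. \<bar>g s\<bar> powr p \<partial>lebesgue_on D)"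
      using g by (subst Bochner_Integration.integral_add) (auto simp: carr_Lp D)
    also have "\<dots> \<le> 1 + measure lebesgue D"
      using * by simp
    finally have "nrm (Lp_space D q) g \<le> (1 + measure lebesgue D) powr (1 / q)"
      unfolding nrm_Lp using assms by (intro powr_mono2) auto
    also have "\<dots> \<le> (1 + measure lebesgue D) powr 1"
      using assms by (intro powr_mono) auto
    finally show ?thesis by simp
  qed
  show ?thesis
  proof (rule le_mult_if_le_mult_add)
    show "0 \<le> 1 + measure lebesgue D" by simp
    fix e :: real assume e: "e > 0"
    define N where "N = nrm (Lp_space D p) f + e"
    have N: "N > 0" using e by (simp add: N_def nrm_Lp_nonneg add_nonneg_pos)
    have "nrm (Lp_space D q) (\<lambda>s. inverse N * f s) \<le> 1 + measure lebesgue D"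
    proof (rule unit)
      show "(\<lambda>s. inverse N * f s) \<in> carr (Lp_space D p)" by (rule P.scale_mem) fact
      have "nrm (Lp_space D p) (\<lambda>s. inverse N * f s) = nrm (Lp_space D p) f / N"
        using P.nrm_scale[OF assms(4), of "inverse N"] N by (simp add: field_simps)
      also have "\<dots> \<le> 1" using N e by (simp add: N_def)
      finally show "nrm (Lp_space D p) (\<lambda>s. inverse N * f s) \<le> 1" .
    qed
    also have "nrm (Lp_space D q) (\<lambda>s. inverse N * f s) = nrm (Lp_space D q) f / N"
      using Q.nrm_scale[OF Lp_subset[OF assms], of "inverse N"] N by (simp add: field_simps)
    finally show "nrm (Lp_space D q) f \<le> (1 + measure lebesgue D) * (nrm (Lp_space D p) f + e)"
      using N by (simp add: N_def field_simps)
  qed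
qed

section \<open>Products of square-integrable functions\<close>

lemma carr_L2: "f \<in> carr (Lp_space D 2) \<longleftrightarrow> f \<in> borel_measurable (lebesgue_on D) \<and>
    integrable (lebesgue_on D) (\<lambda>s. (f s)\<^sup>2)"
  by (simp add: carr_Lp powr_numeral)

lemma nrm_L2_sq: "(nrm (Lp_space D 2) f)\<^sup>2 = (\<integral>s. (f s)\<^sup>2 \<partial>lebesgue_on D)"
  using nrm_Lp_powr[of 2 D f] by (simp add: powr_numeral nrm_Lp_nonneg)

lemma L2_mult_integrable:
  assumes "f \<in> carr (Lp_space D 2)" "g \<in> carr (Lp_space D 2)"
  shows "integrable (lebesgue_on D) (\<lambda>s. f s * g s)"
proof (rule Bochner_Integration.integrable_bound)
  show "integrable (lebesgue_on D) (\<lambda>s. (f s)\<^sup>2 + (g s)\<^sup>2)"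
    using assms by (simp add: carr_L2)
  show "AE s in lebesgue_on D. norm (f s * g s) \<le> norm ((f s)\<^sup>2 + (g s)\<^sup>2)"
  proof (rule AE_I2)
    fix s
    have "2 * (\<bar>f s\<bar> * \<bar>g s\<bar>) \<le> (f s)\<^sup>2 + (g s)\<^sup>2"
      using sum_squares_bound[of "\<bar>f s\<bar>" "\<bar>g s\<bar>"] by (simp add: mult.assoc)
    moreover have "0 \<le> \<bar>f s\<bar> * \<bar>g s\<bar>" by simp
    ultimately show "norm (f s * g s) \<le> norm ((f s)\<^sup>2 + (g s)\<^sup>2)"
      unfolding real_norm_def abs_mult by linarith
  qed
qed (use assms in \<open>auto simp: carr_L2\<close>)

lemma L2_Cauchy_Schwarz:
  assumes "f \<in> carr (Lp_space D 2)" "g \<in> carr (Lp_space D 2)"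
  shows "(\<integral>s. \<bar>f s * g s\<bar> \<partial>lebesgue_on D) \<le> nrm (Lp_space D 2) f * nrm (Lp_space D 2) g"
proof -
  have f: "f \<in> borel_measurable (lebesgue_on D)" "integrable (lebesgue_on D) (\<lambda>s. (f s)\<^sup>2)"
    and g: "g \<in> borel_measurable (lebesgue_on D)" "integrable (lebesgue_on D) (\<lambda>s. (g s)\<^sup>2)"
    using assms by (auto simp: carr_L2)
  have eq: "(\<integral>\<^sup>+s. (ennreal \<bar>h s\<bar>)\<^sup>2 \<partial>lebesgue_on D) = ennreal ((nrm (Lp_space D 2) h)\<^sup>2)"
    if "integrable (lebesgue_on D) (\<lambda>s. (h s)\<^sup>2)" for h
    using nn_integral_eq_integral[OF that] by (simp add: nrm_L2_sq ennreal_power)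
  have "(\<integral>\<^sup>+s. ennreal \<bar>f s\<bar> * ennreal \<bar>g s\<bar> \<partial>lebesgue_on D) = ennreal (\<integral>s. \<bar>f s * g s\<bar> \<partial>lebesgue_on D)"
    using nn_integral_eq_integral[OF integrable_abs[OF L2_mult_integrable[OF assms]]]
    by (simp add: abs_mult ennreal_mult)
  moreover have "(\<integral>\<^sup>+s. ennreal \<bar>f s\<bar> * ennreal \<bar>g s\<bar> \<partial>lebesgue_on D)\<^sup>2 \<le>
      (\<integral>\<^sup>+s. (ennreal \<bar>f s\<bar>)\<^sup>2 \<partial>lebesgue_on D) * (\<integral>\<^sup>+s. (ennreal \<bar>g s\<bar>)\<^sup>2 \<partial>lebesgue_on D)"
    using f g by (intro Cauchy_Schwarz_nn_integral) auto
  ultimately have "ennreal ((\<integral>s. \<bar>f s * g s\<bar> \<partial>lebesgue_on D)\<^sup>2) \<le>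
      ennreal ((nrm (Lp_space D 2) f * nrm (Lp_space D 2) g)\<^sup>2)"
    unfolding eq[OF f(2)] eq[OF g(2)]
    by (simp add: ennreal_power ennreal_mult'' power_mult_distrib)
  then have "(\<integral>s. \<bar>f s * g s\<bar> \<partial>lebesgue_on D)\<^sup>2 \<le> (nrm (Lp_space D 2) f * nrm (Lp_space D 2) g)\<^sup>2"
    by simp
  then show ?thesis
    by (rule power2_le_imp_le) (simp add: nrm_Lp_nonneg)
qed

lemma L2_Cauchy_Schwarz':
  assumes "f \<in> carr (Lp_space D 2)" "g \<in> carr (Lp_space D 2)"
  shows "\<bar>\<integral>s. f s * g s \<partial>lebesgue_on D\<bar> \<le> nrm (Lp_space D 2) f * nrm (Lp_space D 2) g"
  using order_trans[OF integral_norm_bound[of "lebesgue_on D" "\<lambda>s. f s * g s"]] L2_Cauchy_Schwarz[OF assms]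
  by (simp only: real_norm_def)

section \<open>Test functions\<close>

lemma partial_deriv_eq:
  assumes "(f has_derivative f') (at s)"
  shows "partial_deriv i f s = f' (axis i 1)"
  using assms by (simp add: partial_deriv_def frechet_derivative_at[symmetric])

lemma differentiable_frechet: 
  "f differentiable (at s) \<Longrightarrow> (f has_derivative frechet_derivative f (at s)) (at s)"
  using frechet_derivative_works by blast

text \<open>Only the step from one derivative to none has content: differentiability everywhere
  implies continuity. Higher orders reduce to the partial derivatives.\<close>

lemma Ck_SucD: "Ck (Suc k) f \<Longrightarrow> Ck k f"
proof (induction k arbitrary: f)
  case 0
  then show ?case
    by (auto intro!: continuous_at_imp_continuous_on differentiable_imp_continuous_within)
qed simp

lemma partial_deriv_add:
  assumes "\<And>s. f differentiable (at s)" "\<And>s. g differentiable (at s)"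
  shows "partial_deriv i (\<lambda>s. f s + g s) = (\<lambda>s. partial_deriv i f s + partial_deriv i g s)"
proof
  fix s
  show "partial_deriv i (\<lambda>s. f s + g s) s = partial_deriv i f s + partial_deriv i g s"
    using partial_deriv_eq[OF has_derivative_add[OF differentiable_frechet[OF assms(1)] differentiable_frechet[OF assms(2)]]]
    by (simp add: partial_deriv_def)
qed

lemma partial_deriv_mult:
  assumes "\<And>s. f differentiable (at s)" "\<And>s. g differentiable (at s)"
  shows "partial_deriv i (\<lambda>s. f s * g s) = (\<lambda>s. f s * partial_deriv i g s + partial_deriv i f s * g s)"
proof
  fix s
  show "partial_deriv i (\<lambda>s. f s * g s) s = f s * partial_deriv i g s + partial_deriv i f s * g s"
    using partial_deriv_eq[OF has_derivative_mult[OF differentiable_frechet[OF assms(1)] differentiable_frechet[OF assms(2)]]]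
    by (simp add: partial_deriv_def)
qed

lemma partial_deriv_compose:
  assumes "\<And>s. f differentiable (at s)" "\<And>x. (g has_real_derivative g' x) (at x)"
  shows "partial_deriv i (\<lambda>s. g (f s)) = (\<lambda>s. g' (f s) * partial_deriv i f s)"
proof
  fix s
  have "((\<lambda>s. g (f s)) has_derivative (\<lambda>h. g' (f s) * frechet_derivative f (at s) h)) (at s)"
    using has_derivative_compose[OF differentiable_frechet[OF assms(1)], of g "(*) (g' (f s))"] assms(2)
    by (simp add: has_field_derivative_def)
  from partial_deriv_eq[OF this]
  show "partial_deriv i (\<lambda>s. g (f s)) s = g' (f s) * partial_deriv i f s"
    by (simp add: partial_deriv_def)
qed

lemma partial_deriv_const: "partial_deriv i (\<lambda>s. c) = (\<lambda>s. 0)"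
proof
  fix s show "partial_deriv i (\<lambda>s. c) s = 0"
    using partial_deriv_eq[of "\<lambda>s. c" "\<lambda>_. 0"] by simp
qed

lemma Ck_const: "Ck k (\<lambda>s. c)"
  by (induction k arbitrary: c) (auto simp: partial_deriv_const)

lemma Ck_add: "Ck k f \<Longrightarrow> Ck k g \<Longrightarrow> Ck k (\<lambda>s. f s + g s)"
proof (induction k arbitrary: f g)
  case 0
  then show ?case by (auto intro: continuous_intros)
next
  case (Suc k)
  then show ?case by (simp add: partial_deriv_add)
qed

lemma Ck_mult: "Ck k f \<Longrightarrow> Ck k g \<Longrightarrow> Ck k (\<lambda>s. f s * g s)"
proof (induction k arbitrary: f g)
  case 0
  then show ?case by (auto intro: continuous_intros)
next
  case (Suc k)
  have "Ck k f" "Ck k g" using Suc.prems Ck_SucD by blast+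
  then show ?case using Suc by (simp add: partial_deriv_mult Ck_add)
qed

text \<open>The partial derivative of exp(f) contains the same exponential as a factor, whose
  regularity one order lower is the induction hypothesis.\<close>

lemma Ck_exp: "Ck k f \<Longrightarrow> Ck k (\<lambda>s. exp (f s))"
proof (induction k arbitrary: f)
  case 0
  then show ?case by (auto intro: continuous_intros)
next
  case (Suc k)
  have d: "\<And>s. f differentiable (at s)" using Suc.prems by simp
  have e: "(\<lambda>s. exp (f s)) differentiable (at s)" for s
    using has_derivative_exp[OF differentiable_frechet[OF d]] by (rule differentiableI)
  have "partial_deriv i (\<lambda>s. exp (f s)) = (\<lambda>s. exp (f s) * partial_deriv i f s)" for i
    by (rule partial_deriv_compose[OF d]) (rule DERIV_exp)
  then show ?case
    using Suc e by (simp add: Ck_mult Ck_SucD[OF Suc.prems])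
qed

text \<open>The family is closed under differentiation up to linear combinations; \<open>flat_exp 0\<close> is the
  classical smooth function that is positive exactly on the positive half line.\<close>

definition flat_exp :: "nat \<Rightarrow> real \<Rightarrow> real" where
  "flat_exp m x = (if x \<le> 0 then 0 else exp (- 1 / x) / x ^ m)"

text \<open>Under the substitution of 1/x for x this is the decay of x^m / exp x at
  infinity.\<close>

lemma flat_tendsto_0: "((\<lambda>x. exp (- 1 / x) / x ^ m) \<longlongrightarrow> 0) (at_right (0::real))"
proof -
  have "((\<lambda>x. exp (- 1 / inverse x) / inverse x ^ m) \<longlongrightarrow> (0::real)) at_top"
  proof (rule Lim_transform_eventually)
    show "((\<lambda>x. x ^ m / exp x) \<longlongrightarrow> (0::real)) at_top"
      by (rule tendsto_power_div_exp_0)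
    show "\<forall>\<^sub>F x in at_top. (x::real) ^ m / exp x = exp (- 1 / inverse x) / inverse x ^ m"
      using eventually_gt_at_top[of "0::real"]
      by eventually_elim (simp add: exp_minus divide_inverse power_inverse mult.commute)
  qed
  then show ?thesis
    by (simp add: at_right_to_top filterlim_filtermap)
qed

text \<open>Differentiating exp(-1/x) / x^m raises the power in the denominator by one through x^m
  and by two through exp(-1/x). At the origin the right difference quotient is again a member of the
  family, with parameter m+1, and tends to 0.\<close>

lemma flat_deriv: "(flat_exp m has_real_derivative (- real m * flat_exp (m + 1) x + flat_exp (m + 2) x)) (at x)"
proof -
  consider "x < 0" | "x > 0" | "x = 0" by linarith
  then show ?thesis
  proof cases
    case 1
    have "((\<lambda>x. 0) has_real_derivative 0) (at x)" by simp
    then have "(flat_exp m has_real_derivative 0) (at x)"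
      by (rule has_field_derivative_transform_within_open[where S="{..<0}"]) (use 1 in \<open>auto simp: flat_exp_def\<close>)
    then show ?thesis using 1 by (simp add: flat_exp_def)
  next
    case 2
    have "((\<lambda>x. exp (- 1 / x) / x ^ m) has_real_derivative
        ((exp (- 1 / x) * (1 / x^2)) * x ^ m - exp (- 1 / x) * (real m * x ^ (m - 1))) / (x ^ m * x ^ m)) (at x)"
      using 2 by (auto intro!: derivative_eq_intros simp: power2_eq_square)
    moreover have "((exp (- 1 / x) * (1 / x^2)) * x ^ m - exp (- 1 / x) * (real m * x ^ (m - 1))) / (x ^ m * x ^ m)
      = - real m * flat_exp (m + 1) x + flat_exp (m + 2) x"
      using 2 by (cases m) (auto simp: flat_exp_def field_simps power2_eq_square)
    ultimately have "((\<lambda>x. exp (- 1 / x) / x ^ m) has_real_derivative (- real m * flat_exp (m + 1) x + flat_exp (m + 2) x)) (at x)"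
      by simp
    then show ?thesis
      by (rule has_field_derivative_transform_within_open[where S="{0<..}"]) (use 2 in \<open>auto simp: flat_exp_def\<close>)
  next
    case 3
    have "((\<lambda>h. (flat_exp m (0 + h) - flat_exp m 0) / h) \<longlongrightarrow> 0) (at 0)"
      unfolding filterlim_split_at_real
    proof (rule filterlim_split_at)
      show "((\<lambda>h. (flat_exp m (0 + h) - flat_exp m 0) / h) \<longlongrightarrow> 0) (at_left 0)"
        by (rule Lim_transform_eventually[OF tendsto_const])
          (auto simp: eventually_at_filter flat_exp_def)
      show "((\<lambda>h. (flat_exp m (0 + h) - flat_exp m 0) / h) \<longlongrightarrow> 0) (at_right 0)"
        by (rule Lim_transform_eventually[OF flat_tendsto_0[of "Suc m"]])
          (auto simp: eventually_at_filter flat_exp_def field_simps)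
    qed
    then show ?thesis using 3 by (simp add: DERIV_def flat_exp_def)
  qed
qed

text \<open>The induction ranges over all \<open>m\<close>, since each derivative trades
  \<open>m\<close> for m+1 and m+2. Affine functions of one coordinate are the right arguments
  because a bump is a product over the four sides of a box.\<close>

lemma Ck_flat_affine: "Ck k (\<lambda>s. flat_exp m (c * s $ i + d))"
proof (induction k arbitrary: m)
  case 0
  have "continuous_on UNIV (flat_exp m)"
    using flat_deriv DERIV_isCont by (blast intro: continuous_at_imp_continuous_on)
  then have "continuous_on UNIV (flat_exp m \<circ> (\<lambda>s. c * s $ i + d))"
    by (intro continuous_on_compose continuous_intros) (auto intro: continuous_on_subset)
  then show ?case by (simp add: o_def)
next
  case (Suc k)
  have L: "((\<lambda>s::real^2. c * s $ i + d) has_derivative (\<lambda>h. c * h $ i)) (at s)" for s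
    by (auto intro!: derivative_eq_intros bounded_linear.has_derivative[OF bounded_linear_vec_nth])
  have d: "((\<lambda>s::real^2. flat_exp m (c * s $ i + d)) has_derivative
      (\<lambda>h. (- real m * flat_exp (m + 1) (c * s $ i + d) + flat_exp (m + 2) (c * s $ i + d)) * (c * h $ i))) (at s)" for s
    using has_derivative_compose[OF L flat_deriv[unfolded has_field_derivative_def]] by simp
  have "partial_deriv j (\<lambda>s. flat_exp m (c * s $ i + d)) =
      (\<lambda>s. (- real m * flat_exp (m + 1) (c * s $ i + d) + flat_exp (m + 2) (c * s $ i + d)) * (c * axis j 1 $ i))" for j
    using partial_deriv_eq[OF d] by blast
  moreover have "Ck k (\<lambda>s. (- real m * flat_exp (m + 1) (c * s $ i + d) + flat_exp (m + 2) (c * s $ i + d)) * (c * axis j 1 $ i))" for j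
    by (intro Ck_mult Ck_add Ck_const Suc)
  ultimately show ?case
    using d by (simp only: Ck.simps) (blast intro: differentiableI)
qed

section \<open>Supports and algebra of test functions\<close>

lemma test_functionsI:
  assumes "\<And>k. Ck k \<phi>" "compact K" "K \<subseteq> D" "\<And>s. s \<notin> K \<Longrightarrow> \<phi> s = 0"
  shows "\<phi> \<in> test_functions D"
proof -
  have sub: "closure {s. \<phi> s \<noteq> 0} \<subseteq> K"
    using assms(2,4) by (intro closure_minimal) (auto simp: compact_imp_closed)
  then have "compact (closure {s. \<phi> s \<noteq> 0})"
    using compact_Int_closed[OF assms(2) closed_closure, of "{s. \<phi> s \<noteq> 0}"] by (simp add: Int_absorb1)
  then show ?thesis
    using assms sub by (auto simp: test_functions_def)
qed

lemma test_functionsE: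
  assumes "\<phi> \<in> test_functions D"
  obtains K where "compact K" "K \<subseteq> D" "\<And>s. s \<notin> K \<Longrightarrow> \<phi> s = 0"
    "\<And>s i. s \<notin> K \<Longrightarrow> partial_deriv i \<phi> s = 0"
proof
  let ?K = "closure {s. \<phi> s \<noteq> 0}"
  show "compact ?K" "?K \<subseteq> D" using assms by (auto simp: test_functions_def)
  show z: "\<phi> s = 0" if "s \<notin> ?K" for s
    using that closure_subset[of "{s. \<phi> s \<noteq> 0}"] by blast
  fix s i assume s: "s \<notin> ?K"
  \<comment> \<open>Off its closed support the function is zero on an open set, so its derivative
    vanishes there as well.\<close>
  have "(\<phi> has_derivative (\<lambda>_. 0)) (at s)"
  proof (rule has_derivative_transform_within_open)
    show "((\<lambda>_. 0) has_derivative (\<lambda>_. 0)) (at s)" by (rule has_derivative_const)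
    show "open (- ?K)" by (intro open_Compl closed_closure)
    show "s \<in> - ?K" using s by blast
    show "0 = \<phi> x" if "x \<in> - ?K" for x using that by (intro z[symmetric]) blast
  qed
  from partial_deriv_eq[OF this] show "partial_deriv i \<phi> s = 0" by simp
qed

lemma test_functions_Ck: "\<phi> \<in> test_functions D \<Longrightarrow> Ck k \<phi>"
  by (simp add: test_functions_def)

lemma test_functions_differentiable: "\<phi> \<in> test_functions D \<Longrightarrow> \<phi> differentiable (at s)"
  using test_functions_Ck[of \<phi> D "Suc 0"] by simp

lemma test_functions_partial_continuous: "\<phi> \<in> test_functions D \<Longrightarrow> continuous_on UNIV (partial_deriv i \<phi>)"
  using test_functions_Ck[of \<phi> D "Suc 0"] by simp

lemma test_functions_continuous: "\<phi> \<in> test_functions D \<Longrightarrow> continuous_on UNIV \<phi>"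
  using test_functions_Ck[of \<phi> D 0] by simp

lemma test_functions_zero: "(\<lambda>s. 0) \<in> test_functions D"
  by (rule test_functionsI[where K="{}"]) (auto simp: Ck_const)

lemma test_functions_add:
  assumes "\<phi> \<in> test_functions D" "\<eta> \<in> test_functions D"
  shows "(\<lambda>s. \<phi> s + \<eta> s) \<in> test_functions D"
proof -
  obtain K where K: "compact K" "K \<subseteq> D" "\<And>s. s \<notin> K \<Longrightarrow> \<phi> s = 0"
    by (rule test_functionsE[OF assms(1)]) blast
  obtain L where L: "compact L" "L \<subseteq> D" "\<And>s. s \<notin> L \<Longrightarrow> \<eta> s = 0"
    by (rule test_functionsE[OF assms(2)]) blast
  show ?thesis
  proof (rule test_functionsI[where K="K \<union> L"])
    show "Ck k (\<lambda>s. \<phi> s + \<eta> s)" for k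
      by (intro Ck_add test_functions_Ck[OF assms(1)] test_functions_Ck[OF assms(2)])
  qed (use K L in auto)
qed

lemma test_functions_mult:
  assumes "\<phi> \<in> test_functions D" "\<eta> \<in> test_functions D"
  shows "(\<lambda>s. \<phi> s * \<eta> s) \<in> test_functions D"
proof -
  obtain K where K: "compact K" "K \<subseteq> D" "\<And>s. s \<notin> K \<Longrightarrow> \<phi> s = 0"
    by (rule test_functionsE[OF assms(1)]) blast
  show ?thesis
  proof (rule test_functionsI[where K=K])
    show "Ck k (\<lambda>s. \<phi> s * \<eta> s)" for k
      by (intro Ck_mult test_functions_Ck[OF assms(1)] test_functions_Ck[OF assms(2)])
  qed (use K in auto)
qed

lemma test_functions_scale:
  assumes "\<phi> \<in> test_functions D"
  shows "(\<lambda>s. c * \<phi> s) \<in> test_functions D"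
proof -
  obtain K where K: "compact K" "K \<subseteq> D" "\<And>s. s \<notin> K \<Longrightarrow> \<phi> s = 0"
    by (rule test_functionsE[OF assms]) blast
  show ?thesis
  proof (rule test_functionsI[where K=K])
    show "Ck k (\<lambda>s. c * \<phi> s)" for k
      by (intro Ck_mult Ck_const test_functions_Ck[OF assms])
  qed (use K in auto)
qed

lemma continuous_compact_support_bounded:
  fixes f :: "real^2 \<Rightarrow> real"
  assumes "continuous_on UNIV f" "compact K" "\<And>s. s \<notin> K \<Longrightarrow> f s = 0"
  obtains B where "B \<ge> 0" "\<And>s. \<bar>f s\<bar> \<le> B"
proof -
  have "compact (f ` K)"
    using assms by (intro compact_continuous_image) (auto intro: continuous_on_subset)
  then obtain B where B: "\<And>s. s \<in> K \<Longrightarrow> \<bar>f s\<bar> \<le> B"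
    using compact_imp_bounded bounded_iff by (metis (mono_tags, opaque_lifting) imageI real_norm_def)
  then have "\<bar>f s\<bar> \<le> max B 0" for s
    using assms(3)[of s] by (cases "s \<in> K") (auto simp: max.coboundedI1)
  then show ?thesis by (intro that[of "max B 0"]) auto
qed

text \<open>For a smooth \<open>F\<close> that is zero off the box and positive on it, 1 - exp(-n F)
  stays between 0 and 1, vanishes off the box and increases to its indicator. The exponential
  provides the truncation at height 1 without loss of smoothness.\<close>

lemma bump_sequence:
  fixes a b :: "real^2"
  assumes "closure (box a b) \<subseteq> D"
  obtains \<phi> where "\<And>n::nat. \<phi> n \<in> test_functions D" "\<And>n s. \<bar>\<phi> n s\<bar> \<le> 1"
    "\<And>n s. s \<notin> box a b \<Longrightarrow> \<phi> n s = 0" "\<And>s. s \<in> box a b \<Longrightarrow> (\<lambda>n. \<phi> n s) \<longlonglongrightarrow> 1"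
proof
  define F where "F s = (flat_exp 0 (1 * s $ 1 + - (a $ 1)) * flat_exp 0 ((-1) * s $ 1 + b $ 1)) *
     (flat_exp 0 (1 * s $ 2 + - (a $ 2)) * flat_exp 0 ((-1) * s $ 2 + b $ 2))" for s :: "real^2"
  define \<phi> where "\<phi> n s = 1 + (-1) * exp ((- real n) * F s)" for n and s :: "real^2"
  have Ck: "Ck k F" for k
    unfolding F_def by (intro Ck_mult Ck_flat_affine)
  have F0: "F s \<ge> 0" for s by (simp add: F_def flat_exp_def)
  have box: "s \<in> box a b \<longleftrightarrow> F s > 0" for s
    by (auto simp: mem_box_cart F_def flat_exp_def forall_2)
  show z: "\<phi> n s = 0" if "s \<notin> box a b" for n s
    using that box[of s] F0[of s] by (simp add: \<phi>_def)
  show "\<phi> n \<in> test_functions D" for n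
  proof (rule test_functionsI)
    show "Ck k (\<phi> n)" for k
      unfolding \<phi>_def by (intro Ck_mult Ck_add Ck_exp Ck_const Ck)
    show "compact (closure (box a b))" by (simp add: bounded_box compact_closure)
    show "closure (box a b) \<subseteq> D" by fact
    show "s \<notin> closure (box a b) \<Longrightarrow> \<phi> n s = 0" for s
      using z closure_subset by blast
  qed
  show "\<bar>\<phi> n s\<bar> \<le> 1" for n s
    using F0[of s] by (simp add: \<phi>_def)
  show "(\<lambda>n. \<phi> n s) \<longlonglongrightarrow> 1" if "s \<in> box a b" for s
  proof -
    have "(\<lambda>n. 1 + (-1) * exp ((- real n) * x)) \<longlonglongrightarrow> 1" if "x > 0" for x
      using that by real_asymp
    then show ?thesis using that box[of s] unfolding \<phi>_def by blast
  qed
qed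

section \<open>Weak gradients\<close>

lemma complete_lebesgue_on:
  assumes "D \<in> sets lebesgue"
  shows "complete_measure (lebesgue_on D)"
proof
  fix A B :: "'a set" assume B: "B \<subseteq> A" "A \<in> null_sets (lebesgue_on D)"
  have "A \<subseteq> D" "A \<in> null_sets lebesgue"
    using B(2) assms null_sets_restrict_space[of D lebesgue A] by auto
  then have "B \<subseteq> D" "B \<in> null_sets lebesgue"
    using B(1) completion.complete2 by blast+
  then show "B \<in> sets (lebesgue_on D)"
    using assms null_sets_restrict_space[of D lebesgue B] by auto
qed

lemma open_in_lebesgue: "open D \<Longrightarrow> D \<in> sets lebesgue"
  by (simp add: borel_open sets_completionI_sets)

text \<open>The definitions integrate over \<open>lebesgue_on D\<close>, while translations,
  dilations and Fubini are applied to \<open>lborel\<close>; Borel functions that vanish off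
  \<open>D\<close> pass between the two.\<close>

lemma integral_lebesgue_on_vanishing:
  fixes f :: "'a::euclidean_space \<Rightarrow> real"
  assumes "D \<in> sets lebesgue" "f \<in> borel_measurable borel" "\<And>s. s \<notin> D \<Longrightarrow> f s = 0"
  shows "(\<integral>s. f s \<partial>lebesgue_on D) = (\<integral>s. f s \<partial>lborel)"
    and "integrable (lebesgue_on D) f \<longleftrightarrow> integrable lborel f"
proof -
  have eq: "(\<lambda>s. indicator D s * f s) = f"
    using assms(3) by (auto simp: fun_eq_iff split: split_indicator)
  show "(\<integral>s. f s \<partial>lebesgue_on D) = (\<integral>s. f s \<partial>lborel)"
    using assms(1,2) by (simp add: integral_restrict_space eq integral_completion)
  show "integrable (lebesgue_on D) f \<longleftrightarrow> integrable lborel f"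
    using assms(1,2) by (simp add: integrable_restrict_space eq integrable_completion)
qed

lemma continuous_compact_support_integrable:
  fixes f :: "'a::euclidean_space \<Rightarrow> real"
  assumes "continuous_on UNIV f" "compact K" "\<And>s. s \<notin> K \<Longrightarrow> f s = 0"
  shows "integrable lborel f"
proof -
  have "integrable lborel (\<lambda>s. indicator K s *\<^sub>R f s)"
    using assms by (intro borel_integrable_compact) (auto intro: continuous_on_subset)
  moreover have "(\<lambda>s. indicator K s *\<^sub>R f s) = f"
    using assms(3) by (auto simp: fun_eq_iff split: split_indicator)
  ultimately show ?thesis by simp
qed

section \<open>Integration by parts\<close>

lemma line_partial_deriv:
  assumes "\<And>s. \<phi> differentiable (at s)"
  shows "((\<lambda>t. \<phi> (s + t *\<^sub>R axis i 1)) has_real_derivative partial_deriv i \<phi> (s + t *\<^sub>R axis i 1)) (at t)"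
proof -
  have "((\<lambda>t. s + t *\<^sub>R axis i 1) has_derivative (\<lambda>h. h *\<^sub>R axis i 1)) (at t)"
    by (auto intro!: derivative_eq_intros)
  from has_derivative_compose[OF this differentiable_frechet[OF assms]]
  have d: "((\<lambda>t. \<phi> (s + t *\<^sub>R axis i 1)) has_derivative
      (\<lambda>h. frechet_derivative \<phi> (at (s + t *\<^sub>R axis i 1)) (h *\<^sub>R axis i 1))) (at t)" .
  have "linear (frechet_derivative \<phi> (at (s + t *\<^sub>R axis i 1)))"
    using assms linear_frechet_derivative by blast
  then have "frechet_derivative \<phi> (at (s + t *\<^sub>R axis i 1)) (h *\<^sub>R axis i 1) =
      partial_deriv i \<phi> (s + t *\<^sub>R axis i 1) * h" for h
    by (simp add: linear_scale partial_deriv_def mult.commute)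
  then have "(\<lambda>h. frechet_derivative \<phi> (at (s + t *\<^sub>R axis i 1)) (h *\<^sub>R axis i 1)) =
      (*) (partial_deriv i \<phi> (s + t *\<^sub>R axis i 1))"
    by (intro ext)
  then show ?thesis
    using d unfolding has_field_derivative_def by metis
qed

lemma integral_lborel_translate:
  fixes f :: "'a::euclidean_space \<Rightarrow> real"
  assumes [measurable]: "f \<in> borel_measurable borel"
  shows "(\<integral>s. f (c + s) \<partial>lborel) = (\<integral>s. f s \<partial>lborel)"
proof -
  have "(\<integral>s. f s \<partial>lborel) = (\<integral>s. f s \<partial>distr lborel borel ((+) c))"
    by (simp add: lborel_distr_plus)
  also have "\<dots> = (\<integral>s. f (c + s) \<partial>lborel)"
    by (subst integral_distr) auto
  finally show ?thesis by simp
qed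

lemma integrable_lborel_translate:
  fixes f :: "'a::euclidean_space \<Rightarrow> real"
  assumes "integrable lborel f"
  shows "integrable lborel (\<lambda>s. f (c + s))"
proof -
  have "integrable (distr lborel borel ((+) c)) f"
    using assms by (simp add: lborel_distr_plus)
  then show ?thesis
    by (subst (asm) integrable_distr_eq) (use assms in auto)
qed

text \<open>Translation invariance kills the difference quotients, which converge dominatedly.\<close>

lemma integral_partial_deriv_zero:
  assumes "\<phi> \<in> test_functions D"
  shows "(\<integral>s. partial_deriv i \<phi> s \<partial>lborel) = 0"
proof -
  obtain K where K: "compact K" "\<And>s. s \<notin> K \<Longrightarrow> \<phi> s = 0" "\<And>s i. s \<notin> K \<Longrightarrow> partial_deriv i \<phi> s = 0"
    by (rule test_functionsE[OF assms]) blast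
  note cont = test_functions_continuous[OF assms] test_functions_partial_continuous[OF assms]
  have [measurable]: "\<phi> \<in> borel_measurable borel" "partial_deriv i \<phi> \<in> borel_measurable borel"
    using cont by (auto intro: borel_measurable_continuous_onI)
  obtain B where B: "B \<ge> 0" "\<And>s. \<bar>partial_deriv i \<phi> s\<bar> \<le> B"
    by (rule continuous_compact_support_bounded[OF cont(2) K(1,3)]) blast+
  define e :: "real^2" where "e = axis i 1"
  define q where "q n s = (\<phi> (inverse (Suc n) *\<^sub>R e + s) - \<phi> s) * Suc n" for n :: nat and s
  \<comment> \<open>A translation of length at most 1 keeps the support inside \<open>K'\<close>,
    which provides the integrable majorant.\<close>
  define K' where "K' = {x + y | x y. x \<in> K \<and> y \<in> cball 0 (1::real)}"
  have K': "compact K'"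
    unfolding K'_def by (rule compact_sums[OF K(1) compact_cball])
  have int: "integrable lborel \<phi>"
    by (rule continuous_compact_support_integrable[OF cont(1) K(1,2)])
  have int_t: "integrable lborel (\<lambda>s. \<phi> (c + s))" for c
    by (rule integrable_lborel_translate[OF int])
  have "(\<lambda>n. \<integral>s. q n s \<partial>lborel) \<longlonglongrightarrow> (\<integral>s. partial_deriv i \<phi> s \<partial>lborel)"
  proof (rule integral_dominated_convergence[where w="\<lambda>s. B * indicator K' s"])
    have "emeasure lborel K' < \<infinity>" "K' \<in> sets borel"
      using emeasure_bounded_finite[OF compact_imp_bounded[OF K']] K' by (auto simp: compact_imp_closed)
    then show "integrable lborel (\<lambda>s. B * indicator K' s)"
      by (intro integrable_mult_right integrable_real_indicator) auto
    show "AE s in lborel. (\<lambda>n. q n s) \<longlonglongrightarrow> partial_deriv i \<phi> s"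
    proof (rule AE_I2)
      fix s
      have "((\<lambda>h. (\<phi> (s + (0 + h) *\<^sub>R e) - \<phi> (s + 0 *\<^sub>R e)) / h) \<longlongrightarrow> partial_deriv i \<phi> s) (at 0)"
        using line_partial_deriv[OF test_functions_differentiable[OF assms], of s i 0]
        unfolding DERIV_def e_def by simp
      moreover have "filterlim (\<lambda>n. inverse (real (Suc n))) (at 0) sequentially"
        using LIMSEQ_inverse_real_of_nat by (intro filterlim_atI) auto
      ultimately have "(\<lambda>n. (\<phi> (s + (0 + inverse (real (Suc n))) *\<^sub>R e) - \<phi> (s + 0 *\<^sub>R e)) / inverse (real (Suc n)))
          \<longlonglongrightarrow> partial_deriv i \<phi> s"
        by (rule filterlim_compose)
      then show "(\<lambda>n. q n s) \<longlonglongrightarrow> partial_deriv i \<phi> s"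
        by (simp add: q_def add.commute divide_inverse)
    qed
    show "AE s in lborel. norm (q n s) \<le> B * indicator K' s" for n
    proof (rule AE_I2)
      fix s
      let ?h = "inverse (real (Suc n))"
      have h: "0 < ?h" "?h \<le> 1" by (auto simp: inverse_le_1_iff)
      show "norm (q n s) \<le> B * indicator K' s"
      proof (cases "s \<in> K'")
        case True
        \<comment> \<open>By the mean value theorem the quotient is a value of the partial
          derivative, hence bounded by \<open>B\<close>.\<close>
        obtain z where "\<phi> (s + ?h *\<^sub>R e) - \<phi> (s + 0 *\<^sub>R e) = (?h - 0) * partial_deriv i \<phi> (s + z *\<^sub>R e)"
          using MVT2[OF h(1), of "\<lambda>t. \<phi> (s + t *\<^sub>R e)" "\<lambda>t. partial_deriv i \<phi> (s + t *\<^sub>R e)"]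
            line_partial_deriv[OF test_functions_differentiable[OF assms], of s i]
          unfolding e_def by blast
        then have "q n s = partial_deriv i \<phi> (s + z *\<^sub>R e)"
          by (simp add: q_def add.commute)
        then show ?thesis using True B by simp
      next
        case False
        have nK: "s + t *\<^sub>R e \<notin> K" if "0 \<le> t" "t \<le> 1" for t
        proof
          assume "s + t *\<^sub>R e \<in> K"
          moreover have "s = (s + t *\<^sub>R e) + (- t *\<^sub>R e)" by simp
          moreover have "- t *\<^sub>R e \<in> cball 0 1" using that by (simp add: e_def)
          ultimately have "s \<in> K'" unfolding K'_def by blast
          then show False using False by simp
        qed
        have "\<phi> s = 0" "\<phi> (?h *\<^sub>R e + s) = 0"
          using K(2)[OF nK[of 0]] K(2)[OF nK[of ?h]] h by (auto simp: add.commute)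
        then show ?thesis using B by (simp add: q_def)
      qed
    qed
  qed (auto simp: q_def)
  moreover have "(\<integral>s. q n s \<partial>lborel) = 0" for n
    unfolding q_def using int int_t integral_lborel_translate[of \<phi>]
    by (simp add: Bochner_Integration.integral_diff)
  ultimately show ?thesis by (simp add: LIMSEQ_const_iff)
qed

lemma continuous_absolutely_integrable_on:
  fixes f :: "'a::euclidean_space \<Rightarrow> 'b::euclidean_space"
  assumes "continuous_on UNIV f" "compact K"
  shows "f absolutely_integrable_on K"
proof -
  have "integrable lborel (\<lambda>s. indicator K s *\<^sub>R f s)"
    using assms by (intro borel_integrable_compact) (auto intro: continuous_on_subset)
  then show ?thesis
    using borel_measurable_integrable[OF \<open>integrable lborel _\<close>]
    unfolding set_integrable_def by (simp add: integrable_completion)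
qed

text \<open>The product with another test function is a test function, so its partial derivatives
  integrate to zero; the product rule splits this into the two sides of the defining
  identity.\<close>

lemma has_weak_grad_test_function:
  assumes D: "open D" and \<phi>: "\<phi> \<in> test_functions D"
  shows "has_weak_grad D \<phi> (\<lambda>s. \<chi> i. partial_deriv i \<phi> s)"
  unfolding has_weak_grad_def
proof (intro conjI ballI allI impI)
  note cont = test_functions_continuous test_functions_partial_continuous
  fix K :: "(real^2) set" assume "compact K \<and> K \<subseteq> D"
  then have K: "compact K" by simp
  show "\<phi> absolutely_integrable_on K"
    by (rule continuous_absolutely_integrable_on[OF cont(1)[OF \<phi>] K])
  have "continuous_on UNIV (\<lambda>s. \<chi> i. partial_deriv i \<phi> s)"
    using cont(2)[OF \<phi>] by (intro continuous_on_vec_lambda)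
  then show "(\<lambda>s. \<chi> i. partial_deriv i \<phi> s) absolutely_integrable_on K"
    using K by (rule continuous_absolutely_integrable_on)
next
  note cont = test_functions_continuous test_functions_partial_continuous
  fix \<eta> i assume \<eta>: "\<eta> \<in> test_functions D"
  have Dl: "D \<in> sets lebesgue" using D by (rule open_in_lebesgue)
  obtain K where K: "compact K" "K \<subseteq> D" "\<And>s. s \<notin> K \<Longrightarrow> \<phi> s = 0" "\<And>s i. s \<notin> K \<Longrightarrow> partial_deriv i \<phi> s = 0"
    by (rule test_functionsE[OF \<phi>]) blast
  have c: "continuous_on UNIV (\<lambda>s. \<phi> s * partial_deriv i \<eta> s)" "continuous_on UNIV (\<lambda>s. partial_deriv i \<phi> s * \<eta> s)"
    using \<phi> \<eta> cont by (auto intro!: continuous_on_mult)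
  have m: "(\<lambda>s. \<phi> s * partial_deriv i \<eta> s) \<in> borel_measurable borel" "(\<lambda>s. partial_deriv i \<phi> s * \<eta> s) \<in> borel_measurable borel"
    using c by (auto intro: borel_measurable_continuous_onI)
  have "(\<integral>s. \<phi> s * partial_deriv i \<eta> s \<partial>lborel) + (\<integral>s. partial_deriv i \<phi> s * \<eta> s \<partial>lborel)
      = (\<integral>s. \<phi> s * partial_deriv i \<eta> s + partial_deriv i \<phi> s * \<eta> s \<partial>lborel)"
    by (rule Bochner_Integration.integral_add[symmetric];
        rule continuous_compact_support_integrable[OF _ K(1)]) (use c K in auto)
  also have "\<dots> = (\<integral>s. partial_deriv i (\<lambda>s. \<phi> s * \<eta> s) s \<partial>lborel)"
    using \<phi> \<eta> by (simp add: partial_deriv_mult test_functions_differentiable)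
  also have "\<dots> = 0"
    by (rule integral_partial_deriv_zero[OF test_functions_mult[OF \<phi> \<eta>]])
  finally have "(\<integral>s. \<phi> s * partial_deriv i \<eta> s \<partial>lborel) = - (\<integral>s. partial_deriv i \<phi> s * \<eta> s \<partial>lborel)"
    by simp
  moreover have "(\<integral>s. \<phi> s * partial_deriv i \<eta> s \<partial>lebesgue_on D) = (\<integral>s. \<phi> s * partial_deriv i \<eta> s \<partial>lborel)"
    by (rule integral_lebesgue_on_vanishing[OF Dl m(1)]) (use K in auto)
  moreover have "(\<integral>s. partial_deriv i \<phi> s * \<eta> s \<partial>lebesgue_on D) = (\<integral>s. partial_deriv i \<phi> s * \<eta> s \<partial>lborel)"
    by (rule integral_lebesgue_on_vanishing[OF Dl m(2)]) (use K in auto)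
  ultimately show "(\<integral>s. \<phi> s * partial_deriv i \<eta> s \<partial>lebesgue_on D) =
      - (\<integral>s. (\<chi> i. partial_deriv i \<phi> s) $ i * \<eta> s \<partial>lebesgue_on D)"
    by simp
qed

section \<open>The fundamental lemma and uniqueness of weak gradients\<close>

lemma locally_integrable_mult_test:
  fixes v \<eta> :: "real^2 \<Rightarrow> real"
  assumes D: "open D" and v: "\<And>K. compact K \<Longrightarrow> K \<subseteq> D \<Longrightarrow> v absolutely_integrable_on K"
    and \<eta>: "continuous_on UNIV \<eta>" "compact K" "K \<subseteq> D" "\<And>s. s \<notin> K \<Longrightarrow> \<eta> s = 0"
  shows "integrable (lebesgue_on D) (\<lambda>s. v s * \<eta> s)"
proof -
  have v': "integrable lebesgue (\<lambda>s. indicator K s *\<^sub>R v s)"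
    using v[OF \<eta>(2,3)] by (simp add: set_integrable_def)
  obtain B where B: "B \<ge> 0" "\<And>s. \<bar>\<eta> s\<bar> \<le> B"
    by (rule continuous_compact_support_bounded[OF \<eta>(1,2,4)]) blast+
  have \<eta>': "\<eta> \<in> borel_measurable lebesgue"
    using \<eta>(1) by (intro measurable_completion) (auto intro: borel_measurable_continuous_onI)
  have "integrable lebesgue (\<lambda>s. (indicator K s *\<^sub>R v s) * \<eta> s)"
  proof (rule Bochner_Integration.integrable_bound)
    show "integrable lebesgue (\<lambda>s. (indicator K s *\<^sub>R v s) * B)"
      by (rule integrable_mult_left) (rule v')
    show "(\<lambda>s. (indicator K s *\<^sub>R v s) * \<eta> s) \<in> borel_measurable lebesgue"
      by (rule borel_measurable_times[OF borel_measurable_integrable[OF v'] \<eta>'])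
    show "AE s in lebesgue. norm ((indicator K s *\<^sub>R v s) * \<eta> s) \<le> norm ((indicator K s *\<^sub>R v s) * B)"
    proof (rule AE_I2)
      fix s
      show "norm ((indicator K s *\<^sub>R v s) * \<eta> s) \<le> norm ((indicator K s *\<^sub>R v s) * B)"
        unfolding norm_mult using B(1) B(2)[of s] by (intro mult_left_mono) auto
    qed
  qed
  moreover have "(\<lambda>s. (indicator K s *\<^sub>R v s) * \<eta> s) = (\<lambda>s. indicator D s *\<^sub>R (v s * \<eta> s))"
    using \<eta>(3,4) by (auto simp: fun_eq_iff split: split_indicator)
  moreover have "D \<in> sets lebesgue" using D by (rule open_in_lebesgue)
  ultimately show ?thesis
    by (simp add: integrable_restrict_space)
qed

text \<open>Dominated convergence along bumps shows that \<open>h\<close> integrates to zero over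
  every box whose closure lies in \<open>D\<close>. Boxes are stable under intersection and generate
  the Borel sets, so \<open>h\<close> vanishes almost everywhere on each such box, and
  \<open>D\<close> is a countable union of closed boxes.\<close>

lemma fundamental_lemma_calculus_of_variations:
  fixes h :: "real^2 \<Rightarrow> real"
  assumes D: "open D" and h: "\<And>K. compact K \<Longrightarrow> K \<subseteq> D \<Longrightarrow> h absolutely_integrable_on K"
    and z: "\<And>\<phi>. \<phi> \<in> test_functions D \<Longrightarrow> (\<integral>s. h s * \<phi> s \<partial>lebesgue_on D) = 0"
  shows "AE s in lebesgue_on D. h s = 0"
proof -
  have Dl: "D \<in> sets lebesgue" using D by (rule open_in_lebesgue)
  have box0: "(\<integral>s. indicator (box a b) s * h s \<partial>lebesgue) = 0" if ab: "closure (box a b) \<subseteq> D" for a b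
  proof -
    obtain \<phi> where \<phi>: "\<And>n::nat. \<phi> n \<in> test_functions D" "\<And>n s. \<bar>\<phi> n s\<bar> \<le> 1"
      "\<And>n s. s \<notin> box a b \<Longrightarrow> \<phi> n s = 0" "\<And>s. s \<in> box a b \<Longrightarrow> (\<lambda>n. \<phi> n s) \<longlonglongrightarrow> 1"
      by (rule bump_sequence[OF ab]) blast
    let ?K = "closure (box a b)"
    have K: "compact ?K" by (simp add: bounded_box compact_closure)
    have int: "integrable lebesgue (\<lambda>s. indicator ?K s *\<^sub>R h s)"
      using h[OF K ab] by (simp add: set_integrable_def)
    have [measurable]: "\<phi> n \<in> borel_measurable lebesgue" for n
      using test_functions_continuous[OF \<phi>(1)]
      by (intro measurable_completion) (auto intro: borel_measurable_continuous_onI)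
    have sub: "box a b \<subseteq> ?K" by (rule closure_subset)
    have eqn: "indicator D s * (h s * \<phi> n s) = indicator ?K s * h s * \<phi> n s" for n s
      using \<phi>(3)[of s n] sub ab by (auto simp: fun_eq_iff split: split_indicator)
    have eqb: "indicator (box a b) s * h s = (indicator ?K s *\<^sub>R h s) * indicator (box a b) s" for s
      using sub by (auto simp: fun_eq_iff split: split_indicator)
    have "(\<lambda>n. \<integral>s. (indicator ?K s *\<^sub>R h s) * \<phi> n s \<partial>lebesgue) \<longlonglongrightarrow>
        (\<integral>s. (indicator ?K s *\<^sub>R h s) * indicator (box a b) s \<partial>lebesgue)"
    proof (rule integral_dominated_convergence[where w="\<lambda>s. \<bar>indicator ?K s *\<^sub>R h s\<bar>"])
      show "AE s in lebesgue. (\<lambda>n. (indicator ?K s *\<^sub>R h s) * \<phi> n s) \<longlonglongrightarrow>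
          (indicator ?K s *\<^sub>R h s) * indicator (box a b) s"
      proof (rule AE_I2)
        fix s
        have "(\<lambda>n. \<phi> n s) \<longlonglongrightarrow> indicator (box a b) s"
          using \<phi>(3,4) by (cases "s \<in> box a b") auto
        then show "(\<lambda>n. (indicator ?K s *\<^sub>R h s) * \<phi> n s) \<longlonglongrightarrow> (indicator ?K s *\<^sub>R h s) * indicator (box a b) s"
          by (intro tendsto_intros)
      qed
      show "AE s in lebesgue. norm ((indicator ?K s *\<^sub>R h s) * \<phi> n s) \<le> \<bar>indicator ?K s *\<^sub>R h s\<bar>" for n
        using \<phi>(2) by (auto simp: abs_mult mult_left_le)
      have m: "(\<lambda>s. indicator ?K s *\<^sub>R h s) \<in> borel_measurable lebesgue"
        using int by (rule borel_measurable_integrable)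
      show "(\<lambda>s. (indicator ?K s *\<^sub>R h s) * \<phi> n s) \<in> borel_measurable lebesgue" for n
        by (rule borel_measurable_times[OF m]) measurable
      show "(\<lambda>s. (indicator ?K s *\<^sub>R h s) * indicator (box a b) s) \<in> borel_measurable lebesgue"
      proof (rule borel_measurable_times[OF m])
        show "indicator (box a b) \<in> borel_measurable lebesgue"
          by (rule borel_measurable_indicator) (simp add: sets_completionI_sets)
      qed
      show "integrable lebesgue (\<lambda>s. \<bar>indicator ?K s *\<^sub>R h s\<bar>)"
        using int by (rule integrable_abs)
    qed
    moreover have "(\<integral>s. (indicator ?K s *\<^sub>R h s) * \<phi> n s \<partial>lebesgue) = 0" for n
      using z[OF \<phi>(1)[of n]] Dl by (simp add: integral_restrict_space eqn)
    ultimately have "(\<integral>s. (indicator ?K s *\<^sub>R h s) * indicator (box a b) s \<partial>lebesgue) = 0"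
      by (simp add: LIMSEQ_const_iff)
    then show ?thesis by (simp add: eqb)
  qed
  \<comment> \<open>\<open>h\<close> is only locally integrable, so the argument is confined to one
    box, where there is an integrable Borel representative \<open>f\<close>.\<close>
  have local: "AE s in lborel. s \<in> box a b \<longrightarrow> h s = 0" if ab: "closure (box a b) \<subseteq> D" for a b
  proof -
    let ?K = "closure (box a b)"
    have K: "compact ?K" by (simp add: bounded_box compact_closure)
    have sub: "box a b \<subseteq> ?K" by (rule closure_subset)
    have int: "integrable lebesgue (\<lambda>s. indicator (box a b) s * h s)"
      using set_integrable_subset[OF h[OF K ab] _ sub]
      by (simp add: set_integrable_def sets_completionI_sets)
    then obtain f where f: "f \<in> borel_measurable lborel" "AE s in lborel. indicator (box a b) s * h s = f s"
      using completion_ex_borel_measurable_real[of "\<lambda>s. indicator (box a b) s * h s" lborel] by auto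
    have fl: "AE s in lebesgue. indicator (box a b) s * h s = f s"
      using f(2) by (rule AE_completion)
    have "integrable lebesgue f"
      using int f fl by (subst integrable_cong_AE[symmetric]) (auto intro: measurable_completion)
    then have fi: "integrable lborel f"
      using f(1) by (simp add: integrable_completion)
    have fbox: "(\<integral>s. indicator (box c d) s * f s \<partial>lborel) = 0" for c d
    proof -
      \<comment> \<open>The test box is intersected with the fixed one, which brings it within reach
        of \<open>box0\<close>.\<close>
      obtain c' d' where cd: "box c d \<inter> box a b = box c' d'"
        unfolding box_Int_box by blast
      have "closure (box c' d') \<subseteq> D"
        using closure_mono[of "box c' d'" "box a b"] cd ab by auto
      have "(\<integral>s. indicator (box c d) s * f s \<partial>lborel) = (\<integral>s. indicator (box c d) s * f s \<partial>lebesgue)"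
        using f(1) by (intro integral_completion[symmetric]) auto
      also have "\<dots> = (\<integral>s. indicator (box c' d') s * h s \<partial>lebesgue)"
      proof (rule integral_cong_AE)
        have "(\<lambda>s. indicator (box c d) s * (indicator (box a b) s * h s)) \<in> borel_measurable lebesgue"
        proof (rule borel_measurable_times[OF _ borel_measurable_integrable[OF int]])
          show "indicator (box c d) \<in> borel_measurable lebesgue"
            by (rule borel_measurable_indicator) (simp add: sets_completionI_sets)
        qed
        then show "(\<lambda>s. indicator (box c' d') s * h s) \<in> borel_measurable lebesgue"
          by (simp add: cd[symmetric] indicator_inter_arith mult.assoc)
        show "AE s in lebesgue. indicator (box c d) s * f s = indicator (box c' d') s * h s"
          using fl by eventually_elim (auto simp: cd[symmetric] indicator_inter_arith mult.assoc)
        show "(\<lambda>s. indicator (box c d) s * f s) \<in> borel_measurable lebesgue"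
          using f(1) by (intro measurable_completion) auto
      qed
      also have "\<dots> = 0" by (rule box0) fact
      finally show ?thesis .
    qed
    have f0: "(\<integral>s. f s \<partial>lborel) = 0"
    proof -
      have "(\<integral>s. f s \<partial>lborel) = (\<integral>s. indicator (box a b) s * f s \<partial>lborel)"
      proof (rule integral_cong_AE)
        show "AE s in lborel. f s = indicator (box a b) s * f s"
          using f(2) by eventually_elim (auto simp: fun_eq_iff split: split_indicator)
      qed (use f(1) in auto)
      then show ?thesis using fbox by simp
    qed
    have "AE s in lborel. f s = 0"
    proof (rule sigma_finite_measure.density_zero[OF sigma_finite_lborel fi])
      fix A :: "(real^2) set" assume "A \<in> sets lborel"
      then have A: "A \<in> sigma_sets UNIV (range (\<lambda>(a, b). box a b))"
        by (simp add: borel_eq_box)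
      have "Int_stable (range (\<lambda>(a, b). box a b :: (real^2) set))"
        by (auto simp: Int_stable_def box_Int_box)
      \<comment> \<open>Dynkin's argument: the sets over which \<open>f\<close> integrates to zero
        contain the boxes and are closed under disjoint unions and, by \<open>f0\<close>, under
        complements.\<close>
      from this subset_Pow_Union[THEN subset_trans, OF Pow_mono[OF subset_UNIV]] A
      have "A \<in> sets borel \<and> (\<integral>s. indicator A s * f s \<partial>lborel) = 0"
      proof (induction rule: sigma_sets_induct_disjoint)
        case (basic A)
        then show ?case using fbox by auto
      next
        case empty
        then show ?case by simp
      next
        case (compl A)
        have "(\<integral>s. indicator (UNIV - A) s * f s \<partial>lborel) = (\<integral>s. f s - indicator A s * f s \<partial>lborel)"
          by (intro Bochner_Integration.integral_cong) (auto simp: fun_eq_iff split: split_indicator)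
        also have "\<dots> = 0"
          using compl fi f0 integrable_mult_indicator[of A lborel f]
          by (subst Bochner_Integration.integral_diff) auto
        finally show ?case using compl by auto
      next
        case (union A)
        have m: "\<And>i. A i \<in> sets borel" using union by blast
        have "set_integrable lborel (\<Union>i. A i) f"
          unfolding set_integrable_def by (intro integrable_mult_indicator fi) (use m in auto)
        then have "(\<integral>s\<in>(\<Union>i. A i). f s \<partial>lborel) = (\<Sum>i. \<integral>s\<in>A i. f s \<partial>lborel)"
          by (intro lebesgue_integral_countable_add)
            (use m union(1) in \<open>auto simp: disjoint_family_on_def\<close>)
        also have "\<dots> = 0"
          using union by (simp add: set_lebesgue_integral_def)
        finally show ?case using m by (auto simp: set_lebesgue_integral_def)
      qed
      then show "(\<integral>s\<in>A. f s \<partial>lborel) = 0"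
        by (simp add: set_lebesgue_integral_def)
    qed
    with f(2) show ?thesis
      by eventually_elim auto
  qed
  obtain \<D> where "countable \<D>" "\<D> \<subseteq> Pow D" "\<And>X. X \<in> \<D> \<Longrightarrow> \<exists>a b. X = cbox a b" "\<Union>\<D> = D"
    using open_countable_Union_open_cbox[OF D] by metis
  note \<D> = this
  have "AE s in lebesgue. s \<in> X \<longrightarrow> h s = 0" if "X \<in> \<D>" for X
  proof -
    obtain a b where X: "X = cbox a b" using \<D>(3) \<open>X \<in> \<D>\<close> by blast
    have "cbox a b \<subseteq> D" using \<D>(2) that X by auto
    then have "closure (box a b) \<subseteq> D"
      using closure_minimal[OF box_subset_cbox[of a b] closed_cbox] by blast
    from AE_completion[OF local[OF this]] have "AE s in lebesgue. s \<in> box a b \<longrightarrow> h s = 0" .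
    \<comment> \<open>The covering boxes are closed while the local statement concerns open ones;
      their faces form a null set.\<close>
    moreover have "cbox a b - box a b \<in> null_sets lebesgue"
      using negligible_frontier_interval by (simp add: negligible_iff_null_sets)
    then have "AE s in lebesgue. s \<notin> cbox a b - box a b" by (rule AE_not_in)
    ultimately show ?thesis unfolding X by eventually_elim auto
  qed
  then have "AE s in lebesgue. \<forall>X\<in>\<D>. s \<in> X \<longrightarrow> h s = 0"
    by (intro AE_ball_countable'[OF _ \<D>(1)])
  then have "AE s in lebesgue. s \<in> D \<longrightarrow> h s = 0"
    by eventually_elim (use \<D>(4) in blast)
  then show ?thesis
    using Dl by (simp add: AE_restrict_space_iff)
qed

lemma weak_grad_component_locally_integrable:
  assumes "has_weak_grad D u G" "compact K" "K \<subseteq> D"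
  shows "(\<lambda>s. G s $ i) absolutely_integrable_on K"
  using absolutely_integrable_component[where f=G and A=K and b="axis i 1"] assms
  by (simp add: has_weak_grad_def inner_axis)

lemma weak_grad_mult_integrable:
  assumes "open D" "has_weak_grad D u G" "\<phi> \<in> test_functions D"
  shows "integrable (lebesgue_on D) (\<lambda>s. (G s $ i) * \<phi> s)"
    and "integrable (lebesgue_on D) (\<lambda>s. u s * partial_deriv i \<phi> s)"
proof -
  obtain K where K: "compact K" "K \<subseteq> D" "\<And>s. s \<notin> K \<Longrightarrow> \<phi> s = 0" "\<And>s i. s \<notin> K \<Longrightarrow> partial_deriv i \<phi> s = 0"
    by (rule test_functionsE[OF assms(3)]) blast
  show "integrable (lebesgue_on D) (\<lambda>s. (G s $ i) * \<phi> s)"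
    by (rule locally_integrable_mult_test[OF assms(1) weak_grad_component_locally_integrable[OF assms(2)]
          test_functions_continuous[OF assms(3)] K(1-3)])
  show "integrable (lebesgue_on D) (\<lambda>s. u s * partial_deriv i \<phi> s)"
    by (rule locally_integrable_mult_test[OF assms(1) _
          test_functions_partial_continuous[OF assms(3)] K(1,2,4)])
      (use assms(2) in \<open>auto simp: has_weak_grad_def\<close>)
qed

text \<open>\<open>weak_grad\<close> picks an arbitrary weak gradient; through this uniqueness any
  explicitly known gradient may replace it under integrals.\<close>

lemma has_weak_grad_unique:
  assumes D: "open D" and G: "has_weak_grad D u G" "has_weak_grad D u G'"
  shows "AE s in lebesgue_on D. G s = G' s"
proof -
  have "AE s in lebesgue_on D. G s $ i - G' s $ i = 0" for i
  proof (rule fundamental_lemma_calculus_of_variations[OF D])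
    show "(\<lambda>s. G s $ i - G' s $ i) absolutely_integrable_on K" if "compact K" "K \<subseteq> D" for K
      using weak_grad_component_locally_integrable[OF _ that] G by (intro set_integral_diff) auto
    fix \<phi> assume \<phi>: "\<phi> \<in> test_functions D"
    have "(\<integral>s. (G s $ i) * \<phi> s \<partial>lebesgue_on D) = (\<integral>s. (G' s $ i) * \<phi> s \<partial>lebesgue_on D)"
    proof -
      have "- (\<integral>s. (G s $ i) * \<phi> s \<partial>lebesgue_on D) = - (\<integral>s. (G' s $ i) * \<phi> s \<partial>lebesgue_on D)"
        using G \<phi> by (simp add: has_weak_grad_def)
      then show ?thesis by simp
    qed
    then show "(\<integral>s. (G s $ i - G' s $ i) * \<phi> s \<partial>lebesgue_on D) = 0"
      using weak_grad_mult_integrable(1)[OF D _ \<phi>] G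
      by (simp add: left_diff_distrib Bochner_Integration.integral_diff)
  qed
  then have "AE s in lebesgue_on D. \<forall>i\<in>UNIV. G s $ i - G' s $ i = 0"
    by (intro AE_finite_allI) auto
  then show ?thesis by eventually_elim (simp add: vec_eq_iff)
qed

lemma has_weak_grad_linear:
  assumes D: "open D" and G: "has_weak_grad D u G" "has_weak_grad D v H"
  shows "has_weak_grad D (\<lambda>s. u s + c * v s) (\<lambda>s. G s + c *\<^sub>R H s)"
  unfolding has_weak_grad_def
proof (intro conjI ballI allI impI)
  fix K assume K: "compact K \<and> K \<subseteq> D"
  have u: "u absolutely_integrable_on K" "v absolutely_integrable_on K"
    "G absolutely_integrable_on K" "H absolutely_integrable_on K"
    using G K by (auto simp: has_weak_grad_def)
  show "(\<lambda>s. u s + c * v s) absolutely_integrable_on K"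
    using u by (intro set_integral_add set_integrable_mult_right)
  show "(\<lambda>s. G s + c *\<^sub>R H s) absolutely_integrable_on K"
    using u by (intro set_integral_add absolutely_integrable_scaleR_left) auto
next
  fix \<phi> i assume \<phi>: "\<phi> \<in> test_functions D"
  note i = weak_grad_mult_integrable[OF D G(1) \<phi>, of i] weak_grad_mult_integrable[OF D G(2) \<phi>, of i]
  have "(\<integral>s. (u s + c * v s) * partial_deriv i \<phi> s \<partial>lebesgue_on D) =
      (\<integral>s. u s * partial_deriv i \<phi> s \<partial>lebesgue_on D) + c * (\<integral>s. v s * partial_deriv i \<phi> s \<partial>lebesgue_on D)"
    using i by (simp add: distrib_right mult.assoc Bochner_Integration.integral_add)
  also have "\<dots> = - ((\<integral>s. (G s $ i) * \<phi> s \<partial>lebesgue_on D) + c * (\<integral>s. (H s $ i) * \<phi> s \<partial>lebesgue_on D))"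
    using G \<phi> by (simp add: has_weak_grad_def)
  also have "(\<integral>s. (G s $ i) * \<phi> s \<partial>lebesgue_on D) + c * (\<integral>s. (H s $ i) * \<phi> s \<partial>lebesgue_on D)
      = (\<integral>s. ((G s + c *\<^sub>R H s) $ i) * \<phi> s \<partial>lebesgue_on D)"
    using i by (simp add: distrib_right mult.assoc Bochner_Integration.integral_add)
  finally show "(\<integral>s. (u s + c * v s) * partial_deriv i \<phi> s \<partial>lebesgue_on D) =
      - (\<integral>s. ((G s + c *\<^sub>R H s) $ i) * \<phi> s \<partial>lebesgue_on D)" .
qed

lemma weak_grad_AE:
  assumes "open D" "has_weak_grad D u G"
  shows "AE s in lebesgue_on D. weak_grad D u s = G s"
  unfolding weak_grad_def
  by (rule has_weak_grad_unique[OF assms(1) someI[of "has_weak_grad D u", OF assms(2)] assms(2)])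


section \<open>Sobolev spaces\<close>

lemma carr_W1p: "u \<in> carr (W1p D p) \<longleftrightarrow> u \<in> carr (Lp_space D p) \<and>
    (\<exists>G. has_weak_grad D u G \<and> (\<forall>i. (\<lambda>s. G s $ i) \<in> carr (Lp_space D p)))"
  by (simp add: W1p_def)

lemma Lp_cong_AE:
  assumes D: "D \<in> sets lebesgue" and f: "f \<in> carr (Lp_space D p)" "AE s in lebesgue_on D. g s = f s"
  shows "g \<in> carr (Lp_space D p)"
    and "(\<integral>s. \<bar>g s\<bar> powr p \<partial>lebesgue_on D) = (\<integral>s. \<bar>f s\<bar> powr p \<partial>lebesgue_on D)"
proof -
  have f': "f \<in> borel_measurable (lebesgue_on D)" "integrable (lebesgue_on D) (\<lambda>s. \<bar>f s\<bar> powr p)"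
    using f(1) by (auto simp: carr_Lp)
  then have g: "g \<in> borel_measurable (lebesgue_on D)"
    using complete_measure.borel_measurable_AE_eq[OF complete_lebesgue_on[OF D] _ f(2)] by blast
  have eq: "AE s in lebesgue_on D. \<bar>g s\<bar> powr p = \<bar>f s\<bar> powr p"
    using f(2) by eventually_elim simp
  have "integrable (lebesgue_on D) (\<lambda>s. \<bar>g s\<bar> powr p)"
    by (rule integrable_cong_AE_imp[OF f'(2)]) (use g eq in auto)
  then show "g \<in> carr (Lp_space D p)" using g by (simp add: carr_Lp)
  show "(\<integral>s. \<bar>g s\<bar> powr p \<partial>lebesgue_on D) = (\<integral>s. \<bar>f s\<bar> powr p \<partial>lebesgue_on D)"
    by (rule integral_cong_AE) (use f' g eq in auto)
qed

text \<open>The exponent is a parameter because three instances occur: p for the states, its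
  conjugate for the functions testing the equation, and 2 for the membership of test functions in
  L^2.\<close>

locale sobolev =
  fixes D :: "(real^2) set" and p :: real
  assumes D_open: "open D" and p_ge_1: "p \<ge> 1"
begin

lemma D_lebesgue: "D \<in> sets lebesgue"
  using D_open by (rule open_in_lebesgue)

lemma W1p_weak_grad:
  assumes "u \<in> carr (W1p D p)"
  shows "has_weak_grad D u (weak_grad D u)" "(\<lambda>s. weak_grad D u s $ i) \<in> carr (Lp_space D p)"
proof -
  obtain G where G: "has_weak_grad D u G" "\<And>i. (\<lambda>s. G s $ i) \<in> carr (Lp_space D p)"
    using assms by (auto simp: carr_W1p)
  show "has_weak_grad D u (weak_grad D u)"
    unfolding weak_grad_def by (rule someI[of "has_weak_grad D u", OF G(1)])
  show "(\<lambda>s. weak_grad D u s $ i) \<in> carr (Lp_space D p)"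
    by (rule Lp_cong_AE(1)[OF D_lebesgue G(2)])
      (use weak_grad_AE[OF D_open G(1)] in \<open>auto elim!: AE_mp\<close>)
qed

text \<open>The p-th power of the Sobolev norm, with the gradient as a separate argument so that any
  weak gradient can be inserted in place of the chosen one.\<close>

definition energy :: "(real^2 \<Rightarrow> real) \<Rightarrow> (real^2 \<Rightarrow> real^2) \<Rightarrow> real" where
  "energy u G = (\<integral>s. \<bar>u s\<bar> powr p \<partial>lebesgue_on D) + (\<Sum>i\<in>UNIV. \<integral>s. \<bar>G s $ i\<bar> powr p \<partial>lebesgue_on D)"

lemma energy_nonneg: "0 \<le> energy u G"
  unfolding energy_def by (intro add_nonneg_nonneg sum_nonneg) auto

lemma energy_weak_grad:
  assumes "has_weak_grad D u G" "\<And>i. (\<lambda>s. G s $ i) \<in> carr (Lp_space D p)"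
  shows "energy u (weak_grad D u) = energy u G"
proof -
  have "(\<integral>s. \<bar>weak_grad D u s $ i\<bar> powr p \<partial>lebesgue_on D) = (\<integral>s. \<bar>G s $ i\<bar> powr p \<partial>lebesgue_on D)" for i
    by (rule Lp_cong_AE(2)[OF D_lebesgue assms(2)])
      (use weak_grad_AE[OF D_open assms(1)] in \<open>auto elim!: AE_mp\<close>)
  then show ?thesis by (simp add: energy_def)
qed

lemma nrm_W1p: "nrm (W1p D p) u = energy u (weak_grad D u) powr (1 / p)"
  using p_ge_1 by (simp add: W1p_def energy_def nrm_Lp_powr)

lemma nrm_W1p_eq:
  assumes "has_weak_grad D u G" "\<And>i. (\<lambda>s. G s $ i) \<in> carr (Lp_space D p)"
  shows "nrm (W1p D p) u = energy u G powr (1 / p)"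
  using energy_weak_grad[OF assms] by (simp add: nrm_W1p)

lemma W1p_linear:
  assumes "u \<in> carr (W1p D p)" "v \<in> carr (W1p D p)"
  shows "(\<lambda>s. u s + c * v s) \<in> carr (W1p D p)"
    and "nrm (W1p D p) (\<lambda>s. u s + c * v s) =
      energy (\<lambda>s. u s + c * v s) (\<lambda>s. weak_grad D u s + c *\<^sub>R weak_grad D v s) powr (1 / p)"
proof -
  have 1: "has_weak_grad D (\<lambda>s. u s + c * v s) (\<lambda>s. weak_grad D u s + c *\<^sub>R weak_grad D v s)"
    by (rule has_weak_grad_linear[OF D_open W1p_weak_grad(1)[OF assms(1)] W1p_weak_grad(1)[OF assms(2)]])
  have 2: "(\<lambda>s. (weak_grad D u s + c *\<^sub>R weak_grad D v s) $ i) \<in> carr (Lp_space D p)" for i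
    using Lp_add[OF p_ge_1 W1p_weak_grad(2)[OF assms(1)] Lp_scale[OF W1p_weak_grad(2)[OF assms(2)]]]
    by simp
  have 3: "(\<lambda>s. u s + c * v s) \<in> carr (Lp_space D p)"
    using assms by (intro Lp_add[OF p_ge_1] Lp_scale) (auto simp: carr_W1p)
  show "(\<lambda>s. u s + c * v s) \<in> carr (W1p D p)"
    using 1 2 3 unfolding carr_W1p by blast
  show "nrm (W1p D p) (\<lambda>s. u s + c * v s) =
      energy (\<lambda>s. u s + c * v s) (\<lambda>s. weak_grad D u s + c *\<^sub>R weak_grad D v s) powr (1 / p)"
    by (rule nrm_W1p_eq[OF 1 2])
qed

lemma test_function_Lp:
  assumes "continuous_on UNIV f" "compact K" "K \<subseteq> D" "\<And>s. s \<notin> K \<Longrightarrow> f s = 0"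
  shows "f \<in> carr (Lp_space D p)"
proof -
  have c: "continuous_on UNIV (\<lambda>s. \<bar>f s\<bar> powr p)"
    using assms(1) p_ge_1 by (intro continuous_on_powr' continuous_intros) auto
  have "integrable (lebesgue_on D) (\<lambda>s. \<bar>f s\<bar> powr p)"
    using continuous_compact_support_integrable[OF c assms(2)] assms(3,4) p_ge_1 borel_measurable_continuous_onI[OF c]
    by (subst integral_lebesgue_on_vanishing(2)[OF D_lebesgue]) auto
  moreover have "f \<in> borel_measurable (lebesgue_on D)"
    using assms(1) by (intro measurable_restrict_space1 measurable_completion)
      (auto intro: borel_measurable_continuous_onI)
  ultimately show ?thesis by (simp add: carr_Lp)
qed

lemma test_function_W1p:
  assumes "\<phi> \<in> test_functions D"
  shows "\<phi> \<in> carr (W1p D p)"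
    and "nrm (W1p D p) \<phi> = energy \<phi> (\<lambda>s. \<chi> i. partial_deriv i \<phi> s) powr (1 / p)"
proof -
  obtain K where K: "compact K" "K \<subseteq> D" "\<And>s. s \<notin> K \<Longrightarrow> \<phi> s = 0" "\<And>s i. s \<notin> K \<Longrightarrow> partial_deriv i \<phi> s = 0"
    by (rule test_functionsE[OF assms]) blast
  have 1: "\<phi> \<in> carr (Lp_space D p)"
    by (rule test_function_Lp[OF test_functions_continuous[OF assms] K(1-3)])
  have 2: "(\<lambda>s. (\<chi> i. partial_deriv i \<phi> s) $ i) \<in> carr (Lp_space D p)" for i
    using test_function_Lp[OF test_functions_partial_continuous[OF assms] K(1,2,4)] by simp
  note 3 = has_weak_grad_test_function[OF D_open assms]
  show "\<phi> \<in> carr (W1p D p)"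
    using 1 2 3 unfolding carr_W1p by blast
  show "nrm (W1p D p) \<phi> = energy \<phi> (\<lambda>s. \<chi> i. partial_deriv i \<phi> s) powr (1 / p)"
    by (rule nrm_W1p_eq[OF 3 2])
qed

text \<open>The convexity inequality with weight \<open>t\<close> holds for each of the three
  integrals of the energy, hence for their sum, and \<open>Minkowski_root\<close> is applied once to
  that sum.\<close>

lemma seminormed_W1p: "seminormed_fspace (W1p D p)"
proof
  show zero: "(\<lambda>s. 0) \<in> carr (W1p D p)"
    by (rule test_function_W1p(1)[OF test_functions_zero])
  fix u v :: "real^2 \<Rightarrow> real" and c
  assume u: "u \<in> carr (W1p D p)"
  show "(\<lambda>s. c * u s) \<in> carr (W1p D p)"
    using W1p_linear(1)[OF zero u, of c] by simp
  have "nrm (W1p D p) (\<lambda>s. c * u s) = energy (\<lambda>s. c * u s) (\<lambda>s. c *\<^sub>R weak_grad D u s) powr (1 / p)"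
  proof (rule nrm_W1p_eq)
    \<comment> \<open>c u is read as u + (c - 1) u.\<close>
    show "has_weak_grad D (\<lambda>s. c * u s) (\<lambda>s. c *\<^sub>R weak_grad D u s)"
      using has_weak_grad_linear[OF D_open W1p_weak_grad(1)[OF u] W1p_weak_grad(1)[OF u], of "c - 1"]
      by (simp add: algebra_simps)
    show "(\<lambda>s. (c *\<^sub>R weak_grad D u s) $ i) \<in> carr (Lp_space D p)" for i
      using Lp_scale[OF W1p_weak_grad(2)[OF u]] by simp
  qed
  also have "energy (\<lambda>s. c * u s) (\<lambda>s. c *\<^sub>R weak_grad D u s) = \<bar>c\<bar> powr p * energy u (weak_grad D u)"
    by (simp add: energy_def Lp_integral_scale distrib_left sum_distrib_left)
  finally show "nrm (W1p D p) (\<lambda>s. c * u s) = \<bar>c\<bar> * nrm (W1p D p) u"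
    using p_ge_1 energy_nonneg by (simp add: nrm_W1p powr_mult powr_powr)
  assume v: "v \<in> carr (W1p D p)"
  show "(\<lambda>s. u s + v s) \<in> carr (W1p D p)"
    using W1p_linear(1)[OF u v, of 1] by simp
  have "nrm (W1p D p) (\<lambda>s. u s + v s) = energy (\<lambda>s. u s + v s) (\<lambda>s. weak_grad D u s + weak_grad D v s) powr (1 / p)"
    using W1p_linear(2)[OF u v, of 1] by simp
  also have "\<dots> \<le> energy u (weak_grad D u) powr (1 / p) + energy v (weak_grad D v) powr (1 / p)"
  proof (rule Minkowski_root[OF p_ge_1 energy_nonneg energy_nonneg energy_nonneg])
    fix t :: real assume t: "0 < t" "t < 1"
    have uv: "u \<in> carr (Lp_space D p)" "v \<in> carr (Lp_space D p)"
      using u v by (auto simp: carr_W1p)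
    show "energy (\<lambda>s. u s + v s) (\<lambda>s. weak_grad D u s + weak_grad D v s)
        \<le> t powr (1 - p) * energy u (weak_grad D u) + (1 - t) powr (1 - p) * energy v (weak_grad D v)"
    proof -
      have "(\<Sum>i\<in>UNIV. \<integral>s. \<bar>weak_grad D u s $ i + weak_grad D v s $ i\<bar> powr p \<partial>lebesgue_on D) \<le>
          (\<Sum>i\<in>UNIV. t powr (1 - p) * (\<integral>s. \<bar>weak_grad D u s $ i\<bar> powr p \<partial>lebesgue_on D) +
            (1 - t) powr (1 - p) * (\<integral>s. \<bar>weak_grad D v s $ i\<bar> powr p \<partial>lebesgue_on D))"
        by (intro sum_mono Lp_integral_add_le p_ge_1 W1p_weak_grad(2) u v t)
      also have "\<dots> = t powr (1 - p) * (\<Sum>i\<in>UNIV. \<integral>s. \<bar>weak_grad D u s $ i\<bar> powr p \<partial>lebesgue_on D) +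
            (1 - t) powr (1 - p) * (\<Sum>i\<in>UNIV. \<integral>s. \<bar>weak_grad D v s $ i\<bar> powr p \<partial>lebesgue_on D)"
        by (simp only: sum.distrib sum_distrib_left)
      finally show ?thesis
        using Lp_integral_add_le[OF p_ge_1 uv t] unfolding energy_def vector_add_component distrib_left
        by linarith
    qed
  qed
  finally show "nrm (W1p D p) (\<lambda>s. u s + v s) \<le> nrm (W1p D p) u + nrm (W1p D p) v"
    by (simp add: nrm_W1p)
qed

sublocale W1p: seminormed_fspace "W1p D p"
  by (rule seminormed_W1p)

lemma nrm_Lp_le_W1p: "nrm (Lp_space D p) u \<le> nrm (W1p D p) u"
proof -
  have "0 \<le> (\<Sum>i\<in>UNIV. \<integral>s. \<bar>weak_grad D u s $ i\<bar> powr p \<partial>lebesgue_on D)"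
    by (intro sum_nonneg) auto
  then show ?thesis
    unfolding nrm_Lp nrm_W1p energy_def using p_ge_1 by (intro powr_mono2) auto
qed

lemma carr_W01p: "u \<in> carr (W01p D p) \<longleftrightarrow>
    u \<in> carr (W1p D p) \<and> (\<forall>e>0. \<exists>\<phi>\<in>test_functions D. nrm (W1p D p) (u - \<phi>) < e)"
  by (simp add: W01p_def)

lemma nrm_W01p: "nrm (W01p D p) = nrm (W1p D p)"
  by (simp add: W01p_def)

lemma test_function_W01p:
  assumes "\<phi> \<in> test_functions D"
  shows "\<phi> \<in> carr (W01p D p)"
  unfolding carr_W01p using assms test_function_W1p(1)[OF assms] W1p.nrm_zero
  by (auto simp: fun_diff_def intro!: bexI[of _ \<phi>])

lemma seminormed_W01p: "seminormed_fspace (W01p D p)"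
proof
  show "(\<lambda>s. 0) \<in> carr (W01p D p)"
    by (rule test_function_W01p[OF test_functions_zero])
  fix u v :: "real^2 \<Rightarrow> real" and c
  assume u: "u \<in> carr (W01p D p)"
  then have u1: "u \<in> carr (W1p D p)" by (simp add: carr_W01p)
  show "nrm (W01p D p) (\<lambda>s. c * u s) = \<bar>c\<bar> * nrm (W01p D p) u"
    using W1p.nrm_scale[OF u1] by (simp add: nrm_W01p)
  show "(\<lambda>s. c * u s) \<in> carr (W01p D p)"
    unfolding carr_W01p
  proof (intro conjI allI impI)
    show "(\<lambda>s. c * u s) \<in> carr (W1p D p)" by (rule W1p.scale_mem[OF u1])
    fix e :: real assume "e > 0"
    then obtain \<phi> where \<phi>: "\<phi> \<in> test_functions D" "nrm (W1p D p) (u - \<phi>) < e / (1 + \<bar>c\<bar>)"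
      using u unfolding carr_W01p by (meson abs_ge_zero add_pos_nonneg divide_pos_pos zero_less_one)
    have "nrm (W1p D p) ((\<lambda>s. c * u s) - (\<lambda>s. c * \<phi> s)) = \<bar>c\<bar> * nrm (W1p D p) (u - \<phi>)"
      using W1p.nrm_scale[OF W1p.diff_mem[OF u1 test_function_W1p(1)[OF \<phi>(1)]], of c]
      by (simp add: fun_diff_def right_diff_distrib)
    also have "\<dots> \<le> \<bar>c\<bar> * (e / (1 + \<bar>c\<bar>))"
      using \<phi>(2) by (intro mult_left_mono) auto
    also have "\<dots> < e"
      using \<open>e > 0\<close> by (simp add: field_simps)
    finally show "\<exists>\<phi>\<in>test_functions D. nrm (W1p D p) ((\<lambda>s. c * u s) - \<phi>) < e"
      using test_functions_scale[OF \<phi>(1)] by blast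
  qed
  assume v: "v \<in> carr (W01p D p)"
  then have v1: "v \<in> carr (W1p D p)" by (simp add: carr_W01p)
  show "nrm (W01p D p) (\<lambda>s. u s + v s) \<le> nrm (W01p D p) u + nrm (W01p D p) v"
    using W1p.nrm_triangle[OF u1 v1] by (simp add: nrm_W01p)
  show "(\<lambda>s. u s + v s) \<in> carr (W01p D p)"
    unfolding carr_W01p
  proof (intro conjI allI impI)
    show "(\<lambda>s. u s + v s) \<in> carr (W1p D p)" by (rule W1p.add_mem[OF u1 v1])
    fix e :: real assume "e > 0"
    then obtain \<phi> \<eta> where \<phi>: "\<phi> \<in> test_functions D" "nrm (W1p D p) (u - \<phi>) < e / 2"
      and \<eta>: "\<eta> \<in> test_functions D" "nrm (W1p D p) (v - \<eta>) < e / 2"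
      using u v unfolding carr_W01p by (meson half_gt_zero)
    have "nrm (W1p D p) ((\<lambda>s. u s + v s) - (\<lambda>s. \<phi> s + \<eta> s)) \<le> nrm (W1p D p) (u - \<phi>) + nrm (W1p D p) (v - \<eta>)"
      using W1p.nrm_triangle[OF W1p.diff_mem[OF u1 test_function_W1p(1)[OF \<phi>(1)]]
          W1p.diff_mem[OF v1 test_function_W1p(1)[OF \<eta>(1)]]]
      by (simp add: fun_diff_def algebra_simps)
    also have "\<dots> < e" using \<phi> \<eta> by simp
    finally show "\<exists>\<phi>\<in>test_functions D. nrm (W1p D p) ((\<lambda>s. u s + v s) - \<phi>) < e"
      using test_functions_add[OF \<phi>(1) \<eta>(1)] by blast
  qed
qed

sublocale W01p: seminormed_fspace "W01p D p"
  by (rule seminormed_W01p)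

lemma nrm_Lp_le_W01p:
  assumes "u \<in> carr (W01p D p)"
  shows "u \<in> carr (Lp_space D p)" "nrm (Lp_space D p) u \<le> nrm (W01p D p) u"
  using assms nrm_Lp_le_W1p by (auto simp: carr_W01p carr_W1p nrm_W01p)

end

section \<open>The local averaging estimate\<close>

text \<open>Two applications of the two-term inequality: \<open>b\<close> and \<open>c\<close> are
  merged into \<open>x\<close> with relative weights \<beta>/\<delta> and \<gamma>/\<delta>, and
  \<open>x\<close> is then combined with \<open>a\<close>.\<close>

lemma weighted_AM_GM3:
  fixes a b c :: real
  assumes "a > 0" "b > 0" "c > 0" "\<alpha> > 0" "\<beta> > 0" "\<gamma> > 0" "\<alpha> + \<beta> + \<gamma> = 1"
  shows "a powr \<alpha> * b powr \<beta> * c powr \<gamma> \<le> \<alpha> * a + \<beta> * b + \<gamma> * c"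
proof -
  define \<delta> where "\<delta> = \<beta> + \<gamma>"
  have \<delta>: "\<delta> > 0" "\<alpha> + \<delta> = 1" using assms by (auto simp: \<delta>_def)
  define x where "x = b powr (\<beta> / \<delta>) * c powr (\<gamma> / \<delta>)"
  have x: "x > 0" "x powr \<delta> = b powr \<beta> * c powr \<gamma>"
    using assms \<delta> by (auto simp: x_def powr_mult powr_powr)
  have "x \<le> \<beta> / \<delta> * b + \<gamma> / \<delta> * c"
    unfolding x_def using assms \<delta> by (intro Youngs_inequality_0) (auto simp: \<delta>_def simp flip: add_divide_distrib)
  then have "\<delta> * x \<le> \<delta> * (\<beta> / \<delta> * b + \<gamma> / \<delta> * c)"
    using \<delta> by (intro mult_left_mono) auto
  also have "\<dots> = \<beta> * b + \<gamma> * c"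
    using \<delta> by (simp add: field_simps)
  finally have "\<delta> * x \<le> \<beta> * b + \<gamma> * c" .
  moreover have "a powr \<alpha> * x powr \<delta> \<le> \<alpha> * a + \<delta> * x"
    using assms \<delta> x by (intro Youngs_inequality_0) auto
  ultimately show ?thesis using x(2) by (simp add: mult.assoc)
qed

text \<open>The weights 1/p, 1/2 - 1/p and 1/2 are dictated by homogeneity: the exponent of
  \<open>f\<close> becomes 2/p + 2 (1/2 - 1/p) = 1 and that of \<open>h\<close> becomes q (1 - 1/p)
  = 1. The number \<open>m\<close> will be the measure of the set in the convolution
  inequality.\<close>

lemma Young_pointwise:
  fixes f h m p q :: real
  assumes p: "p > 2" and q: "q = p / (p - 1)" and m: "m > 0" and "f \<ge> 0" "h \<ge> 0"
  shows "f * h \<le> m powr (1/2 + 1/p) * (1/p * (f\<^sup>2 / m) + (1/2 - 1/p) * (f\<^sup>2 * h powr q) + 1/2 * (h powr q / m))"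
proof (cases "f = 0 \<or> h = 0")
  case True
  then show ?thesis using p m by auto
next
  case False
  then have fh: "f > 0" "h > 0" using assms by auto
  have e: "q * (1/2 - 1/p) + q * (1/2) = 1"
  proof -
    have "q * (1/2 - 1/p) + q * (1/2) = q * (1 - 1/p)"
      by (simp add: algebra_simps)
    also have "\<dots> = 1" using p by (simp add: q divide_simps)
    finally show ?thesis .
  qed
  have f2: "f\<^sup>2 = f powr 2" using fh by simp
  have "(f\<^sup>2 / m) powr (1/p) * (f\<^sup>2 * h powr q) powr (1/2 - 1/p) * (h powr q / m) powr (1/2)
      = (f powr (2 * (1/p)) * f powr (2 * (1/2 - 1/p))) *
        (h powr (q * (1/2 - 1/p)) * h powr (q * (1/2))) / (m powr (1/p) * m powr (1/2))"
    unfolding f2 using fh m by (simp add: powr_divide powr_mult powr_powr del: powr_numeral)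
  also have "\<dots> = f * h / m powr (1/2 + 1/p)"
    unfolding powr_add[symmetric] e using fh by (simp add: algebra_simps)
  finally have "f * h = m powr (1/2 + 1/p) *
      ((f\<^sup>2 / m) powr (1/p) * (f\<^sup>2 * h powr q) powr (1/2 - 1/p) * (h powr q / m) powr (1/2))"
    using m by simp
  also have "\<dots> \<le> m powr (1/2 + 1/p) * (1/p * (f\<^sup>2 / m) + (1/2 - 1/p) * (f\<^sup>2 * h powr q) + 1/2 * (h powr q / m))"
    using p m fh by (intro mult_left_mono weighted_AM_GM3) (auto simp: field_simps)
  finally show ?thesis .
qed

section \<open>Young's convolution inequality with an indicator\<close>

lemma nn_integral_lborel_translate:
  fixes f :: "'a::euclidean_space \<Rightarrow> ennreal"
  assumes [measurable]: "f \<in> borel_measurable borel"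
  shows "(\<integral>\<^sup>+s. f (c + s) \<partial>lborel) = (\<integral>\<^sup>+s. f s \<partial>lborel)"
proof -
  have "(\<integral>\<^sup>+s. f s \<partial>lborel) = (\<integral>\<^sup>+s. f s \<partial>distr lborel borel ((+) c))"
    by (simp add: lborel_distr_plus)
  also have "\<dots> = (\<integral>\<^sup>+s. f (c + s) \<partial>lborel)"
    by (subst nn_integral_distr) auto
  finally show ?thesis by simp
qed

lemma nn_integral_lborel_scale:
  fixes f :: "'a::euclidean_space \<Rightarrow> ennreal"
  assumes [measurable]: "f \<in> borel_measurable borel" and "c > 0"
  shows "(\<integral>\<^sup>+s. f s \<partial>lborel) = ennreal (c ^ DIM('a)) * (\<integral>\<^sup>+s. f (c *\<^sub>R s) \<partial>lborel)"
proof -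
  have "(\<integral>\<^sup>+s. f s \<partial>lborel) = (\<integral>\<^sup>+s. f s \<partial>density (distr lborel borel (\<lambda>x. 0 + c *\<^sub>R x)) (\<lambda>_. \<bar>c\<bar>^DIM('a)))"
    using lborel_affine[of c "0::'a"] assms(2) by simp
  also have "\<dots> = (\<integral>\<^sup>+s. ennreal (\<bar>c\<bar>^DIM('a)) * f s \<partial>distr lborel borel (\<lambda>x. c *\<^sub>R x))"
    by (subst nn_integral_density) auto
  also have "\<dots> = (\<integral>\<^sup>+s. ennreal (\<bar>c\<bar>^DIM('a)) * f (c *\<^sub>R s) \<partial>lborel)"
    by (subst nn_integral_distr) auto
  also have "\<dots> = ennreal (c ^ DIM('a)) * (\<integral>\<^sup>+s. f (c *\<^sub>R s) \<partial>lborel)"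
    using assms(2) by (subst nn_integral_cmult) auto
  finally show ?thesis .
qed

text \<open>Young's convolution inequality for \<open>L\<^sup>2 * L\<^sup>q\<close> and the indicator of a set, which takes the
  place of the third function in \<open>L\<^sup>r\<close>, \<open>1/r = 1/2 + 1/p\<close>.\<close>

lemma Young_indicator:
  fixes f h :: "'a::euclidean_space \<Rightarrow> real"
  assumes p: "p > 2" and q: "q = p / (p - 1)"
    and [measurable]: "f \<in> borel_measurable borel" "h \<in> borel_measurable borel" "B \<in> sets borel"
    and nn: "\<And>s. f s \<ge> 0" "\<And>s. h s \<ge> 0"
    and F: "(\<integral>\<^sup>+s. ennreal ((f s)\<^sup>2) \<partial>lborel) \<le> 1" and H: "(\<integral>\<^sup>+s. ennreal (h s powr q) \<partial>lborel) \<le> 1"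
    and m: "m > 0" "emeasure lborel B = ennreal m"
  shows "(\<integral>\<^sup>+s. \<integral>\<^sup>+w. ennreal (f s * h (s + w)) * indicator B w \<partial>lborel \<partial>lborel) \<le> ennreal (m powr (1/2 + 1/p))"
proof -
  \<comment> \<open>The weights of \<open>Young_pointwise\<close>; two of them carry the factor 1/m,
    which cancels the measure of \<open>B\<close> when \<open>w\<close> is integrated.\<close>
  define c1 c2 c3 where "c1 = 1/p/m" and "c2 = 1/2 - 1/p" and "c3 = 1/2/m"
  have c: "c1 \<ge> 0" "c2 \<ge> 0" "c3 \<ge> 0"
    using p m by (auto simp: c1_def c2_def c3_def field_simps)
  define T1 T2 T3 where "T1 s w = ennreal c1 * (ennreal ((f s)\<^sup>2) * indicator B w)"
    and "T2 s w = ennreal c2 * (ennreal ((f s)\<^sup>2) * ennreal (h (s + w) powr q))"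
    and "T3 s w = ennreal c3 * (ennreal (h (s + w) powr q) * indicator B w)" for s w
  have [measurable]: "case_prod T1 \<in> borel_measurable (lborel \<Otimes>\<^sub>M lborel)"
     "case_prod T2 \<in> borel_measurable (lborel \<Otimes>\<^sub>M lborel)" "case_prod T3 \<in> borel_measurable (lborel \<Otimes>\<^sub>M lborel)"
    unfolding T1_def T2_def T3_def by measurable
  have le: "ennreal (f s * h (s + w)) * indicator B w \<le> ennreal (m powr (1/2 + 1/p)) * (T1 s w + T2 s w + T3 s w)" for s w
  proof (cases "w \<in> B")
    case True
    have "ennreal (f s * h (s + w)) \<le> ennreal (m powr (1/2 + 1/p) *
        (c1 * (f s)\<^sup>2 + c2 * ((f s)\<^sup>2 * h (s + w) powr q) + c3 * h (s + w) powr q))"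
      using Young_pointwise[OF p q m(1) nn(1)[of s] nn(2)[of "s + w"]]
      by (intro ennreal_leI) (simp add: c1_def c2_def c3_def)
    also have "\<dots> = ennreal (m powr (1/2 + 1/p)) * (T1 s w + T2 s w + T3 s w)"
      using True c nn by (simp add: T1_def T2_def T3_def ennreal_mult ennreal_plus)
    finally show ?thesis using True by simp
  qed simp
  have I1: "(\<integral>\<^sup>+s. \<integral>\<^sup>+w. T1 s w \<partial>lborel \<partial>lborel) \<le> ennreal (1/p)"
  proof -
    have "(\<integral>\<^sup>+s. \<integral>\<^sup>+w. T1 s w \<partial>lborel \<partial>lborel) = ennreal c1 * ((\<integral>\<^sup>+s. ennreal ((f s)\<^sup>2) \<partial>lborel) * ennreal m)"
      by (simp add: T1_def nn_integral_cmult nn_integral_multc m(2))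
    also have "\<dots> \<le> ennreal c1 * (1 * ennreal m)"
      using F by (intro mult_left_mono mult_right_mono) auto
    also have "\<dots> = ennreal (1/p)"
      using c m by (simp add: c1_def flip: ennreal_mult)
    finally show ?thesis .
  qed
  have I2: "(\<integral>\<^sup>+s. \<integral>\<^sup>+w. T2 s w \<partial>lborel \<partial>lborel) \<le> ennreal (1/2 - 1/p)"
  proof -
    have "(\<integral>\<^sup>+s. \<integral>\<^sup>+w. T2 s w \<partial>lborel \<partial>lborel) =
        ennreal c2 * ((\<integral>\<^sup>+s. ennreal ((f s)\<^sup>2) \<partial>lborel) * (\<integral>\<^sup>+s. ennreal (h s powr q) \<partial>lborel))"
      using nn_integral_lborel_translate[of "\<lambda>s. ennreal (h s powr q)"]
      by (simp add: T2_def nn_integral_cmult nn_integral_multc)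
    also have "\<dots> \<le> ennreal c2 * (1 * 1)"
      using F H by (intro mult_left_mono mult_mono) auto
    finally show ?thesis by (simp add: c2_def)
  qed
  have I3: "(\<integral>\<^sup>+s. \<integral>\<^sup>+w. T3 s w \<partial>lborel \<partial>lborel) \<le> ennreal (1/2)"
  proof -
    \<comment> \<open>Integrating in \<open>s\<close> first lets translation invariance remove the
      shift by \<open>w\<close>.\<close>
    have "(\<integral>\<^sup>+s. \<integral>\<^sup>+w. T3 s w \<partial>lborel \<partial>lborel) = (\<integral>\<^sup>+w. \<integral>\<^sup>+s. T3 s w \<partial>lborel \<partial>lborel)"
      by (rule lborel_pair.Fubini'[symmetric]) measurable
    also have "\<dots> = ennreal c3 * ((\<integral>\<^sup>+s. ennreal (h s powr q) \<partial>lborel) * ennreal m)"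
      using nn_integral_lborel_translate[of "\<lambda>s. ennreal (h s powr q)"]
      by (simp add: T3_def nn_integral_cmult nn_integral_multc add.commute m(2))
    also have "\<dots> \<le> ennreal c3 * (1 * ennreal m)"
      using H by (intro mult_left_mono mult_right_mono) auto
    also have "\<dots> = ennreal (1/2)"
      using c m by (simp add: c3_def flip: ennreal_mult)
    finally show ?thesis .
  qed
  have "(\<integral>\<^sup>+s. \<integral>\<^sup>+w. ennreal (f s * h (s + w)) * indicator B w \<partial>lborel \<partial>lborel)
      \<le> (\<integral>\<^sup>+s. \<integral>\<^sup>+w. ennreal (m powr (1/2 + 1/p)) * (T1 s w + T2 s w + T3 s w) \<partial>lborel \<partial>lborel)"
    by (intro nn_integral_mono le)
  also have "\<dots> = ennreal (m powr (1/2 + 1/p)) * ((\<integral>\<^sup>+s. \<integral>\<^sup>+w. T1 s w \<partial>lborel \<partial>lborel) +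
      (\<integral>\<^sup>+s. \<integral>\<^sup>+w. T2 s w \<partial>lborel \<partial>lborel) + (\<integral>\<^sup>+s. \<integral>\<^sup>+w. T3 s w \<partial>lborel \<partial>lborel))"
    by (simp add: nn_integral_cmult nn_integral_add)
  also have "\<dots> \<le> ennreal (m powr (1/2 + 1/p)) * (ennreal (1/p) + ennreal (1/2 - 1/p) + ennreal (1/2))"
    by (intro mult_left_mono add_mono I1 I2 I3) simp
  \<comment> \<open>The three bounds are the three weights, hence their sum is 1.\<close>
  also have "ennreal (1/p) + ennreal (1/2 - 1/p) + ennreal (1/2) = 1"
  proof -
    have "0 \<le> 1/p" "0 \<le> 1/2 - 1/p" using p by (auto simp: field_simps)
    then have "ennreal (1/p) + ennreal (1/2 - 1/p) = ennreal (1/2)"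
      by (simp only: ennreal_plus[symmetric]) simp
    moreover have "ennreal (1/2) + ennreal (1/2) = 1"
      by (subst ennreal_plus[symmetric]) auto
    ultimately show ?thesis by simp
  qed
  finally show ?thesis by simp
qed

section \<open>Oscillation of a test function over discs\<close>

lemma emeasure_lborel_cball_plane:
  assumes "r \<ge> 0"
  shows "emeasure lborel (cball (c::real^2) r) = ennreal (pi * r\<^sup>2)"
  using emeasure_cball[OF assms, of c] by (simp add: unit_ball_vol_2)

text \<open>The fundamental theorem of calculus along the segment from s to s+w, with each component
  of \<open>w\<close> bounded by its norm. The sum of the moduli of the partial derivatives stands
  in for the norm of the gradient.\<close>

lemma difference_le_gradient_integral:
  assumes "\<phi> \<in> test_functions D"
  shows "ennreal \<bar>\<phi> (s + w) - \<phi> s\<bar> \<le>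
    (\<integral>\<^sup>+\<tau>. ennreal (norm w * (\<Sum>i\<in>UNIV. \<bar>partial_deriv i \<phi> (s + \<tau> *\<^sub>R w)\<bar>)) * indicator {0..1} \<tau> \<partial>lborel)"
proof -
  define g where "g \<tau> = (\<Sum>i\<in>UNIV. w $ i * partial_deriv i \<phi> (s + \<tau> *\<^sub>R w))" for \<tau> :: real
  have d: "((\<lambda>\<tau>. \<phi> (s + \<tau> *\<^sub>R w)) has_vector_derivative g \<tau>) (at \<tau> within {0..1})" for \<tau>
  proof -
    have "((\<lambda>\<tau>. s + \<tau> *\<^sub>R w) has_derivative (\<lambda>h. h *\<^sub>R w)) (at \<tau>)"
      by (auto intro!: derivative_eq_intros)
    from has_derivative_compose[OF this differentiable_frechet[OF test_functions_differentiable[OF assms]]]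
    have "((\<lambda>\<tau>. \<phi> (s + \<tau> *\<^sub>R w)) has_derivative
        (\<lambda>h. frechet_derivative \<phi> (at (s + \<tau> *\<^sub>R w)) (h *\<^sub>R w))) (at \<tau>)" .
    moreover have "frechet_derivative \<phi> (at (s + \<tau> *\<^sub>R w)) (h *\<^sub>R w) = h *\<^sub>R g \<tau>" for h
    proof -
      have lin: "linear (frechet_derivative \<phi> (at (s + \<tau> *\<^sub>R w)))"
        using test_functions_differentiable[OF assms] linear_frechet_derivative by blast
      have "w = (\<Sum>i\<in>UNIV. w $ i *\<^sub>R axis i 1)"
        using basis_expansion[of w] by (simp add: scalar_mult_eq_scaleR)
      then have "frechet_derivative \<phi> (at (s + \<tau> *\<^sub>R w)) w = g \<tau>"
      proof -
        have "frechet_derivative \<phi> (at (s + \<tau> *\<^sub>R w)) (\<Sum>i\<in>UNIV. w $ i *\<^sub>R axis i 1) = g \<tau>"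
          by (simp add: linear_sum[OF lin] linear_scale[OF lin] g_def partial_deriv_def)
        then show ?thesis using \<open>w = _\<close> by simp
      qed
      then show ?thesis using linear_scale[OF lin] by simp
    qed
    ultimately show ?thesis
      by (simp add: has_vector_derivative_def has_derivative_at_withinI)
  qed
  have cont: "continuous_on {0..1} g"
    unfolding g_def
    by (intro continuous_intros continuous_on_compose2[OF test_functions_partial_continuous[OF assms]]) auto
  have "\<phi> (s + w) - \<phi> s = (\<integral>\<tau>. indicator {0..1} \<tau> *\<^sub>R g \<tau> \<partial>lborel)"
    using integral_FTC_atLeastAtMost[of 0 1 "\<lambda>\<tau>. \<phi> (s + \<tau> *\<^sub>R w)" g, OF _ d cont] by simp
  then have "ennreal \<bar>\<phi> (s + w) - \<phi> s\<bar> \<le> (\<integral>\<^sup>+\<tau>. norm (indicator {0..1} \<tau> *\<^sub>R g \<tau>) \<partial>lborel)"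
    using integral_norm_bound_ennreal[OF borel_integrable_atLeastAtMost'[OF cont, unfolded set_integrable_def]]
    by simp
  also have "\<dots> \<le> (\<integral>\<^sup>+\<tau>. ennreal (norm w * (\<Sum>i\<in>UNIV. \<bar>partial_deriv i \<phi> (s + \<tau> *\<^sub>R w)\<bar>)) * indicator {0..1} \<tau> \<partial>lborel)"
  proof (rule nn_integral_mono)
    fix \<tau> :: real
    have "\<bar>g \<tau>\<bar> \<le> (\<Sum>i\<in>UNIV. \<bar>w $ i\<bar> * \<bar>partial_deriv i \<phi> (s + \<tau> *\<^sub>R w)\<bar>)"
      unfolding g_def using sum_abs[of "\<lambda>i. w $ i * partial_deriv i \<phi> (s + \<tau> *\<^sub>R w)" UNIV] by (simp add: abs_mult)
    also have "\<dots> \<le> (\<Sum>i\<in>UNIV. norm w * \<bar>partial_deriv i \<phi> (s + \<tau> *\<^sub>R w)\<bar>)"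
      by (intro sum_mono mult_right_mono component_le_norm_cart) auto
    finally show "ennreal (norm (indicator {0..1} \<tau> *\<^sub>R g \<tau>)) \<le>
        ennreal (norm w * (\<Sum>i\<in>UNIV. \<bar>partial_deriv i \<phi> (s + \<tau> *\<^sub>R w)\<bar>)) * indicator {0..1} \<tau>"
      by (auto simp: sum_distrib_left intro!: ennreal_leI split: split_indicator)
  qed
  finally show ?thesis .
qed

text \<open>For fixed \<tau> the dilation by \<tau> turns the integrals over \<open>s\<close> and
  \<open>w\<close> into those of \<open>Young_indicator\<close> on the disc of radius \<tau> r. The
  area of this disc contributes \<tau>^{1 + 2/p} and the Jacobian divides by \<tau>^2; the remaining
  \<tau>^{2/p - 1} is integrable near 0.\<close>

lemma averaging_estimate:
  fixes f :: "real^2 \<Rightarrow> real"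
  assumes p: "p > 2" and q: "q = p / (p - 1)" and \<phi>: "\<phi> \<in> test_functions D" and r: "r > 0"
    and f[measurable]: "f \<in> borel_measurable borel" "\<And>s. f s \<ge> 0"
    and F: "(\<integral>\<^sup>+s. ennreal ((f s)\<^sup>2) \<partial>lborel) \<le> 1"
    and H: "(\<integral>\<^sup>+s. ennreal ((\<Sum>i\<in>UNIV. \<bar>partial_deriv i \<phi> s\<bar>) powr q) \<partial>lborel) \<le> 1"
  shows "(\<integral>\<^sup>+s. \<integral>\<^sup>+w. ennreal (f s * \<bar>\<phi> (s + w) - \<phi> s\<bar>) * indicator (cball 0 r) w \<partial>lborel \<partial>lborel)
    \<le> ennreal (p / 2 * (r * (pi * r\<^sup>2) powr (1/2 + 1/p)))"
proof -
  define h where "h s = (\<Sum>i\<in>UNIV. \<bar>partial_deriv i \<phi> s\<bar>)" for s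
  have hnn: "h s \<ge> 0" for s by (simp add: h_def sum_nonneg)
  have [measurable]: "\<phi> \<in> borel_measurable borel"
    using test_functions_continuous[OF \<phi>] by (rule borel_measurable_continuous_onI)
  have [measurable]: "partial_deriv i \<phi> \<in> borel_measurable borel" for i
    using test_functions_partial_continuous[OF \<phi>] by (rule borel_measurable_continuous_onI)
  have h[measurable]: "h \<in> borel_measurable borel"
    unfolding h_def by measurable
  have [measurable]: "cball 0 r \<in> sets (borel :: (real^2) measure)" "{0..1::real} \<in> sets borel"
    by auto
  define G where "G \<tau> s w = ennreal (f s * h (s + \<tau> *\<^sub>R w)) * indicator (cball 0 r) w" for \<tau> s w
  have "(\<integral>\<^sup>+s. \<integral>\<^sup>+w. ennreal (f s * \<bar>\<phi> (s + w) - \<phi> s\<bar>) * indicator (cball 0 r) w \<partial>lborel \<partial>lborel)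
    \<le> (\<integral>\<^sup>+s. \<integral>\<^sup>+w. \<integral>\<^sup>+\<tau>. ennreal r * G \<tau> s w * indicator {0..1} \<tau> \<partial>lborel \<partial>lborel \<partial>lborel)"
  proof (intro nn_integral_mono)
    fix s w
    show "ennreal (f s * \<bar>\<phi> (s + w) - \<phi> s\<bar>) * indicator (cball 0 r) w
        \<le> (\<integral>\<^sup>+\<tau>. ennreal r * G \<tau> s w * indicator {0..1} \<tau> \<partial>lborel)"
    proof (cases "w \<in> cball 0 r")
      case True
      then have w: "norm w \<le> r" by simp
      have "ennreal (f s * \<bar>\<phi> (s + w) - \<phi> s\<bar>) = ennreal (f s) * ennreal \<bar>\<phi> (s + w) - \<phi> s\<bar>"
        using f(2) by (simp add: ennreal_mult)
      also have "\<dots> \<le> ennreal (f s) * (\<integral>\<^sup>+\<tau>. ennreal (norm w * h (s + \<tau> *\<^sub>R w)) * indicator {0..1} \<tau> \<partial>lborel)"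
        unfolding h_def by (intro mult_left_mono difference_le_gradient_integral[OF \<phi>]) simp
      also have "\<dots> = (\<integral>\<^sup>+\<tau>. ennreal (f s) * (ennreal (norm w * h (s + \<tau> *\<^sub>R w)) * indicator {0..1} \<tau>) \<partial>lborel)"
        by (rule nn_integral_cmult[symmetric]) measurable
      also have "\<dots> \<le> (\<integral>\<^sup>+\<tau>. ennreal r * G \<tau> s w * indicator {0..1} \<tau> \<partial>lborel)"
      proof (rule nn_integral_mono)
        fix \<tau> :: real
        have "ennreal (f s * (norm w * h (s + \<tau> *\<^sub>R w))) \<le> ennreal (r * (f s * h (s + \<tau> *\<^sub>R w)))"
          using mult_right_mono[OF w, of "f s * h (s + \<tau> *\<^sub>R w)"] f(2) hnn
          by (intro ennreal_leI) (simp add: mult_ac)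
        then show "ennreal (f s) * (ennreal (norm w * h (s + \<tau> *\<^sub>R w)) * indicator {0..1} \<tau>)
            \<le> ennreal r * G \<tau> s w * indicator {0..1} \<tau>"
          using True f(2) hnn r by (auto simp: G_def ennreal_mult split: split_indicator)
      qed
      finally show ?thesis using True by simp
    qed simp
  qed
  also have "\<dots> = (\<integral>\<^sup>+s. \<integral>\<^sup>+\<tau>. \<integral>\<^sup>+w. ennreal r * G \<tau> s w * indicator {0..1} \<tau> \<partial>lborel \<partial>lborel \<partial>lborel)"
    unfolding G_def by (intro nn_integral_cong lborel_pair.Fubini') measurable
  also have "\<dots> = (\<integral>\<^sup>+\<tau>. \<integral>\<^sup>+s. \<integral>\<^sup>+w. ennreal r * G \<tau> s w * indicator {0..1} \<tau> \<partial>lborel \<partial>lborel \<partial>lborel)"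
    unfolding G_def by (intro lborel_pair.Fubini') measurable
  also have "\<dots> = (\<integral>\<^sup>+\<tau>. ennreal r * (\<integral>\<^sup>+s. \<integral>\<^sup>+w. G \<tau> s w \<partial>lborel \<partial>lborel) * indicator {0..1} \<tau> \<partial>lborel)"
    unfolding G_def by (simp add: nn_integral_cmult nn_integral_multc)
  also have "\<dots> \<le> (\<integral>\<^sup>+\<tau>. ennreal (r * (pi * r\<^sup>2) powr (1/2 + 1/p)) * (ennreal (\<tau> powr (2/p - 1)) * indicator {0..1} \<tau>) \<partial>lborel)"
  proof (rule nn_integral_mono_AE)
    \<comment> \<open>The dilation requires \<tau> > 0, so the single point 0 is discarded.\<close>
    have "AE \<tau> in lborel. \<tau> \<noteq> (0::real)" by (rule AE_lborel_singleton)
    then show "AE \<tau> in lborel. ennreal r * (\<integral>\<^sup>+s. \<integral>\<^sup>+w. G \<tau> s w \<partial>lborel \<partial>lborel) * indicator {0..1} \<tau>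
        \<le> ennreal (r * (pi * r\<^sup>2) powr (1/2 + 1/p)) * (ennreal (\<tau> powr (2/p - 1)) * indicator {0..1} \<tau>)"
    proof eventually_elim
      case (elim \<tau>)
      show ?case
      proof (cases "\<tau> \<in> {0..1}")
        case True
        with elim have \<tau>: "\<tau> > 0" by auto
        have "ennreal (\<tau>\<^sup>2) * (\<integral>\<^sup>+s. \<integral>\<^sup>+w. G \<tau> s w \<partial>lborel \<partial>lborel)
            = (\<integral>\<^sup>+s. ennreal (\<tau>\<^sup>2) * (\<integral>\<^sup>+w. G \<tau> s w \<partial>lborel) \<partial>lborel)"
          unfolding G_def by (rule nn_integral_cmult[symmetric]) measurable
        also have "\<dots> = (\<integral>\<^sup>+s. \<integral>\<^sup>+w. ennreal (f s * h (s + w)) * indicator (cball 0 (\<tau> * r)) w \<partial>lborel \<partial>lborel)"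
        proof (rule nn_integral_cong)
          fix s
          have ind: "indicator (cball 0 (\<tau> * r)) (\<tau> *\<^sub>R w) = (indicator (cball 0 r) w :: ennreal)" for w :: "real^2"
            using \<tau> by (auto split: split_indicator)
          show "ennreal (\<tau>\<^sup>2) * (\<integral>\<^sup>+w. G \<tau> s w \<partial>lborel)
              = (\<integral>\<^sup>+w. ennreal (f s * h (s + w)) * indicator (cball 0 (\<tau> * r)) w \<partial>lborel)"
          proof (subst nn_integral_lborel_scale[of "\<lambda>w::real^2. ennreal (f s * h (s + w)) * indicator (cball 0 (\<tau> * r)) w", OF _ \<tau>])
            have "cball 0 (\<tau> * r) \<in> sets (borel :: (real^2) measure)" by auto
            then show "(\<lambda>w. ennreal (f s * h (s + w)) * indicator (cball 0 (\<tau> * r)) w) \<in> borel_measurable borel"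
              by measurable
          qed (simp add: ind G_def[abs_def])
        qed
        also have "\<dots> \<le> ennreal ((pi * (\<tau> * r)\<^sup>2) powr (1/2 + 1/p))"
          using H r \<tau> f(2) hnn
          by (intro Young_indicator[OF p q _ _ _ _ _ F]) (auto simp: h_def[symmetric] emeasure_lborel_cball_plane)
        also have "(pi * (\<tau> * r)\<^sup>2) powr (1/2 + 1/p) = \<tau>\<^sup>2 * (\<tau> powr (2/p - 1) * (pi * r\<^sup>2) powr (1/2 + 1/p))"
        proof -
          have "(pi * (\<tau> * r)\<^sup>2) powr (1/2 + 1/p) = (\<tau>\<^sup>2) powr (1/2 + 1/p) * (pi * r\<^sup>2) powr (1/2 + 1/p)"
            by (simp add: power_mult_distrib powr_mult mult_ac)
          also have "(\<tau>\<^sup>2) powr (1/2 + 1/p) = (\<tau> powr 2) powr (1/2 + 1/p)"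
            using \<tau> by (simp add: powr_numeral)
          also have "\<dots> = \<tau> powr (2 + (2/p - 1))"
            unfolding powr_powr by (simp add: algebra_simps)
          also have "\<dots> = \<tau>\<^sup>2 * \<tau> powr (2/p - 1)"
            using \<tau> by (simp only: powr_add) (simp add: powr_numeral)
          finally show ?thesis by (simp add: mult_ac)
        qed
        finally have "ennreal (\<tau>\<^sup>2) * (\<integral>\<^sup>+s. \<integral>\<^sup>+w. G \<tau> s w \<partial>lborel \<partial>lborel)
            \<le> ennreal (\<tau>\<^sup>2) * ennreal (\<tau> powr (2/p - 1) * (pi * r\<^sup>2) powr (1/2 + 1/p))"
          by (simp add: ennreal_mult)
        then have "(\<integral>\<^sup>+s. \<integral>\<^sup>+w. G \<tau> s w \<partial>lborel \<partial>lborel) \<le> ennreal (\<tau> powr (2/p - 1) * (pi * r\<^sup>2) powr (1/2 + 1/p))"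
          using \<tau> by (subst (asm) ennreal_mult_le_mult_iff) auto
        then have "ennreal r * (\<integral>\<^sup>+s. \<integral>\<^sup>+w. G \<tau> s w \<partial>lborel \<partial>lborel) \<le>
            ennreal r * ennreal (\<tau> powr (2/p - 1) * (pi * r\<^sup>2) powr (1/2 + 1/p))"
          by (rule mult_left_mono) simp
        also have "\<dots> = ennreal (r * (pi * r\<^sup>2) powr (1/2 + 1/p)) * ennreal (\<tau> powr (2/p - 1))"
          using r by (simp add: mult_ac flip: ennreal_mult)
        finally show ?thesis using True by simp
      qed simp
    qed
  qed
  also have "\<dots> = ennreal (r * (pi * r\<^sup>2) powr (1/2 + 1/p)) * (\<integral>\<^sup>+\<tau>. ennreal (\<tau> powr (2/p - 1)) * indicator {0..1} \<tau> \<partial>lborel)"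
    by (rule nn_integral_cmult) measurable
  \<comment> \<open>This integral over the unit interval is the origin of the factor p/2 in the
    rate.\<close>
  also have "(\<integral>\<^sup>+\<tau>. ennreal (\<tau> powr (2/p - 1)) * indicator {0..1} \<tau> \<partial>lborel) = ennreal (p / 2)"
    using nn_integral_has_integral_lebesgue'[OF _ has_integral_powr_from_0[of "2/p - 1" 1]] p
    by simp
  also have "ennreal (r * (pi * r\<^sup>2) powr (1/2 + 1/p)) * ennreal (p / 2) = ennreal (p / 2 * (r * (pi * r\<^sup>2) powr (1/2 + 1/p)))"
    using p r by (simp add: mult_ac flip: ennreal_mult)
  finally show ?thesis .
qed

section \<open>Compactness of the embedding into the dual Sobolev space\<close>

text \<open>Fubini is applied over products of \<open>lborel\<close>, for which Lebesgue
  measurability on \<open>D\<close> is too weak. The representative also carries the extension by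
  zero.\<close>

lemma borel_representative:
  fixes f :: "'a::euclidean_space \<Rightarrow> real"
  assumes D: "open D" and f: "f \<in> borel_measurable (lebesgue_on D)"
  obtains F where "F \<in> borel_measurable borel" "\<And>s. s \<notin> D \<Longrightarrow> F s = 0" "AE s in lebesgue_on D. f s = F s"
proof -
  have Dl: "D \<in> sets lebesgue" using D by (rule open_in_lebesgue)
  have "(\<lambda>s. if s \<in> D then f s else 0) \<in> borel_measurable lebesgue"
    using f Dl by (simp add: borel_measurable_if)
  then obtain g where g: "g \<in> borel_measurable lborel" "AE s in lborel. (if s \<in> D then f s else 0) = g s"
    using completion_ex_borel_measurable_real by blast
  show ?thesis
  proof
    show "(\<lambda>s. indicator D s * g s) \<in> borel_measurable borel"
      using g(1) D by (intro borel_measurable_times borel_measurable_indicator) (auto simp: borel_open)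
    show "indicator D s * g s = 0" if "s \<notin> D" for s using that by simp
    have "AE s in lebesgue. s \<in> D \<longrightarrow> f s = indicator D s * g s"
      using AE_completion[OF g(2)] by eventually_elim auto
    then show "AE s in lebesgue_on D. f s = indicator D s * g s"
      using Dl by (simp add: AE_restrict_space_iff)
  qed
qed

text \<open>The right-hand side of \<open>averaging_estimate\<close> divided by the area of the
  disc, that is, the error of replacing \<phi> by its means.\<close>

definition averaging_rate :: "real \<Rightarrow> real \<Rightarrow> real" where
  "averaging_rate p r = p / 2 * (r * (pi * r\<^sup>2) powr (1/2 + 1/p)) / (pi * r\<^sup>2)"

lemma averaging_rate_nonneg: "p > 0 \<Longrightarrow> r > 0 \<Longrightarrow> 0 \<le> averaging_rate p r"
  by (simp add: averaging_rate_def)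

lemma averaging_rate_le:
  assumes "p > 2" "r > 0"
  shows "averaging_rate p r \<le> p / 2 * r powr (2 / p)"
proof -
  have "(pi * r\<^sup>2) powr (1/2 + 1/p) / (pi * r\<^sup>2) = (pi * r\<^sup>2) powr (1/2 + 1/p - 1)"
    using assms by (simp only: powr_diff) simp
  also have "\<dots> = pi powr (1/p - 1/2) * (r powr 2) powr (1/p - 1/2)"
    using assms by (simp add: powr_mult algebra_simps)
  also have "\<dots> \<le> 1 * (r powr 2) powr (1/p - 1/2)"
  proof (rule mult_right_mono)
    have "1/p - 1/2 \<le> 0" using assms by (simp add: field_simps)
    then show "pi powr (1/p - 1/2) \<le> 1"
      using powr_mono[of "1/p - 1/2" 0 pi] pi_gt3 by simp
  qed simp
  also have "\<dots> = r powr (2/p - 1)"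
    unfolding powr_powr by (simp add: algebra_simps)
  finally have "r * ((pi * r\<^sup>2) powr (1/2 + 1/p) / (pi * r\<^sup>2)) \<le> r * r powr (2/p - 1)"
    using assms by (intro mult_left_mono) auto
  also have "r * r powr (2/p - 1) = r powr (2/p)"
    using assms by (simp add: powr_mult_base)
  finally have "p / 2 * (r * ((pi * r\<^sup>2) powr (1/2 + 1/p) / (pi * r\<^sup>2))) \<le> p / 2 * r powr (2/p)"
    using assms by (intro mult_left_mono) auto
  then show ?thesis
    by (simp only: averaging_rate_def times_divide_eq_right mult.assoc)
qed

text \<open>Integrating F(s) \<phi>(s+w) over \<open>s\<close> and over \<open>w\<close> in the
  disc, and subtracting the integral of F(s) (\<phi>(s+w) - \<phi>(s)), leaves the area times the
  pairing. The subtracted term is small by \<open>averaging_estimate\<close>; in the other one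
  Fubini moves the mean from \<phi> to \<open>F\<close>.\<close>

lemma averaging_bound_borel:
  fixes F :: "real^2 \<Rightarrow> real"
  assumes p: "p > 2" and q: "q = p / (p - 1)" and \<phi>: "\<phi> \<in> test_functions D" and r: "r > 0"
    and Fm[measurable]: "F \<in> borel_measurable borel" and Fi: "integrable lborel F"
    and F2: "(\<integral>\<^sup>+s. ennreal ((F s)\<^sup>2) \<partial>lborel) \<le> 1"
    and H: "(\<integral>\<^sup>+s. ennreal ((\<Sum>i\<in>UNIV. \<bar>partial_deriv i \<phi> s\<bar>) powr q) \<partial>lborel) \<le> 1"
  shows "\<bar>\<integral>s. F s * \<phi> s \<partial>lborel\<bar> \<le> averaging_rate p r +
    \<bar>\<integral>t. \<phi> t * ((\<integral>s. F s * indicator (cball t r) s \<partial>lborel) / (pi * r\<^sup>2)) \<partial>lborel\<bar>"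
proof -
  define m where "m = pi * r\<^sup>2"
  have m: "m > 0" using r by (simp add: m_def)
  define B where "B = (indicator (cball 0 r) :: real^2 \<Rightarrow> real)"
  have Bm[measurable]: "B \<in> borel_measurable borel"
    unfolding B_def by (intro borel_measurable_indicator) auto
  have Bi: "integrable lborel B" "(\<integral>w. B w \<partial>lborel) = m"
    using emeasure_lborel_cball_plane[of r 0] r
    unfolding B_def m_def by (auto simp: measure_def intro!: integrable_real_indicator)
  have B01: "0 \<le> B w" "B w \<le> 1" for w by (auto simp: B_def split: split_indicator)
  note cont = test_functions_continuous[OF \<phi>]
  obtain K where K: "compact K" "\<And>s. s \<notin> K \<Longrightarrow> \<phi> s = 0"
    by (rule test_functionsE[OF \<phi>]) blast
  have \<phi>m[measurable]: "\<phi> \<in> borel_measurable borel"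
    using cont by (rule borel_measurable_continuous_onI)
  have \<phi>i: "integrable lborel \<phi>"
    by (rule continuous_compact_support_integrable[OF cont K])
  obtain C where C: "C \<ge> 0" "\<And>s. \<bar>\<phi> s\<bar> \<le> C"
    by (rule continuous_compact_support_bounded[OF cont K]) blast+
  have prod: "integrable (lborel \<Otimes>\<^sub>M lborel) (\<lambda>(s, w). u s * v w)"
    if "integrable lborel u" "integrable lborel v" for u v :: "real^2 \<Rightarrow> real"
  proof (rule lborel_pair.Fubini_integrable)
    have [measurable]: "u \<in> borel_measurable borel" "v \<in> borel_measurable borel"
      using that by auto
    show "(\<lambda>(s, w). u s * v w) \<in> borel_measurable (lborel \<Otimes>\<^sub>M lborel)" by measurable
    show "integrable lborel (\<lambda>s. \<integral>w. norm (case (s, w) of (s, w) \<Rightarrow> u s * v w) \<partial>lborel)"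
      using that by (simp add: abs_mult)
    show "AE s in lborel. integrable lborel (\<lambda>w. case (s, w) of (s, w) \<Rightarrow> u s * v w)"
      using that by simp
  qed
  \<comment> \<open>\<phi> is bounded, so the joint integrand is dominated by a product of two
    integrable functions.\<close>
  have J: "integrable (lborel \<Otimes>\<^sub>M lborel) (\<lambda>(s, w). F s * \<phi> (s + w) * B w)"
  proof (rule Bochner_Integration.integrable_bound)
    show "integrable (lborel \<Otimes>\<^sub>M lborel) (\<lambda>x. C * (case x of (s, w) \<Rightarrow> F s * B w))"
      using prod[OF Fi Bi(1)] by (rule integrable_mult_right)
    show "AE x in lborel \<Otimes>\<^sub>M lborel. norm (case x of (s, w) \<Rightarrow> F s * \<phi> (s + w) * B w)
        \<le> norm (C * (case x of (s, w) \<Rightarrow> F s * B w))"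
    proof (rule AE_I2)
      fix x :: "(real^2) \<times> (real^2)"
      obtain s w where x: "x = (s, w)" by (cases x)
      have "\<bar>\<phi> (s + w)\<bar> * \<bar>F s * B w\<bar> \<le> C * \<bar>F s * B w\<bar>"
        using C by (intro mult_right_mono) auto
      then show "norm (case x of (s, w) \<Rightarrow> F s * \<phi> (s + w) * B w) \<le> norm (C * (case x of (s, w) \<Rightarrow> F s * B w))"
        using C by (simp add: x abs_mult mult_ac)
    qed
  qed measurable
  have J0: "integrable (lborel \<Otimes>\<^sub>M lborel) (\<lambda>(s, w). F s * \<phi> s * B w)"
  proof -
    have "integrable lborel (\<lambda>s. F s * \<phi> s)"
    proof (rule Bochner_Integration.integrable_bound)
      show "integrable lborel (\<lambda>s. C * F s)" using Fi by simp
      show "AE s in lborel. norm (F s * \<phi> s) \<le> norm (C * F s)"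
      proof (rule AE_I2)
        fix s show "norm (F s * \<phi> s) \<le> norm (C * F s)"
          using C mult_left_mono[OF C(2)[of s], of "\<bar>F s\<bar>"] by (simp add: abs_mult mult_ac)
      qed
    qed measurable
    from prod[OF this Bi(1)] show ?thesis .
  qed
  have I: "integrable (lborel \<Otimes>\<^sub>M lborel) (\<lambda>(s, w). F s * (\<phi> (s + w) - \<phi> s) * B w)"
    using Bochner_Integration.integrable_diff[OF J J0] by (simp add: case_prod_unfold algebra_simps)
  have eq: "m * (\<integral>s. F s * \<phi> s \<partial>lborel) =
     (\<integral>x. (case x of (s, w) \<Rightarrow> F s * \<phi> (s + w) * B w) \<partial>(lborel \<Otimes>\<^sub>M lborel)) -
     (\<integral>x. (case x of (s, w) \<Rightarrow> F s * (\<phi> (s + w) - \<phi> s) * B w) \<partial>(lborel \<Otimes>\<^sub>M lborel))"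
  proof -
    have "(\<integral>x. (case x of (s, w) \<Rightarrow> F s * \<phi> s * B w) \<partial>(lborel \<Otimes>\<^sub>M lborel)) = (\<integral>s. \<integral>w. F s * \<phi> s * B w \<partial>lborel \<partial>lborel)"
      using lborel_pair.integral_fst[OF J0] by simp
    also have "\<dots> = m * (\<integral>s. F s * \<phi> s \<partial>lborel)"
      by (simp add: Bi(2) mult.commute)
    finally show ?thesis
      using Bochner_Integration.integral_diff[OF J I] by (simp add: case_prod_unfold algebra_simps)
  qed
  have Ib: "\<bar>\<integral>x. (case x of (s, w) \<Rightarrow> F s * (\<phi> (s + w) - \<phi> s) * B w) \<partial>(lborel \<Otimes>\<^sub>M lborel)\<bar> \<le> m * averaging_rate p r"
  proof -
    have "ennreal \<bar>\<integral>x. (case x of (s, w) \<Rightarrow> F s * (\<phi> (s + w) - \<phi> s) * B w) \<partial>(lborel \<Otimes>\<^sub>M lborel)\<bar>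
        \<le> (\<integral>\<^sup>+x. norm (case x of (s, w) \<Rightarrow> F s * (\<phi> (s + w) - \<phi> s) * B w) \<partial>(lborel \<Otimes>\<^sub>M lborel))"
      using integral_norm_bound_ennreal[OF I] by simp
    also have "\<dots> = (\<integral>\<^sup>+s. \<integral>\<^sup>+w. ennreal (norm (F s * (\<phi> (s + w) - \<phi> s) * B w)) \<partial>lborel \<partial>lborel)"
      by (subst lborel.nn_integral_fst[symmetric]) (auto simp: case_prod_beta)
    also have "\<dots> = (\<integral>\<^sup>+s. \<integral>\<^sup>+w. ennreal (\<bar>F s\<bar> * \<bar>\<phi> (s + w) - \<phi> s\<bar>) * indicator (cball 0 r) w \<partial>lborel \<partial>lborel)"
      by (intro nn_integral_cong) (auto simp: abs_mult B_def split: split_indicator)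
    also have "\<dots> \<le> ennreal (p / 2 * (r * (pi * r\<^sup>2) powr (1/2 + 1/p)))"
      using F2 H by (intro averaging_estimate[OF p q \<phi> r]) auto
    also have "p / 2 * (r * (pi * r\<^sup>2) powr (1/2 + 1/p)) = m * averaging_rate p r"
      using r by (simp add: averaging_rate_def m_def)
    finally show ?thesis
      using m averaging_rate_nonneg[of p r] p r by (simp add: ennreal_le_iff)
  qed
  have Jeq: "(\<integral>x. (case x of (s, w) \<Rightarrow> F s * \<phi> (s + w) * B w) \<partial>(lborel \<Otimes>\<^sub>M lborel)) =
     (\<integral>t. \<phi> t * (\<integral>s. F s * indicator (cball t r) s \<partial>lborel) \<partial>lborel)"
  proof -
    have "(\<integral>x. (case x of (s, w) \<Rightarrow> F s * \<phi> (s + w) * B w) \<partial>(lborel \<Otimes>\<^sub>M lborel)) =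
       (\<integral>s. \<integral>w. F s * \<phi> (s + w) * B w \<partial>lborel \<partial>lborel)"
      using lborel_pair.integral_fst[OF J] by simp
    also have "\<dots> = (\<integral>s. \<integral>t. F s * \<phi> t * B (t - s) \<partial>lborel \<partial>lborel)"
    proof (rule Bochner_Integration.integral_cong[OF refl])
      fix s
      show "(\<integral>w. F s * \<phi> (s + w) * B w \<partial>lborel) = (\<integral>t. F s * \<phi> t * B (t - s) \<partial>lborel)"
        using integral_lborel_translate[of "\<lambda>t. F s * \<phi> t * B (t - s)" s] by simp
    qed
    also have "\<dots> = (\<integral>t. \<integral>s. F s * \<phi> t * B (t - s) \<partial>lborel \<partial>lborel)"
    proof (rule lborel_pair.Fubini_integral[symmetric])
      show "integrable (lborel \<Otimes>\<^sub>M lborel) (\<lambda>(s, t). F s * \<phi> t * B (t - s))"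
      proof (rule Bochner_Integration.integrable_bound[OF prod[OF Fi \<phi>i]])
        show "AE x in lborel \<Otimes>\<^sub>M lborel. norm (case x of (s, t) \<Rightarrow> F s * \<phi> t * B (t - s))
          \<le> norm (case x of (s, t) \<Rightarrow> F s * \<phi> t)"
        proof (rule AE_I2)
          fix x :: "(real^2) \<times> (real^2)"
          obtain s t where x: "x = (s, t)" by (cases x)
          have "\<bar>F s * \<phi> t\<bar> * \<bar>B (t - s)\<bar> \<le> \<bar>F s * \<phi> t\<bar> * 1"
            using B01[of "t - s"] by (intro mult_left_mono) auto
          then show "norm (case x of (s, t) \<Rightarrow> F s * \<phi> t * B (t - s)) \<le> norm (case x of (s, t) \<Rightarrow> F s * \<phi> t)"
            by (simp add: x abs_mult)
        qed
      qed measurable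
    qed
    also have "\<dots> = (\<integral>t. \<phi> t * (\<integral>s. F s * indicator (cball t r) s \<partial>lborel) \<partial>lborel)"
    proof (rule Bochner_Integration.integral_cong[OF refl])
      fix t
      \<comment> \<open>Symmetry of the disc: t - s lies in the disc about 0 exactly when s lies in
        the disc about t.\<close>
      have "(\<lambda>s. F s * \<phi> t * B (t - s)) = (\<lambda>s. \<phi> t * (F s * indicator (cball t r) s))"
        by (auto simp: B_def dist_norm norm_minus_commute fun_eq_iff split: split_indicator)
      then show "(\<integral>s. F s * \<phi> t * B (t - s) \<partial>lborel) = \<phi> t * (\<integral>s. F s * indicator (cball t r) s \<partial>lborel)"
        by simp
    qed
    finally show ?thesis .
  qed
  have eq2: "(\<integral>t. \<phi> t * ((\<integral>s. F s * indicator (cball t r) s \<partial>lborel) / m) \<partial>lborel) =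
      (\<integral>t. \<phi> t * (\<integral>s. F s * indicator (cball t r) s \<partial>lborel) \<partial>lborel) / m"
    unfolding times_divide_eq_right by (rule integral_divide_zero)
  have "m * \<bar>\<integral>s. F s * \<phi> s \<partial>lborel\<bar> = \<bar>m * (\<integral>s. F s * \<phi> s \<partial>lborel)\<bar>"
    using m by (simp add: abs_mult)
  also have "\<dots> \<le> \<bar>\<integral>t. \<phi> t * (\<integral>s. F s * indicator (cball t r) s \<partial>lborel) \<partial>lborel\<bar> + m * averaging_rate p r"
    unfolding eq using Ib Jeq by linarith
  finally have "\<bar>\<integral>s. F s * \<phi> s \<partial>lborel\<bar> \<le>
      (\<bar>\<integral>t. \<phi> t * (\<integral>s. F s * indicator (cball t r) s \<partial>lborel) \<partial>lborel\<bar> + m * averaging_rate p r) / m"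
    using m by (simp add: pos_le_divide_eq mult.commute)
  also have "\<dots> = averaging_rate p r + \<bar>\<integral>t. \<phi> t * ((\<integral>s. F s * indicator (cball t r) s \<partial>lborel) / m) \<partial>lborel\<bar>"
    unfolding eq2 using m by (simp add: add_divide_distrib abs_divide)
  finally show ?thesis by (simp add: m_def)
qed

lemma L2_measurable: "f \<in> carr (Lp_space D 2) \<Longrightarrow> f \<in> borel_measurable (lebesgue_on D)"
  by (simp add: carr_L2)

text \<open>The inherited Sobolev space has the conjugate exponent q, because its dual is the space
  \<open>Wm1p D p\<close> of right-hand sides.\<close>

locale sobolev_embedding = sobolev D q for D q +
  fixes p :: real
  assumes D_bounded: "bounded D" and p_gt_2: "p > 2" and q_eq: "q = p / (p - 1)"
begin

lemma D_lmeasurable: "D \<in> lmeasurable"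
  using D_bounded D_open by (rule lmeasurable_open)

lemma finite_measure_D: "finite_measure (lebesgue_on D)"
  using D_lmeasurable by (rule finite_measure_lebesgue_on)

lemma q_bounds: "1 < q" "q < 2"
  using p_gt_2 by (auto simp: q_eq field_simps)

text \<open>The function counts as zero off \<open>D\<close> and the divisor is the full area of the
  disc, also near the boundary; this is the mean that occurs in
  \<open>averaging_bound_borel\<close>.\<close>

definition ball_average :: "(real^2 \<Rightarrow> real) \<Rightarrow> real \<Rightarrow> real^2 \<Rightarrow> real" where
  "ball_average f r t = (\<integral>s. f s * indicator (cball t r) s \<partial>lebesgue_on D) / (pi * r\<^sup>2)"

lemma L2_integrable:
  assumes "f \<in> carr (Lp_space D 2)"
  shows "integrable (lebesgue_on D) f" "(\<integral>s. \<bar>f s\<bar> \<partial>lebesgue_on D) \<le> (1 + measure lebesgue D) * nrm (Lp_space D 2) f"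
proof -
  have "f \<in> carr (Lp_space D 1)"
    by (rule Lp_subset[OF D_lmeasurable _ _ assms]) auto
  then have "f \<in> borel_measurable (lebesgue_on D)" "integrable (lebesgue_on D) (\<lambda>s. \<bar>f s\<bar>)"
    by (auto simp: carr_Lp)
  then show "integrable (lebesgue_on D) f"
    using integrable_abs_cancel by blast
  show "(\<integral>s. \<bar>f s\<bar> \<partial>lebesgue_on D) \<le> (1 + measure lebesgue D) * nrm (Lp_space D 2) f"
    using Lp_nrm_le[OF D_lmeasurable _ _ assms, of 1] by (simp add: nrm_Lp[of _ 1])
qed

lemma test_function_L2:
  assumes "\<phi> \<in> test_functions D"
  shows "\<phi> \<in> carr (Lp_space D 2)"
proof -
  interpret S2: sobolev D 2 using D_open by unfold_locales auto
  show ?thesis using S2.test_function_W1p(1)[OF assms] by (simp add: carr_W1p)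
qed

lemma ball_average_L2:
  assumes f: "f \<in> carr (Lp_space D 2)" and r: "r > 0"
  shows "ball_average f r \<in> borel_measurable borel"
    and "\<bar>ball_average f r t\<bar> \<le> (\<integral>s. \<bar>f s\<bar> \<partial>lebesgue_on D) / (pi * r\<^sup>2)"
    and "ball_average f r \<in> carr (Lp_space D 2)"
proof -
  note fi = L2_integrable(1)[OF f]
  show *: "\<bar>ball_average f r t\<bar> \<le> (\<integral>s. \<bar>f s\<bar> \<partial>lebesgue_on D) / (pi * r\<^sup>2)" for t
  proof -
    have [measurable]: "(indicator (cball t r) :: real^2 \<Rightarrow> real) \<in> borel_measurable (lebesgue_on D)"
      by (intro measurable_restrict_space1 measurable_completion borel_measurable_indicator) auto
    have "\<bar>\<integral>s. f s * indicator (cball t r) s \<partial>lebesgue_on D\<bar> \<le> (\<integral>s. \<bar>f s\<bar> \<partial>lebesgue_on D)"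
    proof (rule order_trans[OF integral_abs_bound])
      show "(\<integral>s. \<bar>f s * indicator (cball t r) s\<bar> \<partial>lebesgue_on D) \<le> (\<integral>s. \<bar>f s\<bar> \<partial>lebesgue_on D)"
        by (rule integral_mono_AE') (use fi in \<open>auto simp: abs_mult split: split_indicator\<close>)
    qed
    then show ?thesis
      using r by (simp add: ball_average_def abs_mult divide_right_mono)
  qed
  obtain F where F[measurable]: "F \<in> borel_measurable borel" and F0: "\<And>s. s \<notin> D \<Longrightarrow> F s = 0"
    and FA: "AE s in lebesgue_on D. f s = F s"
    by (rule borel_representative[OF D_open L2_measurable[OF f]]) blast
  \<comment> \<open>As a convolution of a Borel representative with an indicator, the average is a
    parameter integral of a jointly measurable function.\<close>
  have "ball_average f r t = (\<integral>s. F s * indicator (cball 0 r) (t - s) \<partial>lborel) / (pi * r\<^sup>2)" for t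
  proof -
    have [measurable]: "cball 0 r \<in> sets (borel :: (real^2) measure)" by auto
    have m: "(\<lambda>s. F s * indicator (cball 0 r) (t - s)) \<in> borel_measurable borel" by measurable
    have "(\<integral>s. f s * indicator (cball t r) s \<partial>lebesgue_on D) = (\<integral>s. F s * indicator (cball 0 r) (t - s) \<partial>lebesgue_on D)"
    proof (rule integral_cong_AE)
      show "AE s in lebesgue_on D. f s * indicator (cball t r) s = F s * indicator (cball 0 r) (t - s)"
        using FA by eventually_elim (auto simp: dist_norm norm_minus_commute split: split_indicator)
      show "(\<lambda>s. f s * indicator (cball t r) s) \<in> borel_measurable (lebesgue_on D)"
      proof (rule borel_measurable_times[OF L2_measurable[OF f]])
        show "(indicator (cball t r) :: real^2 \<Rightarrow> real) \<in> borel_measurable (lebesgue_on D)"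
          by (intro measurable_restrict_space1 measurable_completion borel_measurable_indicator) auto
      qed
      show "(\<lambda>s. F s * indicator (cball 0 r) (t - s)) \<in> borel_measurable (lebesgue_on D)"
        using m by (intro measurable_restrict_space1 measurable_completion) simp
    qed
    also have "\<dots> = (\<integral>s. F s * indicator (cball 0 r) (t - s) \<partial>lborel)"
      by (rule integral_lebesgue_on_vanishing(1)[OF D_lebesgue m]) (simp add: F0)
    finally show ?thesis by (simp add: ball_average_def)
  qed
  then have eq: "ball_average f r = (\<lambda>t. (\<integral>s. F s * indicator (cball 0 r) (t - s) \<partial>lborel) / (pi * r\<^sup>2))"
    by (rule ext)
  show m: "ball_average f r \<in> borel_measurable borel"
  proof -
    have [measurable]: "cball 0 r \<in> sets (borel :: (real^2) measure)" by auto
    show ?thesis unfolding eq by measurable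
  qed
  interpret finite_measure "lebesgue_on D" by (rule finite_measure_D)
  have m': "ball_average f r \<in> borel_measurable (lebesgue_on D)"
    using m by (intro measurable_restrict_space1 measurable_completion) simp
  have "integrable (lebesgue_on D) (\<lambda>s. (ball_average f r s)\<^sup>2)"
  proof (rule integrable_const_bound)
    show "AE s in lebesgue_on D. norm ((ball_average f r s)\<^sup>2) \<le> ((\<integral>s. \<bar>f s\<bar> \<partial>lebesgue_on D) / (pi * r\<^sup>2))\<^sup>2"
      using * by (auto simp: abs_le_square_iff[symmetric] intro: order_trans[OF _ abs_ge_self])
  qed (use m' in measurable)
  with m' show "ball_average f r \<in> carr (Lp_space D 2)"
    by (simp add: carr_L2)
qed

text \<open>The threshold 1/2 pays for the passage from the two separate q-th powers to the power of
  the sum: convexity costs a factor of at most 2, while (1/2)^q \<le> 1/2.\<close>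

lemma gradient_bound_nrm:
  assumes \<phi>: "\<phi> \<in> test_functions D" and n: "nrm (W01p D q) \<phi> \<le> 1/2"
  shows "(\<integral>\<^sup>+s. ennreal ((\<Sum>i\<in>UNIV. \<bar>partial_deriv i \<phi> s\<bar>) powr q) \<partial>lborel) \<le> 1"
proof -
  obtain K where K: "compact K" "K \<subseteq> D" "\<And>s i. s \<notin> K \<Longrightarrow> partial_deriv i \<phi> s = 0"
    by (rule test_functionsE[OF \<phi>]) blast
  note cont = test_functions_partial_continuous[OF \<phi>]
  have c: "continuous_on UNIV (\<lambda>s. \<bar>partial_deriv i \<phi> s\<bar> powr q)" for i
    using cont q_bounds by (intro continuous_on_powr' continuous_intros) auto
  have i: "integrable lborel (\<lambda>s. \<bar>partial_deriv i \<phi> s\<bar> powr q)" for i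
    by (rule continuous_compact_support_integrable[OF c K(1)]) (simp add: K(3))
  define e where "e i = (\<integral>s. \<bar>partial_deriv i \<phi> s\<bar> powr q \<partial>lborel)" for i
  have e: "e i = (\<integral>s. \<bar>partial_deriv i \<phi> s\<bar> powr q \<partial>lebesgue_on D)" for i
    unfolding e_def
    by (rule integral_lebesgue_on_vanishing(1)[symmetric, OF D_lebesgue borel_measurable_continuous_onI[OF c]])
      (use K in auto)
  have "nrm (W01p D q) \<phi> powr q = energy \<phi> (\<lambda>s. \<chi> i. partial_deriv i \<phi> s)"
    unfolding nrm_W01p test_function_W1p(2)[OF \<phi>] using q_bounds energy_nonneg by (simp add: powr_powr)
  moreover have "nrm (W01p D q) \<phi> powr q \<le> (1/2) powr q"
    using n W01p.nrm_nonneg[OF test_function_W01p[OF \<phi>]] q_bounds by (intro powr_mono2) auto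
  moreover have "(1/2) powr q \<le> (1/2::real) powr 1"
    using q_bounds by (intro powr_mono') auto
  moreover have "energy \<phi> (\<lambda>s. \<chi> i. partial_deriv i \<phi> s) \<ge> (\<Sum>i\<in>UNIV. e i)"
    by (simp add: energy_def e)
  ultimately have sum: "e 1 + e 2 \<le> 1/2" by (simp add: sum_2)
  have "(\<Sum>i\<in>UNIV. \<bar>partial_deriv i \<phi> s\<bar>) powr q \<le>
      2 * (\<bar>partial_deriv 1 \<phi> s\<bar> powr q + \<bar>partial_deriv 2 \<phi> s\<bar> powr q)" for s
  proof -
    have two: "(1/2::real) powr (1 - q) \<le> 2"
    proof -
      have "(1/2::real) powr (1 - q) \<le> (1/2) powr (-1)"
        using q_bounds by (intro powr_mono') auto
      then show ?thesis by (simp add: powr_minus)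
    qed
    have "(\<Sum>i\<in>UNIV. \<bar>partial_deriv i \<phi> s\<bar>) powr q \<le>
        (1/2) powr (1 - q) * (\<bar>partial_deriv 1 \<phi> s\<bar> powr q + \<bar>partial_deriv 2 \<phi> s\<bar> powr q)"
      using abs_add_powr_le[of q "1/2" "\<bar>partial_deriv 1 \<phi> s\<bar>" "\<bar>partial_deriv 2 \<phi> s\<bar>"] q_bounds
      by (simp add: sum_2 distrib_left)
    also have "\<dots> \<le> 2 * (\<bar>partial_deriv 1 \<phi> s\<bar> powr q + \<bar>partial_deriv 2 \<phi> s\<bar> powr q)"
      using two by (intro mult_right_mono) auto
    finally show ?thesis .
  qed
  then have "(\<integral>\<^sup>+s. ennreal ((\<Sum>i\<in>UNIV. \<bar>partial_deriv i \<phi> s\<bar>) powr q) \<partial>lborel) \<le>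
      (\<integral>\<^sup>+s. ennreal (2 * (\<bar>partial_deriv 1 \<phi> s\<bar> powr q + \<bar>partial_deriv 2 \<phi> s\<bar> powr q)) \<partial>lborel)"
    by (intro nn_integral_mono ennreal_leI)
  also have "\<dots> = ennreal (\<integral>s. 2 * (\<bar>partial_deriv 1 \<phi> s\<bar> powr q + \<bar>partial_deriv 2 \<phi> s\<bar> powr q) \<partial>lborel)"
    using i by (intro nn_integral_eq_integral) auto
  also have "(\<integral>s. 2 * (\<bar>partial_deriv 1 \<phi> s\<bar> powr q + \<bar>partial_deriv 2 \<phi> s\<bar> powr q) \<partial>lborel) = 2 * (e 1 + e 2)"
    using i by (simp add: e_def)
  also have "ennreal (2 * (e 1 + e 2)) \<le> ennreal 1"
    using sum by (intro ennreal_leI) simp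
  finally show ?thesis by simp
qed

text \<open>This is \<open>averaging_bound_borel\<close> for a Borel representative of f/M.
  \<open>M\<close> is any positive bound instead of the norm itself, so that null functions are
  included and a whole sequence can share it.\<close>

lemma averaging_bound:
  assumes \<phi>: "\<phi> \<in> test_functions D" and n: "nrm (W01p D q) \<phi> \<le> 1/2" and r: "r > 0"
    and f: "f \<in> carr (Lp_space D 2)" "nrm (Lp_space D 2) f \<le> M" and M: "M > 0"
  shows "\<bar>\<integral>s. f s * \<phi> s \<partial>lebesgue_on D\<bar> \<le> averaging_rate p r * M +
    \<bar>\<integral>t. \<phi> t * ball_average f r t \<partial>lebesgue_on D\<bar>"
proof -
  interpret L2: seminormed_fspace "Lp_space D 2" by (rule seminormed_Lp) simp
  obtain F0 where F0[measurable]: "F0 \<in> borel_measurable borel" and z0: "\<And>s. s \<notin> D \<Longrightarrow> F0 s = 0"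
    and FA: "AE s in lebesgue_on D. f s = F0 s"
    by (rule borel_representative[OF D_open L2_measurable[OF f(1)]]) blast
  note fi = L2_integrable(1)[OF f(1)]
  have f2: "f \<in> borel_measurable (lebesgue_on D)" "integrable (lebesgue_on D) (\<lambda>s. (f s)\<^sup>2)"
    using f(1) by (auto simp: carr_L2)
  have FA2: "AE s in lebesgue_on D. (f s)\<^sup>2 = (F0 s)\<^sup>2"
    using FA by eventually_elim simp
  have F0': "F0 \<in> borel_measurable (lebesgue_on D)"
    using F0 by (intro measurable_restrict_space1 measurable_completion) simp
  have F0i: "integrable lborel F0"
  proof -
    have "integrable (lebesgue_on D) F0"
      by (rule integrable_cong_AE_imp[OF fi F0' FA])
    then show ?thesis by (simp add: integral_lebesgue_on_vanishing(2)[OF D_lebesgue F0 z0])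
  qed
  define F where "F s = F0 s / M" for s
  have F[measurable]: "F \<in> borel_measurable borel" unfolding F_def by measurable
  have Fi: "integrable lborel F" unfolding F_def using F0i by simp
  have F2: "(\<integral>\<^sup>+s. ennreal ((F s)\<^sup>2) \<partial>lborel) \<le> 1"
  proof -
    have m: "(\<lambda>s. (F0 s)\<^sup>2) \<in> borel_measurable borel" by measurable
    have i: "integrable (lebesgue_on D) (\<lambda>s. (F0 s)\<^sup>2)"
      by (rule integrable_cong_AE_imp[OF f2(2) borel_measurable_power[OF F0'] FA2])
    have "(\<integral>s. (F0 s)\<^sup>2 \<partial>lborel) = (\<integral>s. (F0 s)\<^sup>2 \<partial>lebesgue_on D)"
      by (rule integral_lebesgue_on_vanishing(1)[symmetric, OF D_lebesgue m]) (simp add: z0)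
    also have "\<dots> = (\<integral>s. (f s)\<^sup>2 \<partial>lebesgue_on D)"
      by (rule integral_cong_AE[symmetric, OF borel_measurable_power[OF f2(1)] borel_measurable_power[OF F0'] FA2])
    also have "\<dots> = (nrm (Lp_space D 2) f)\<^sup>2" by (simp add: nrm_L2_sq)
    also have "\<dots> \<le> M\<^sup>2"
      using f(2) by (intro power_mono) (auto simp: nrm_Lp_nonneg)
    finally have "(\<integral>s. (F0 s)\<^sup>2 \<partial>lborel) / M\<^sup>2 \<le> 1" using M by simp
    moreover have "integrable lborel (\<lambda>s. (F0 s)\<^sup>2)"
      using i integral_lebesgue_on_vanishing(2)[OF D_lebesgue m] z0 by simp
    then have "integrable lborel (\<lambda>s. (F s)\<^sup>2)" "(\<integral>s. (F s)\<^sup>2 \<partial>lborel) = (\<integral>s. (F0 s)\<^sup>2 \<partial>lborel) / M\<^sup>2"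
      unfolding F_def power_divide by auto
    ultimately show ?thesis
      by (subst nn_integral_eq_integral) auto
  qed
  have \<phi>m: "\<phi> \<in> borel_measurable borel"
    using test_functions_continuous[OF \<phi>] by (rule borel_measurable_continuous_onI)
  obtain K where K: "K \<subseteq> D" "\<And>s. s \<notin> K \<Longrightarrow> \<phi> s = 0"
    by (rule test_functionsE[OF \<phi>]) blast
  have \<phi>m': "\<phi> \<in> borel_measurable (lebesgue_on D)"
    using \<phi>m by (intro measurable_restrict_space1 measurable_completion) simp
  have 1: "(\<integral>s. F s * \<phi> s \<partial>lborel) = (\<integral>s. f s * \<phi> s \<partial>lebesgue_on D) / M"
  proof -
    have m: "(\<lambda>s. F0 s * \<phi> s) \<in> borel_measurable borel" using \<phi>m by measurable
    have "(\<integral>s. f s * \<phi> s \<partial>lebesgue_on D) = (\<integral>s. F0 s * \<phi> s \<partial>lebesgue_on D)"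
    proof (rule integral_cong_AE[OF borel_measurable_times[OF f2(1) \<phi>m'] borel_measurable_times[OF F0' \<phi>m']])
      show "AE s in lebesgue_on D. f s * \<phi> s = F0 s * \<phi> s"
        using FA by eventually_elim simp
    qed
    also have "\<dots> = (\<integral>s. F0 s * \<phi> s \<partial>lborel)"
      by (rule integral_lebesgue_on_vanishing(1)[OF D_lebesgue m]) (simp add: z0)
    finally show ?thesis by (simp add: F_def)
  qed
  have 2: "(\<integral>s. F s * indicator (cball t r) s \<partial>lborel) / (pi * r\<^sup>2) = ball_average f r t / M" for t
  proof -
    have B: "(indicator (cball t r) :: real^2 \<Rightarrow> real) \<in> borel_measurable borel"
      by (intro borel_measurable_indicator) auto
    then have m: "(\<lambda>s. F0 s * indicator (cball t r) s) \<in> borel_measurable borel"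
      using F0 by (intro borel_measurable_times)
    have B': "(indicator (cball t r) :: real^2 \<Rightarrow> real) \<in> borel_measurable (lebesgue_on D)"
      using B by (intro measurable_restrict_space1 measurable_completion) simp
    have "(\<integral>s. f s * indicator (cball t r) s \<partial>lebesgue_on D) = (\<integral>s. F0 s * indicator (cball t r) s \<partial>lebesgue_on D)"
    proof (rule integral_cong_AE[OF borel_measurable_times[OF f2(1) B'] borel_measurable_times[OF F0' B']])
      show "AE s in lebesgue_on D. f s * indicator (cball t r) s = F0 s * indicator (cball t r) s"
        using FA by eventually_elim simp
    qed
    also have "\<dots> = (\<integral>s. F0 s * indicator (cball t r) s \<partial>lborel)"
      by (rule integral_lebesgue_on_vanishing(1)[OF D_lebesgue m]) (simp add: z0)
    finally show ?thesis by (simp add: F_def ball_average_def)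
  qed
  have 3: "(\<integral>t. \<phi> t * (ball_average f r t / M) \<partial>lborel) = (\<integral>t. \<phi> t * ball_average f r t \<partial>lebesgue_on D) / M"
  proof -
    have "(\<lambda>t. \<phi> t * ball_average f r t) \<in> borel_measurable borel"
      using \<phi>m ball_average_L2(1)[OF f(1) r] by measurable
    then have "(\<integral>t. \<phi> t * ball_average f r t \<partial>lebesgue_on D) = (\<integral>t. \<phi> t * ball_average f r t \<partial>lborel)"
      by (rule integral_lebesgue_on_vanishing(1)[OF D_lebesgue]) (use K in auto)
    then show ?thesis by simp
  qed
  have "\<bar>\<integral>s. f s * \<phi> s \<partial>lebesgue_on D\<bar> / M \<le> averaging_rate p r + \<bar>\<integral>t. \<phi> t * ball_average f r t \<partial>lebesgue_on D\<bar> / M"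
    using averaging_bound_borel[OF p_gt_2 q_eq \<phi> r F Fi F2 gradient_bound_nrm[OF \<phi> n]] M
    unfolding 1 2 3 by (simp add: abs_divide)
  also have "\<dots> = (averaging_rate p r * M + \<bar>\<integral>t. \<phi> t * ball_average f r t \<partial>lebesgue_on D\<bar>) / M"
    using M by (simp add: field_simps)
  finally show ?thesis
    using M by (simp add: divide_le_cancel)
qed

end

section \<open>The Sobolev embedding into L^2 and its compactness\<close>

context sobolev_embedding
begin

lemma L1_le_nrm_W01p:
  assumes "u \<in> carr (W01p D q)"
  shows "(\<integral>s. \<bar>u s\<bar> \<partial>lebesgue_on D) \<le> (1 + measure lebesgue D) * nrm (W01p D q) u"
proof -
  have "(\<integral>s. \<bar>u s\<bar> \<partial>lebesgue_on D) \<le> (1 + measure lebesgue D) * nrm (Lp_space D q) u"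
    using Lp_nrm_le[OF D_lmeasurable _ _ nrm_Lp_le_W01p(1)[OF assms], of 1] q_bounds by (simp add: nrm_Lp[of _ 1])
  also have "\<dots> \<le> (1 + measure lebesgue D) * nrm (W01p D q) u"
    using nrm_Lp_le_W01p(2)[OF assms] by (intro mult_left_mono) auto
  finally show ?thesis .
qed

text \<open>The averaging bound with f = \<phi> and radius 1 reads N^2 \<le> A N + c for the L^2
  norm \<open>N\<close>, because the means of \<phi> are bounded by its L^1 norm. Such an inequality
  forces N \<le> A + c + 1.\<close>

lemma Sobolev_test_function:
  obtains C where "C \<ge> 0" "\<And>\<phi>. \<phi> \<in> test_functions D \<Longrightarrow> nrm (Lp_space D 2) \<phi> \<le> C * nrm (W01p D q) \<phi>"
proof -
  interpret L2: seminormed_fspace "Lp_space D 2" by (rule seminormed_Lp) simp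
  define A where "A = averaging_rate p 1"
  \<comment> \<open>The pairing of \<phi> with its means is at most \<open>L * L / pi\<close>, where
    \<open>L\<close> is the L^1 norm and at most 1 + |D|.\<close>
  define c where "c = (1 + measure lebesgue D)\<^sup>2 / pi"
  have A: "A \<ge> 0" using averaging_rate_nonneg[of p 1] p_gt_2 by (simp add: A_def)
  have c: "c \<ge> 0" by (simp add: c_def)
  have unit: "nrm (Lp_space D 2) \<phi> \<le> A + c + 1"
    if \<phi>: "\<phi> \<in> test_functions D" and n: "nrm (W01p D q) \<phi> \<le> 1/2" for \<phi>
  proof (rule ccontr)
    define N where "N = nrm (Lp_space D 2) \<phi>"
    assume "\<not> nrm (Lp_space D 2) \<phi> \<le> A + c + 1"
    then have N: "N > A + c + 1" by (simp add: N_def)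
    note \<phi>2 = test_function_L2[OF \<phi>]
    define L where "L = (\<integral>s. \<bar>\<phi> s\<bar> \<partial>lebesgue_on D)"
    have "L \<le> (1 + measure lebesgue D) * nrm (W01p D q) \<phi>"
      unfolding L_def by (rule L1_le_nrm_W01p[OF test_function_W01p[OF \<phi>]])
    also have "\<dots> \<le> (1 + measure lebesgue D) * 1"
      using n by (intro mult_left_mono) auto
    finally have L: "0 \<le> L" "L \<le> 1 + measure lebesgue D" by (auto simp: L_def)
    have "\<bar>\<integral>t. \<phi> t * ball_average \<phi> 1 t \<partial>lebesgue_on D\<bar> \<le> (\<integral>t. \<bar>\<phi> t * ball_average \<phi> 1 t\<bar> \<partial>lebesgue_on D)"
      by (rule integral_abs_bound)
    also have "\<dots> \<le> (\<integral>t. \<bar>\<phi> t\<bar> * (L / pi) \<partial>lebesgue_on D)"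
    proof (rule integral_mono)
      show "integrable (lebesgue_on D) (\<lambda>t. \<bar>\<phi> t * ball_average \<phi> 1 t\<bar>)"
        using L2_mult_integrable[OF \<phi>2 ball_average_L2(3)[OF \<phi>2]] by simp
      show "integrable (lebesgue_on D) (\<lambda>t. \<bar>\<phi> t\<bar> * (L / pi))"
        using L2_integrable(1)[OF \<phi>2] by simp
      show "\<bar>\<phi> t * ball_average \<phi> 1 t\<bar> \<le> \<bar>\<phi> t\<bar> * (L / pi)" for t
        using ball_average_L2(2)[OF \<phi>2, of 1 t] unfolding abs_mult L_def by (intro mult_left_mono) auto
    qed
    also have "\<dots> = L\<^sup>2 / pi" by (simp add: L_def power2_eq_square)
    also have "\<dots> \<le> c"
      unfolding c_def using L by (intro divide_right_mono power_mono) auto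
    finally have "N\<^sup>2 \<le> A * N + c"
      using averaging_bound[OF \<phi> n, of 1 \<phi> N] \<phi>2 N A c nrm_L2_sq[of D \<phi>]
      by (simp add: N_def A_def power2_eq_square)
    moreover have "N * N > (A + c + 1) * N"
      using N A c by (intro mult_strict_right_mono) auto
    moreover have "c * N \<ge> c * 1" using N A c by (intro mult_left_mono) auto
    ultimately show False using N A c by (simp add: power2_eq_square distrib_right)
  qed
  show ?thesis
  proof (rule that[of "2 * (A + c + 1)"])
    show "0 \<le> 2 * (A + c + 1)" using A c by simp
    fix \<phi> assume \<phi>: "\<phi> \<in> test_functions D"
    show "nrm (Lp_space D 2) \<phi> \<le> 2 * (A + c + 1) * nrm (W01p D q) \<phi>"
    proof (rule le_mult_if_le_mult_add)
      fix e :: real assume e: "e > 0"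
      define k where "k = nrm (W01p D q) \<phi> + e"
      have k: "k > 0" using W01p.nrm_nonneg[OF test_function_W01p[OF \<phi>]] e by (simp add: k_def)
      have "nrm (Lp_space D 2) (\<lambda>s. inverse (2 * k) * \<phi> s) \<le> A + c + 1"
      proof (rule unit[OF test_functions_scale[OF \<phi>]])
        have "nrm (W01p D q) (\<lambda>s. inverse (2 * k) * \<phi> s) = inverse (2 * k) * nrm (W01p D q) \<phi>"
          using W01p.nrm_scale[OF test_function_W01p[OF \<phi>], of "inverse (2 * k)"] k by simp
        also have "\<dots> \<le> inverse (2 * k) * k"
          using k e by (intro mult_left_mono) (auto simp: k_def)
        also have "\<dots> = 1/2" using k by (simp add: field_simps)
        finally show "nrm (W01p D q) (\<lambda>s. inverse (2 * k) * \<phi> s) \<le> 1/2" .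
      qed
      moreover have "nrm (Lp_space D 2) (\<lambda>s. inverse (2 * k) * \<phi> s) = inverse (2 * k) * nrm (Lp_space D 2) \<phi>"
        using L2.nrm_scale[OF test_function_L2[OF \<phi>], of "inverse (2 * k)"] k by simp
      ultimately have "inverse (2 * k) * nrm (Lp_space D 2) \<phi> \<le> A + c + 1" by simp
      then show "nrm (Lp_space D 2) \<phi> \<le> 2 * (A + c + 1) * (nrm (W01p D q) \<phi> + e)"
        unfolding k_def[symmetric] using k by (simp add: field_simps)
    qed (use A c in simp)
  qed
qed

text \<open>Membership in L^2 is itself part of the claim, so a bound on a dense set is not yet
  enough: the approximating test functions converge in L^1, a subsequence converges almost
  everywhere, and Fatou's lemma carries their L^2 bounds to the limit.\<close>

lemma Sobolev_embedding:
  obtains C where "C \<ge> 0" "\<And>u. u \<in> carr (W01p D q) \<Longrightarrow> u \<in> carr (Lp_space D 2)"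
    "\<And>u. u \<in> carr (W01p D q) \<Longrightarrow> nrm (Lp_space D 2) u \<le> C * nrm (W01p D q) u"
proof -
  obtain C where C: "C \<ge> 0" "\<And>\<phi>. \<phi> \<in> test_functions D \<Longrightarrow> nrm (Lp_space D 2) \<phi> \<le> C * nrm (W01p D q) \<phi>"
    by (rule Sobolev_test_function) blast
  have main: "u \<in> carr (Lp_space D 2) \<and> nrm (Lp_space D 2) u \<le> C * nrm (W01p D q) u"
    if u: "u \<in> carr (W01p D q)" for u
  proof -
    have "\<exists>\<phi>\<in>test_functions D. nrm (W01p D q) (u - \<phi>) < 1 / real (Suc n)" for n
      using u unfolding carr_W01p nrm_W01p by simp
    then obtain \<phi> where \<phi>: "\<And>n. \<phi> n \<in> test_functions D" "\<And>n. nrm (W01p D q) (u - \<phi> n) < 1 / real (Suc n)"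
      by metis
    note \<phi>W = test_function_W01p[OF \<phi>(1)]
    note \<phi>2 = test_function_L2[OF \<phi>(1)]
    have d: "u - \<phi> n \<in> carr (W01p D q)" for n by (rule W01p.diff_mem[OF u \<phi>W])
    have um: "u \<in> borel_measurable (lebesgue_on D)"
      using nrm_Lp_le_W01p(1)[OF u] by (simp add: carr_Lp)
    have i: "integrable (lebesgue_on D) ((u - \<phi> n))" for n
    proof -
      have "u - \<phi> n \<in> carr (Lp_space D 1)"
        using Lp_subset[OF D_lmeasurable _ _ nrm_Lp_le_W01p(1)[OF d]] q_bounds by simp
      then have "u - \<phi> n \<in> borel_measurable (lebesgue_on D)" "integrable (lebesgue_on D) (\<lambda>s. \<bar>(u - \<phi> n) s\<bar>)"
        unfolding carr_Lp by auto
      then show ?thesis using integrable_abs_cancel by blast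
    qed
    have "(\<lambda>n. \<integral>s. norm ((u - \<phi> n) s) \<partial>lebesgue_on D) \<longlonglongrightarrow> 0"
    proof (rule tendsto_sandwich[OF _ _ tendsto_const])
      show "\<forall>\<^sub>F n in sequentially. (\<integral>s. norm ((u - \<phi> n) s) \<partial>lebesgue_on D)
          \<le> (1 + measure lebesgue D) * (1 / real (Suc n))"
      proof (rule always_eventually, rule allI)
        fix n
        have "(\<integral>s. norm ((u - \<phi> n) s) \<partial>lebesgue_on D) \<le> (1 + measure lebesgue D) * nrm (W01p D q) (u - \<phi> n)"
          using L1_le_nrm_W01p[OF d, of n] by simp
        also have "\<dots> \<le> (1 + measure lebesgue D) * (1 / real (Suc n))"
          using \<phi>(2)[of n] by (intro mult_left_mono) auto
        finally show "(\<integral>s. norm ((u - \<phi> n) s) \<partial>lebesgue_on D) \<le> (1 + measure lebesgue D) * (1 / real (Suc n))" .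
      qed
      have "(\<lambda>n. (1 + measure lebesgue D) * (1 / real (Suc n))) \<longlonglongrightarrow> (1 + measure lebesgue D) * 0"
        by (intro tendsto_mult_left LIMSEQ_Suc lim_inverse_n')
      then show "(\<lambda>n. (1 + measure lebesgue D) * (1 / real (Suc n))) \<longlonglongrightarrow> 0" by simp
    qed auto
    from tendsto_L1_AE_subseq[OF i this] obtain r :: "nat \<Rightarrow> nat" where r: "strict_mono r"
      "AE s in lebesgue_on D. (\<lambda>n. (u - \<phi> (r n)) s) \<longlonglongrightarrow> 0" by blast
    have lim: "AE s in lebesgue_on D. (\<lambda>n. ennreal ((\<phi> (r n) s)\<^sup>2)) \<longlonglongrightarrow> ennreal ((u s)\<^sup>2)"
      using r(2)
    proof eventually_elim
      case (elim s)
      have "(\<lambda>n. u s - (u - \<phi> (r n)) s) \<longlonglongrightarrow> u s - 0"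
        by (intro tendsto_diff tendsto_const elim)
      then have "(\<lambda>n. \<phi> (r n) s) \<longlonglongrightarrow> u s" by simp
      then show ?case by (intro tendsto_ennrealI tendsto_power)
    qed
    define b where "b n = C * (nrm (W01p D q) u + 1 / real (Suc (r n)))" for n
    have b: "(\<lambda>n. ennreal ((b n)\<^sup>2)) \<longlonglongrightarrow> ennreal ((C * nrm (W01p D q) u)\<^sup>2)"
    proof (intro tendsto_ennrealI tendsto_power)
      have "(\<lambda>n. 1 / real (Suc (r n))) \<longlonglongrightarrow> 0"
        using LIMSEQ_subseq_LIMSEQ[OF LIMSEQ_Suc[OF lim_inverse_n'] r(1)] by (simp add: o_def)
      then have "b \<longlonglongrightarrow> C * (nrm (W01p D q) u + 0)"
        unfolding b_def by (intro tendsto_intros)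
      then show "b \<longlonglongrightarrow> C * nrm (W01p D q) u" by simp
    qed
    have \<phi>b: "(\<integral>\<^sup>+s. ennreal ((\<phi> (r n) s)\<^sup>2) \<partial>lebesgue_on D) \<le> ennreal ((b n)\<^sup>2)" for n
    proof -
      have "nrm (W01p D q) (\<phi> (r n)) \<le> nrm (W01p D q) u + nrm (W01p D q) (\<phi> (r n) - u)"
        by (rule W01p.nrm_le_diff[OF \<phi>W u])
      also have "\<dots> \<le> nrm (W01p D q) u + 1 / real (Suc (r n))"
        using \<phi>(2)[of "r n"] W01p.nrm_diff_commute[OF u \<phi>W, of "r n"] by simp
      finally have "nrm (Lp_space D 2) (\<phi> (r n)) \<le> b n"
        unfolding b_def using C(1) by (intro order_trans[OF C(2)[OF \<phi>(1)]] mult_left_mono)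
      then have "(nrm (Lp_space D 2) (\<phi> (r n)))\<^sup>2 \<le> (b n)\<^sup>2"
        by (intro power_mono) (auto simp: nrm_Lp_nonneg)
      moreover have "(\<integral>\<^sup>+s. ennreal ((\<phi> (r n) s)\<^sup>2) \<partial>lebesgue_on D) = ennreal ((nrm (Lp_space D 2) (\<phi> (r n)))\<^sup>2)"
        unfolding nrm_L2_sq using \<phi>2[of "r n"] by (intro nn_integral_eq_integral) (auto simp: carr_L2)
      ultimately show ?thesis by (simp add: ennreal_leI)
    qed
    have "(\<integral>\<^sup>+s. ennreal ((u s)\<^sup>2) \<partial>lebesgue_on D) = (\<integral>\<^sup>+s. liminf (\<lambda>n. ennreal ((\<phi> (r n) s)\<^sup>2)) \<partial>lebesgue_on D)"
    proof (rule nn_integral_cong_AE)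
      show "AE s in lebesgue_on D. ennreal ((u s)\<^sup>2) = liminf (\<lambda>n. ennreal ((\<phi> (r n) s)\<^sup>2))"
        using lim by eventually_elim (rule lim_imp_Liminf[symmetric], simp)
    qed
    also have "\<dots> \<le> liminf (\<lambda>n. \<integral>\<^sup>+s. ennreal ((\<phi> (r n) s)\<^sup>2) \<partial>lebesgue_on D)"
      using L2_measurable[OF \<phi>2] by (intro nn_integral_liminf) auto
    also have "\<dots> \<le> liminf (\<lambda>n. ennreal ((b n)\<^sup>2))"
      by (intro Liminf_mono always_eventually allI \<phi>b)
    also have "\<dots> = ennreal ((C * nrm (W01p D q) u)\<^sup>2)"
      using b by (intro lim_imp_Liminf) auto
    finally have le: "(\<integral>\<^sup>+s. ennreal ((u s)\<^sup>2) \<partial>lebesgue_on D) \<le> ennreal ((C * nrm (W01p D q) u)\<^sup>2)" .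
    have "integrable (lebesgue_on D) (\<lambda>s. (u s)\<^sup>2)"
    proof (rule integrableI_bounded)
      show "(\<integral>\<^sup>+s. ennreal (norm ((u s)\<^sup>2)) \<partial>lebesgue_on D) < \<infinity>"
        using le_less_trans[OF le] by simp
    qed (use um in measurable)
    then have u2: "u \<in> carr (Lp_space D 2)" using um by (simp add: carr_L2)
    have "ennreal ((nrm (Lp_space D 2) u)\<^sup>2) \<le> ennreal ((C * nrm (W01p D q) u)\<^sup>2)"
      using le nn_integral_eq_integral[of "lebesgue_on D" "\<lambda>s. (u s)\<^sup>2"] u2 by (simp add: nrm_L2_sq carr_L2)
    then have "(nrm (Lp_space D 2) u)\<^sup>2 \<le> (C * nrm (W01p D q) u)\<^sup>2" by simp
    then have "nrm (Lp_space D 2) u \<le> C * nrm (W01p D q) u"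
      by (rule power2_le_imp_le) (use C(1) W01p.nrm_nonneg[OF u] in simp)
    with u2 show ?thesis by simp
  qed
  show ?thesis using that[OF C(1)] main by blast
qed

lemma W01p_subset_L2: "u \<in> carr (W01p D q) \<Longrightarrow> u \<in> carr (Lp_space D 2)"
  by (rule Sobolev_embedding) blast

text \<open>The indicator of each disc belongs to L^2, so the averages tend to zero at every point;
  they share a bound through the L^1 norms, and dominated convergence applies on the finite measure
  space.\<close>

lemma weak_null_ball_average:
  assumes f: "\<And>n. f n \<in> carr (Lp_space D 2)" "\<And>n. nrm (Lp_space D 2) (f n) \<le> M"
    and weak: "\<And>v. v \<in> carr (Lp_space D 2) \<Longrightarrow> (\<lambda>n. \<integral>s. f n s * v s \<partial>lebesgue_on D) \<longlonglongrightarrow> 0"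
    and r: "r > 0"
  shows "(\<lambda>n. nrm (Lp_space D 2) (ball_average (f n) r)) \<longlonglongrightarrow> 0"
proof -
  interpret finite_measure "lebesgue_on D" by (rule finite_measure_D)
  define b where "b = (1 + measure lebesgue D) * M / (pi * r\<^sup>2)"
  have bd: "\<bar>ball_average (f n) r t\<bar> \<le> b" for n t
  proof -
    have "(\<integral>s. \<bar>f n s\<bar> \<partial>lebesgue_on D) \<le> (1 + measure lebesgue D) * M"
      by (rule order_trans[OF L2_integrable(2)[OF f(1)]]) (intro mult_left_mono f(2), simp)
    then have "(\<integral>s. \<bar>f n s\<bar> \<partial>lebesgue_on D) / (pi * r\<^sup>2) \<le> b"
      unfolding b_def using r by (intro divide_right_mono) auto
    then show ?thesis using ball_average_L2(2)[OF f(1) r, of n t] by linarith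
  qed
  have pt: "(\<lambda>n. ball_average (f n) r t) \<longlonglongrightarrow> 0" for t
  proof -
    have "indicator (cball t r) \<in> carr (Lp_space D 2)"
    proof -
      have m: "(indicator (cball t r) :: real^2 \<Rightarrow> real) \<in> borel_measurable (lebesgue_on D)"
        by (intro measurable_restrict_space1 measurable_completion borel_measurable_indicator) auto
      have "integrable (lebesgue_on D) (\<lambda>s. (indicator (cball t r) s :: real)\<^sup>2)"
        by (rule integrable_const_bound[where B=1]) (use m in \<open>auto split: split_indicator\<close>)
      then show ?thesis using m by (simp add: carr_L2)
    qed
    from tendsto_divide[OF weak[OF this] tendsto_const, of "pi * r\<^sup>2"] show ?thesis
      using r by (simp add: ball_average_def)
  qed
  have "(\<lambda>n. \<integral>t. (ball_average (f n) r t)\<^sup>2 \<partial>lebesgue_on D) \<longlonglongrightarrow> (\<integral>t. 0 \<partial>lebesgue_on D)"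
  proof (rule integral_dominated_convergence[where w="\<lambda>_. b\<^sup>2"])
    show "AE t in lebesgue_on D. (\<lambda>n. (ball_average (f n) r t)\<^sup>2) \<longlonglongrightarrow> 0"
    proof (rule AE_I2)
      fix t
      show "(\<lambda>n. (ball_average (f n) r t)\<^sup>2) \<longlonglongrightarrow> 0"
        using tendsto_power[OF pt[of t], of 2] by simp
    qed
    show "AE t in lebesgue_on D. norm ((ball_average (f n) r t)\<^sup>2) \<le> b\<^sup>2" for n
      using power_mono[OF bd abs_ge_zero, of _ _ 2] by simp
    show "(\<lambda>t. (ball_average (f n) r t)\<^sup>2) \<in> borel_measurable (lebesgue_on D)" for n
      by (intro borel_measurable_power L2_measurable[OF ball_average_L2(3)[OF f(1) r]])
  qed auto
  then have "(\<lambda>n. (nrm (Lp_space D 2) (ball_average (f n) r))\<^sup>2) \<longlonglongrightarrow> 0"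
    by (simp add: nrm_L2_sq)
  from tendsto_real_sqrt[OF this] show ?thesis
    by (simp add: nrm_Lp_nonneg)
qed

text \<open>Rellich's theorem in dual form, that is, the compactness of the embedding of \<open>L\<^sup>2(D)\<close> into
  \<open>W\<^sup>-\<^sup>1\<^sup>,\<^sup>p(D)\<close>.\<close>

lemma weak_null_imp_uniformly_null:
  assumes f: "\<And>n. f n \<in> carr (Lp_space D 2)" "\<And>n. nrm (Lp_space D 2) (f n) \<le> M"
    and weak: "\<And>v. v \<in> carr (Lp_space D 2) \<Longrightarrow> (\<lambda>n. \<integral>s. f n s * v s \<partial>lebesgue_on D) \<longlonglongrightarrow> 0"
    and e: "e > 0"
  shows "\<forall>\<^sub>F n in sequentially. \<forall>u\<in>carr (W01p D q). nrm (W01p D q) u \<le> 1 \<longrightarrow> \<bar>\<integral>s. f n s * u s \<partial>lebesgue_on D\<bar> \<le> e"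
proof -
  interpret L2: seminormed_fspace "Lp_space D 2" by (rule seminormed_Lp) simp
  obtain C where C: "C \<ge> 0" "\<And>u. u \<in> carr (W01p D q) \<Longrightarrow> nrm (Lp_space D 2) u \<le> C * nrm (W01p D q) u"
    by (rule Sobolev_embedding) blast
  define M' where "M' = max M 1"
  have M': "M' > 0" "\<And>n. nrm (Lp_space D 2) (f n) \<le> M'"
    unfolding M'_def using f(2) by (auto intro: max.coboundedI1)
  \<comment> \<open>A test function of norm at most 1/2 costs e'. The approximant of
    \<open>u\<close> has norm at most 2 and hence costs 4 e', and the approximation error adds one
    more e'.\<close>
  define e' where "e' = e / 8"
  have e': "e' > 0" using e by (simp add: e'_def)
  \<comment> \<open>Chosen so that the bound p/2 r^{2/p} on the rate, times \<open>M'\<close>,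
    equals e'/2.\<close>
  define r where "r = (e' / (p * M')) powr (p / 2)"
  have r: "r > 0" using e' M' p_gt_2 by (simp add: r_def)
  have rate: "averaging_rate p r * M' \<le> e' / 2"
  proof -
    have "r powr (2 / p) = e' / (p * M')"
      using e' M' p_gt_2 by (simp add: r_def powr_powr)
    then have "averaging_rate p r \<le> p / 2 * (e' / (p * M'))"
      using averaging_rate_le[OF p_gt_2 r] by simp
    then have "averaging_rate p r * M' \<le> p / 2 * (e' / (p * M')) * M'"
      using M' by (intro mult_right_mono) auto
    also have "\<dots> = e' / 2" using M' p_gt_2 by (simp add: field_simps)
    finally show ?thesis .
  qed
  have "(\<lambda>n. C * nrm (Lp_space D 2) (ball_average (f n) r)) \<longlonglongrightarrow> C * 0"
    by (intro tendsto_mult_left weak_null_ball_average[OF f weak r])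
  then have "\<forall>\<^sub>F n in sequentially. C * nrm (Lp_space D 2) (ball_average (f n) r) < e' / 2"
    using e' by (intro order_tendstoD(2)[of _ "C * 0"]) auto
  then show ?thesis
  proof eventually_elim
    case (elim n)
    have test: "\<bar>\<integral>s. f n s * \<phi> s \<partial>lebesgue_on D\<bar> \<le> e'"
      if \<phi>: "\<phi> \<in> test_functions D" and n: "nrm (W01p D q) \<phi> \<le> 1/2" for \<phi>
    proof -
      have "\<bar>\<integral>t. \<phi> t * ball_average (f n) r t \<partial>lebesgue_on D\<bar>
          \<le> nrm (Lp_space D 2) \<phi> * nrm (Lp_space D 2) (ball_average (f n) r)"
        by (rule L2_Cauchy_Schwarz'[OF test_function_L2[OF \<phi>] ball_average_L2(3)[OF f(1) r]])
      also have "\<dots> \<le> C * nrm (Lp_space D 2) (ball_average (f n) r)"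
      proof (rule mult_right_mono)
        have "nrm (Lp_space D 2) \<phi> \<le> C * nrm (W01p D q) \<phi>"
          by (rule C(2)[OF test_function_W01p[OF \<phi>]])
        also have "\<dots> \<le> C * 1" using n C(1) by (intro mult_left_mono) auto
        finally show "nrm (Lp_space D 2) \<phi> \<le> C" by simp
      qed (simp add: nrm_Lp_nonneg)
      finally show ?thesis
        using averaging_bound[OF \<phi> n r f(1)[of n] M'(2)[of n] M'(1)] rate elim by linarith
    qed
    show ?case
    proof (intro ballI impI)
      fix u assume u: "u \<in> carr (W01p D q)" and nu: "nrm (W01p D q) u \<le> 1"
      \<comment> \<open>Exchanging \<open>u\<close> for a test function at distance \<delta> costs
        at most \<open>M' * (C + 1)\<close> times \<delta>; C + 1 is positive even if C = 0.\<close>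
      define \<delta> where "\<delta> = min 1 (e' / (M' * (C + 1)))"
      have \<delta>: "\<delta> > 0" "\<delta> \<le> 1" "\<delta> \<le> e' / (M' * (C + 1))" using e' M' C by (auto simp: \<delta>_def)
      obtain \<phi> where \<phi>: "\<phi> \<in> test_functions D" "nrm (W01p D q) (u - \<phi>) < \<delta>"
        using u \<delta>(1) unfolding carr_W01p nrm_W01p by blast
      note \<phi>W = test_function_W01p[OF \<phi>(1)]
      have n\<phi>: "nrm (W01p D q) \<phi> \<le> 2"
        using W01p.nrm_le_diff[OF \<phi>W u] W01p.nrm_diff_commute[OF u \<phi>W] \<phi>(2) \<delta> nu by linarith
      have "\<bar>\<integral>s. f n s * (1/4 * \<phi> s) \<partial>lebesgue_on D\<bar> \<le> e'"
      proof (rule test[OF test_functions_scale[OF \<phi>(1)]])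
        show "nrm (W01p D q) (\<lambda>s. 1/4 * \<phi> s) \<le> 1/2"
          using W01p.nrm_scale[OF \<phi>W, of "1/4"] n\<phi> by simp
      qed
      then have 1: "\<bar>\<integral>s. f n s * \<phi> s \<partial>lebesgue_on D\<bar> \<le> 4 * e'"
        by simp
      have d: "u - \<phi> \<in> carr (W01p D q)" by (rule W01p.diff_mem[OF u \<phi>W])
      have "\<bar>\<integral>s. f n s * (u - \<phi>) s \<partial>lebesgue_on D\<bar> \<le> nrm (Lp_space D 2) (f n) * nrm (Lp_space D 2) (u - \<phi>)"
        by (rule L2_Cauchy_Schwarz'[OF f(1) W01p_subset_L2[OF d]])
      also have "\<dots> \<le> M' * (C * nrm (W01p D q) (u - \<phi>))"
        using M' C(2)[OF d] by (intro mult_mono) (auto simp: nrm_Lp_nonneg)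
      also have "\<dots> \<le> M' * ((C + 1) * \<delta>)"
        using M' C \<phi>(2) W01p.nrm_nonneg[OF d] by (intro mult_left_mono mult_mono) auto
      also have "\<dots> \<le> e'"
      proof -
        have "M' * (C + 1) > 0" using M' C by simp
        then have "\<delta> * (M' * (C + 1)) \<le> e'" using \<delta>(3) by (simp only: pos_le_divide_eq)
        then show ?thesis by (simp only: mult_ac)
      qed
      finally have 2: "\<bar>\<integral>s. f n s * (u - \<phi>) s \<partial>lebesgue_on D\<bar> \<le> e'" .
      have "(\<integral>s. f n s * (u - \<phi>) s \<partial>lebesgue_on D) = (\<integral>s. f n s * u s \<partial>lebesgue_on D) - (\<integral>s. f n s * \<phi> s \<partial>lebesgue_on D)"
        using L2_mult_integrable[OF f(1) W01p_subset_L2[OF u]] L2_mult_integrable[OF f(1) test_function_L2[OF \<phi>(1)]]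
        by (simp add: right_diff_distrib)
      then show "\<bar>\<integral>s. f n s * u s \<partial>lebesgue_on D\<bar> \<le> e"
        using 1 2 e unfolding e'_def by linarith
    qed
  qed
qed

end

lemma L2_functional:
  assumes v: "v \<in> carr (Lp_space D 2)"
  shows "(\<lambda>u. \<integral>s. u s * v s \<partial>lebesgue_on D) \<in> carr (dual (Lp_space D 2))"
proof -
  interpret L2: seminormed_fspace "Lp_space D 2" by (rule seminormed_Lp) simp
  have "\<bar>\<integral>s. u s * v s \<partial>lebesgue_on D\<bar> \<le> nrm (Lp_space D 2) v * nrm (Lp_space D 2) u"
    if "u \<in> carr (Lp_space D 2)" for u
    using L2_Cauchy_Schwarz'[OF that v] by (simp add: mult.commute)
  then show ?thesis
    unfolding L2.carr_dual using L2_mult_integrable[OF _ v]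
    by (auto simp: distrib_right mult.assoc)
qed

context sobolev_embedding
begin

text \<open>The Sobolev embedding at exponent q is what makes an L^2 right-hand side an element of
  \<open>Wm1p D p\<close>.\<close>

lemma L2_functional_W01p:
  assumes f: "f \<in> carr (Lp_space D 2)"
  shows "(\<lambda>u. \<integral>s. f s * u s \<partial>lebesgue_on D) \<in> carr (dual (W01p D q))"
proof -
  obtain C where C: "C \<ge> 0" "\<And>u. u \<in> carr (W01p D q) \<Longrightarrow> nrm (Lp_space D 2) u \<le> C * nrm (W01p D q) u"
    by (rule Sobolev_embedding) blast
  have "\<bar>\<integral>s. f s * u s \<partial>lebesgue_on D\<bar> \<le> (nrm (Lp_space D 2) f * C) * nrm (W01p D q) u"
    if "u \<in> carr (W01p D q)" for u
  proof -
    have "\<bar>\<integral>s. f s * u s \<partial>lebesgue_on D\<bar> \<le> nrm (Lp_space D 2) f * nrm (Lp_space D 2) u"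
      by (rule L2_Cauchy_Schwarz'[OF f W01p_subset_L2[OF that]])
    also have "\<dots> \<le> nrm (Lp_space D 2) f * (C * nrm (W01p D q) u)"
      using C(2)[OF that] by (intro mult_left_mono) (auto simp: nrm_Lp_nonneg)
    finally show ?thesis by (simp add: mult.assoc)
  qed
  then show ?thesis
    unfolding W01p.carr_dual using L2_mult_integrable[OF f W01p_subset_L2]
    by (auto simp: distrib_left mult.left_commute)
qed

end

section \<open>Weak compactness in the space of square integrable functions\<close>

lemma convex_setD:
  "convex_set C \<Longrightarrow> u \<in> C \<Longrightarrow> v \<in> C \<Longrightarrow> 0 \<le> c \<Longrightarrow> c \<le> 1 \<Longrightarrow> (\<lambda>s. (1 - c) * u s + c * v s) \<in> C"
  by (auto simp: convex_set_def)

locale square_integrable =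
  fixes D :: "(real^2) set"
  assumes D_lm: "D \<in> lmeasurable"
begin

abbreviation V where "V \<equiv> Lp_space D 2"

definition ip :: "(real^2 \<Rightarrow> real) \<Rightarrow> (real^2 \<Rightarrow> real) \<Rightarrow> real" where
  "ip u v = (\<integral>s. u s * v s \<partial>lebesgue_on D)"

sublocale V: seminormed_fspace "Lp_space D 2"
  by (rule seminormed_Lp) simp

section \<open>Inner product identities\<close>

lemma ip_add: "u \<in> carr V \<Longrightarrow> v \<in> carr V \<Longrightarrow> w \<in> carr V \<Longrightarrow> ip (\<lambda>s. u s + v s) w = ip u w + ip v w"
  using L2_mult_integrable[of u D w] L2_mult_integrable[of v D w] by (simp add: ip_def distrib_right)

lemma ip_scale: "ip (\<lambda>s. c * u s) w = c * ip u w"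
  by (simp add: ip_def mult.assoc)

lemma ip_commute: "ip u v = ip v u"
  by (simp add: ip_def mult.commute)

lemma ip_diff: "u \<in> carr V \<Longrightarrow> v \<in> carr V \<Longrightarrow> w \<in> carr V \<Longrightarrow> ip (u - v) w = ip u w - ip v w"
  using L2_mult_integrable[of u D w] L2_mult_integrable[of v D w] by (simp add: ip_def left_diff_distrib)

lemma ip_diff_right: "u \<in> carr V \<Longrightarrow> v \<in> carr V \<Longrightarrow> w \<in> carr V \<Longrightarrow> ip w (u - v) = ip w u - ip w v"
  using ip_diff[of u v w] by (simp add: ip_commute)

lemma nrm_sq: "(nrm V u)\<^sup>2 = ip u u"
  unfolding nrm_L2_sq ip_def by (simp add: power2_eq_square)

lemma ip_le: "u \<in> carr V \<Longrightarrow> v \<in> carr V \<Longrightarrow> \<bar>ip u v\<bar> \<le> nrm V u * nrm V v"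
  unfolding ip_def by (rule L2_Cauchy_Schwarz')

lemma nrm_diff_sq:
  assumes "u \<in> carr V" "v \<in> carr V"
  shows "(nrm V (u - v))\<^sup>2 = (nrm V u)\<^sup>2 - 2 * ip u v + (nrm V v)\<^sup>2"
  using assms V.diff_mem[OF assms] by (simp add: nrm_sq ip_diff ip_diff_right ip_commute[of v u])

lemma nrm_add_sq:
  assumes "u \<in> carr V" "v \<in> carr V"
  shows "(nrm V (\<lambda>s. u s + v s))\<^sup>2 = (nrm V u)\<^sup>2 + 2 * ip u v + (nrm V v)\<^sup>2"
proof -
  have "ip u (\<lambda>s. -1 * v s) = -1 * ip u v"
    unfolding ip_commute[of u] by (rule ip_scale)
  then show ?thesis
    using nrm_diff_sq[OF assms(1) V.scale_mem[OF assms(2), of "-1"]] V.nrm_scale[OF assms(2), of "-1"]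
    by (simp add: fun_diff_def)
qed

text \<open>On a set of finite measure the L^1 norms of the increments are dominated by a geometric
  series, so the sum of their moduli is finite almost everywhere and the telescoping series
  converges.\<close>

lemma rapidly_Cauchy_AE_convergent:
  assumes c: "\<And>n. c n \<in> carr V" and le: "\<And>n. nrm V (c (Suc n) - c n) \<le> (1/2) ^ n"
  shows "AE s in lebesgue_on D. convergent (\<lambda>n. c n s)"
proof -
  define K where "K = 1 + measure lebesgue D"
  have K: "K \<ge> 0" by (simp add: K_def)
  have d: "c (Suc n) - c n \<in> carr V" for n by (rule V.diff_mem[OF c c])
  have d1: "c (Suc n) - c n \<in> carr (Lp_space D 1)" for n
    by (rule Lp_subset[OF D_lm _ _ d]) auto
  then have m: "(\<lambda>s. c (Suc n) s - c n s) \<in> borel_measurable (lebesgue_on D)"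
    and i: "integrable (lebesgue_on D) (\<lambda>s. \<bar>c (Suc n) s - c n s\<bar>)" for n
    by (auto simp: carr_Lp fun_diff_def)
  have b: "(\<integral>\<^sup>+s. ennreal \<bar>c (Suc n) s - c n s\<bar> \<partial>lebesgue_on D) \<le> ennreal (K * (1/2) ^ n)" for n
  proof -
    have "(\<integral>s. \<bar>c (Suc n) s - c n s\<bar> \<partial>lebesgue_on D) = nrm (Lp_space D 1) (c (Suc n) - c n)"
      by (simp add: nrm_Lp)
    also have "\<dots> \<le> K * nrm V (c (Suc n) - c n)"
      unfolding K_def by (rule Lp_nrm_le[OF D_lm _ _ d]) auto
    also have "\<dots> \<le> K * (1/2) ^ n"
      using K le by (intro mult_left_mono) auto
    finally show ?thesis
      by (subst nn_integral_eq_integral[OF i]) (auto intro: ennreal_leI)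
  qed
  have "(\<integral>\<^sup>+s. (\<Sum>n. ennreal \<bar>c (Suc n) s - c n s\<bar>) \<partial>lebesgue_on D) =
      (\<Sum>n. \<integral>\<^sup>+s. ennreal \<bar>c (Suc n) s - c n s\<bar> \<partial>lebesgue_on D)"
    using m by (intro nn_integral_suminf) auto
  also have "\<dots> \<le> (\<Sum>n. ennreal (K * (1/2) ^ n))"
    by (intro suminf_le b) auto
  also have "\<dots> = ennreal (\<Sum>n. K * (1/2) ^ n)"
    using K by (intro suminf_ennreal_eq) (auto intro!: summable_sums summable_mult summable_geometric)
  also have "\<dots> < \<infinity>" by simp
  finally have "(\<integral>\<^sup>+s. (\<Sum>n. ennreal \<bar>c (Suc n) s - c n s\<bar>) \<partial>lebesgue_on D) \<noteq> \<infinity>" by simp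
  then have "AE s in lebesgue_on D. (\<Sum>n. ennreal \<bar>c (Suc n) s - c n s\<bar>) \<noteq> \<infinity>"
    by (intro nn_integral_PInf_AE) (use m in auto)
  then show ?thesis
  proof eventually_elim
    case (elim s)
    then have "summable (\<lambda>n. \<bar>c (Suc n) s - c n s\<bar>)"
      by (intro summable_suminf_not_top) auto
    then have "summable (\<lambda>n. c (Suc n) s - c n s)"
      by (rule summable_rabs_cancel)
    then have "convergent (\<lambda>n. \<Sum>i<n. c (Suc i) s - c i s)"
      by (simp add: summable_iff_convergent)
    then have "convergent (\<lambda>n. c n s - c 0 s)"
      using sum_lessThan_telescope[of "\<lambda>n. c n s"] by simp
    from convergent_add[OF this convergent_const[of "c 0 s"]] show ?case by simp
  qed
qed

text \<open>The Riesz-Fischer argument: the almost everywhere limit of a rapidly Cauchy subsequence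
  is the candidate, and Fatou's lemma turns the Cauchy bounds into bounds on the distance to
  it.\<close>

lemma L2_complete:
  assumes c: "\<And>n. c n \<in> carr V"
    and Cauchy: "\<And>e. e > 0 \<Longrightarrow> \<exists>N. \<forall>m\<ge>N. \<forall>n\<ge>N. nrm V (c m - c n) \<le> e"
  obtains x where "x \<in> carr V" "(\<lambda>n. nrm V (c n - x)) \<longlonglongrightarrow> 0"
proof -
  have "\<exists>N. \<forall>m\<ge>N. \<forall>n\<ge>N. nrm V (c m - c n) \<le> (1/2) ^ k" for k :: nat
    by (rule Cauchy) simp
  then obtain N where N: "\<And>k m n. m \<ge> N k \<Longrightarrow> n \<ge> N k \<Longrightarrow> nrm V (c m - c n) \<le> (1/2) ^ k"
    by metis
  \<comment> \<open>Summing the thresholds puts both r k and r (k+1) at or above N k; the summand k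
    makes the indices unbounded.\<close>
  define r where "r k = k + (\<Sum>j\<le>k. N j)" for k
  have r: "N k \<le> r k" "k \<le> r k" "N k \<le> r (Suc k)" for k
  proof -
    have "N k \<le> (\<Sum>j\<le>k. N j)" by (rule member_le_sum) auto
    then show "N k \<le> r k" "k \<le> r k" "N k \<le> r (Suc k)" by (auto simp: r_def)
  qed
  have conv: "AE s in lebesgue_on D. convergent (\<lambda>k. c (r k) s)"
    using N r c by (intro rapidly_Cauchy_AE_convergent) auto
  define x where "x s = lim (\<lambda>k. c (r k) s)" for s
  have cm: "c n \<in> borel_measurable (lebesgue_on D)" for n
    using c[of n] by (simp add: carr_L2)
  have xm: "x \<in> borel_measurable (lebesgue_on D)"
    unfolding x_def using cm by measurable
  have lim: "AE s in lebesgue_on D. (\<lambda>k. c (r k) s) \<longlonglongrightarrow> x s"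
    using conv by eventually_elim (simp add: x_def convergent_LIMSEQ_iff)
  have le: "(\<integral>\<^sup>+s. ennreal ((c n s - x s)\<^sup>2) \<partial>lebesgue_on D) \<le> ennreal (e\<^sup>2)"
    if e: "e > 0" and N0: "\<And>m n. m \<ge> N0 \<Longrightarrow> n \<ge> N0 \<Longrightarrow> nrm V (c m - c n) \<le> e" and n: "n \<ge> N0" for e n N0
  proof -
    have "(\<integral>\<^sup>+s. ennreal ((c n s - x s)\<^sup>2) \<partial>lebesgue_on D) =
        (\<integral>\<^sup>+s. liminf (\<lambda>k. ennreal ((c n s - c (r k) s)\<^sup>2)) \<partial>lebesgue_on D)"
    proof (rule nn_integral_cong_AE)
      show "AE s in lebesgue_on D. ennreal ((c n s - x s)\<^sup>2) = liminf (\<lambda>k. ennreal ((c n s - c (r k) s)\<^sup>2))"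
        using lim
      proof eventually_elim
        case (elim s)
        have "(\<lambda>k. ennreal ((c n s - c (r k) s)\<^sup>2)) \<longlonglongrightarrow> ennreal ((c n s - x s)\<^sup>2)"
          by (intro tendsto_ennrealI tendsto_intros elim)
        then show ?case by (intro lim_imp_Liminf[symmetric]) auto
      qed
    qed
    also have "\<dots> \<le> liminf (\<lambda>k. \<integral>\<^sup>+s. ennreal ((c n s - c (r k) s)\<^sup>2) \<partial>lebesgue_on D)"
      using cm by (intro nn_integral_liminf) auto
    also have "\<dots> \<le> liminf (\<lambda>k. ennreal (e\<^sup>2))"
    proof (rule Liminf_mono)
      show "\<forall>\<^sub>F k in sequentially. (\<integral>\<^sup>+s. ennreal ((c n s - c (r k) s)\<^sup>2) \<partial>lebesgue_on D) \<le> ennreal (e\<^sup>2)"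
        using eventually_ge_at_top[of N0]
      proof eventually_elim
        case (elim k)
        have d: "c n - c (r k) \<in> carr V" by (rule V.diff_mem[OF c c])
        have "(\<integral>\<^sup>+s. ennreal ((c n s - c (r k) s)\<^sup>2) \<partial>lebesgue_on D) = ennreal ((nrm V (c n - c (r k)))\<^sup>2)"
          unfolding nrm_L2_sq using d by (subst nn_integral_eq_integral[symmetric]) (auto simp: carr_L2)
        also have "\<dots> \<le> ennreal (e\<^sup>2)"
          using N0[OF n, of "r k"] r(2)[of k] elim V.nrm_nonneg[OF d]
          by (intro ennreal_leI power_mono) auto
        finally show ?case .
      qed
    qed
    also have "\<dots> = ennreal (e\<^sup>2)" by (simp add: Liminf_const)
    finally show ?thesis .
  qed
  have d2: "c n - x \<in> carr V \<and> nrm V (c n - x) \<le> e"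
    if e: "e > 0" and N0: "\<And>m n. m \<ge> N0 \<Longrightarrow> n \<ge> N0 \<Longrightarrow> nrm V (c m - c n) \<le> e" and n: "n \<ge> N0" for e n N0
  proof
    have m: "(\<lambda>s. c n s - x s) \<in> borel_measurable (lebesgue_on D)" using cm xm by measurable
    have i: "integrable (lebesgue_on D) (\<lambda>s. (c n s - x s)\<^sup>2)"
    proof (rule integrableI_bounded)
      show "(\<integral>\<^sup>+s. ennreal (norm ((c n s - x s)\<^sup>2)) \<partial>lebesgue_on D) < \<infinity>"
        using le_less_trans[OF le[OF e N0 n]] by simp
    qed (use m in measurable)
    then show "c n - x \<in> carr V" using m by (simp add: carr_L2 fun_diff_def)
    have "ennreal ((nrm V (c n - x))\<^sup>2) \<le> ennreal (e\<^sup>2)"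
      using le[OF e N0 n] nn_integral_eq_integral[OF i] by (simp add: nrm_L2_sq)
    then show "nrm V (c n - x) \<le> e"
      using e by (simp add: nrm_Lp_nonneg power2_le_iff_abs_le)
  qed
  obtain N0 where "\<And>m n. m \<ge> N0 \<Longrightarrow> n \<ge> N0 \<Longrightarrow> nrm V (c m - c n) \<le> 1"
    using Cauchy[of 1] by auto
  from d2[OF zero_less_one this, of N0 N0] have "c N0 - x \<in> carr V" by blast
  moreover have "c N0 - (c N0 - x) = x" by (simp add: fun_eq_iff)
  ultimately have x: "x \<in> carr V" using V.diff_mem[OF c[of N0], of "c N0 - x"] by simp
  moreover have "(\<lambda>n. nrm V (c n - x)) \<longlonglongrightarrow> 0"
  proof (rule LIMSEQ_I)
    fix e :: real assume "e > 0"
    obtain N0 where N0: "\<And>m n. m \<ge> N0 \<Longrightarrow> n \<ge> N0 \<Longrightarrow> nrm V (c m - c n) \<le> e / 2"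
      using Cauchy[of "e/2"] \<open>e > 0\<close> by auto
    have "norm (nrm V (c n - x) - 0) < e" if "n \<ge> N0" for n
      using d2[OF _ N0 that] \<open>e > 0\<close> by (simp add: nrm_Lp_nonneg)
    then show "\<exists>N0. \<forall>n\<ge>N0. norm (nrm V (c n - x) - 0) < e" by blast
  qed
  ultimately show ?thesis by (rule that)
qed

text \<open>Mazur's theorem, tested only against differences with points of \<open>C\<close>: an approximate projection
  of \<open>y\<close> to \<open>C\<close> is compared with the points of \<open>C\<close> on the segment towards \<open>x n\<close>.\<close>

lemma Mazur_approx:
  assumes C: "convex_set C" "C \<subseteq> carr V" and x: "\<And>n. x n \<in> C" "\<And>n. nrm V (x n) \<le> M"
    and y: "y \<in> carr V" and weak: "\<And>c. c \<in> C \<Longrightarrow> (\<lambda>n. ip (x n - y) (y - c)) \<longlonglongrightarrow> 0"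
    and e: "e > 0"
  shows "\<exists>c\<in>C. nrm V (y - c) < e"
proof -
  define d where "d = (INF c\<in>C. (nrm V (y - c))\<^sup>2)"
  have bdd: "bdd_below ((\<lambda>c. (nrm V (y - c))\<^sup>2) ` C)"
    by (intro bdd_belowI[of _ 0]) auto
  have d_le: "d \<le> (nrm V (y - c))\<^sup>2" if "c \<in> C" for c
    unfolding d_def by (rule cINF_lower[OF bdd that])
  have d0: "d \<ge> 0" unfolding d_def using x(1) by (intro cINF_greatest) auto
  \<comment> \<open>Bounds the distance of every \<open>x n\<close> from an almost minimizer
    \<open>c\<close>; d + 1 appears because the error t^2 in the choice of \<open>c\<close> is at
    most 1.\<close>
  define L where "L = M + nrm V y + sqrt (d + 1)"
  have L: "L \<ge> 0"
    unfolding L_def using x(2)[of 0] d0 by (intro add_nonneg_nonneg) (auto simp: nrm_Lp_nonneg intro: order_trans[OF nrm_Lp_nonneg])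
  \<comment> \<open>The step length along the segment. For a minimizer up to the error t^2,
    comparison with the step bounds the first-order term by \<open>t * (1 + L\<^sup>2)\<close>,
    which this choice keeps below half of e^2.\<close>
  define t where "t = min 1 (e\<^sup>2 / (2 * (1 + L\<^sup>2)))"
  have pos: "1 + L\<^sup>2 > 0" by (simp add: add_pos_nonneg)
  have t: "0 < t" "t \<le> 1" "t * (1 + L\<^sup>2) \<le> e\<^sup>2 / 2"
  proof -
    show "0 < t" "t \<le> 1" using e pos by (auto simp: t_def)
    have "t * (1 + L\<^sup>2) \<le> (e\<^sup>2 / (2 * (1 + L\<^sup>2))) * (1 + L\<^sup>2)"
      using pos by (intro mult_right_mono) (auto simp: t_def)
    also have "\<dots> = e\<^sup>2 / 2" using pos by (simp add: field_simps)
    finally show "t * (1 + L\<^sup>2) \<le> e\<^sup>2 / 2" .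
  qed
  have "\<exists>c\<in>C. (nrm V (y - c))\<^sup>2 < d + t\<^sup>2"
    using cINF_less_iff[OF _ bdd, of "d + t\<^sup>2"] x(1) t unfolding d_def[symmetric] by auto
  then obtain c where c: "c \<in> C" "(nrm V (y - c))\<^sup>2 < d + t\<^sup>2" by blast
  have cV: "c \<in> carr V" and xV: "x n \<in> carr V" for n using C(2) c(1) x(1) by auto
  note yc = V.diff_mem[OF y cV]
  have nyc: "nrm V (y - c) \<le> sqrt (d + 1)"
  proof (rule real_le_rsqrt)
    have "t\<^sup>2 \<le> 1\<^sup>2" using t by (intro power_mono) auto
    then show "(nrm V (y - c))\<^sup>2 \<le> d + 1" using c(2) by simp
  qed
  have ip: "2 * ip (y - c) (x n - c) \<le> t * (1 + L\<^sup>2)" for n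
  proof -
    note xc = V.diff_mem[OF xV cV, of n]
    have nxc: "nrm V (x n - c) \<le> L"
    proof -
      have "nrm V (x n - c) \<le> nrm V (x n - y) + nrm V (y - c)"
        by (rule V.nrm_triangle_diff[OF xV y cV])
      moreover have "nrm V (x n - y) \<le> nrm V (x n) + nrm V y"
        using V.nrm_triangle[OF xV V.scale_mem[OF y, of "-1"], of n] V.nrm_scale[OF y, of "-1"]
        by (simp add: fun_diff_def)
      ultimately show ?thesis using x(2)[of n] nyc by (simp add: L_def)
    qed
    define w where "w = (\<lambda>s. (1 - t) * c s + t * x n s)"
    have w: "w \<in> C"
      using C(1) c(1) x(1) t unfolding convex_set_def w_def by auto
    have "y - w = (y - c) - (\<lambda>s. t * (x n - c) s)"
      by (auto simp: w_def fun_eq_iff algebra_simps)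
    then have "(nrm V (y - w))\<^sup>2 = (nrm V (y - c))\<^sup>2 - 2 * (t * ip (y - c) (x n - c)) + (t * nrm V (x n - c))\<^sup>2"
      using nrm_diff_sq[OF yc V.scale_mem[OF xc, of t]] V.nrm_scale[OF xc, of t] ip_scale[of t "x n - c" "y - c"] t
      by (simp add: ip_commute[of "y - c"])
    moreover have "(t * nrm V (x n - c))\<^sup>2 \<le> t\<^sup>2 * L\<^sup>2"
      unfolding power_mult_distrib using nxc by (intro mult_left_mono power_mono) (auto simp: nrm_Lp_nonneg)
    ultimately have "t * (2 * ip (y - c) (x n - c)) \<le> t * (t * (1 + L\<^sup>2))"
      using d_le[OF w] c(2) by (simp add: algebra_simps power2_eq_square)
    then show ?thesis using t by simp
  qed
  \<comment> \<open>The inner products of y - c with x n - c tend to the squared distance of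
    \<open>y\<close> from \<open>c\<close>, which inherits their bound.\<close>
  have "(\<lambda>n. 2 * (ip (x n - y) (y - c) + (nrm V (y - c))\<^sup>2)) \<longlonglongrightarrow> 2 * (0 + (nrm V (y - c))\<^sup>2)"
    by (intro tendsto_intros weak c(1))
  moreover have "2 * (ip (x n - y) (y - c) + (nrm V (y - c))\<^sup>2) \<le> t * (1 + L\<^sup>2)" for n
  proof -
    have "ip (x n - y) (y - c) + (nrm V (y - c))\<^sup>2 = ip (y - c) (x n - c)"
      using ip_diff[OF xV y yc, of n] ip_diff[OF y cV yc] ip_diff[OF xV cV yc, of n] ip_commute
      by (simp add: nrm_sq)
    then show ?thesis using ip[of n] by simp
  qed
  ultimately have "2 * (0 + (nrm V (y - c))\<^sup>2) \<le> t * (1 + L\<^sup>2)"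
    by (intro LIMSEQ_le_const2) auto
  also have "\<dots> \<le> e\<^sup>2 / 2" by (rule t(3))
  also have "\<dots> < 2 * e\<^sup>2" using e by simp
  finally have "(nrm V (y - c))\<^sup>2 < e\<^sup>2" by simp
  then have "nrm V (y - c) < e"
    using e by (simp add: power2_less_imp_less)
  then show ?thesis using c(1) by blast
qed

text \<open>Mazur's theorem makes \<open>y\<close> a norm limit of points of \<open>C\<close>, so
  closedness in norm decides. This keeps the limit control in \<open>C1\<close>.\<close>

lemma weakly_closed:
  assumes C: "convex_set C" "closed_in V C" and x: "\<And>n. x n \<in> C" "\<And>n. nrm V (x n) \<le> M"
    and y: "y \<in> carr V" and weak: "\<And>v. v \<in> carr V \<Longrightarrow> (\<lambda>n. ip (x n - y) v) \<longlonglongrightarrow> 0"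
  shows "y \<in> C"
proof -
  have sub: "C \<subseteq> carr V" using C(2) by (simp add: closed_in_def)
  have "\<forall>e>0. \<exists>c\<in>C. nrm V (y - c) < e"
  proof (intro allI impI)
    fix e :: real assume "e > 0"
    show "\<exists>c\<in>C. nrm V (y - c) < e"
    proof (rule Mazur_approx[OF C(1) sub x y _ \<open>e > 0\<close>])
      show "(\<lambda>n. ip (x n - y) (y - c)) \<longlonglongrightarrow> 0" if "c \<in> C" for c
        using that sub by (intro weak V.diff_mem y) auto
    qed
  qed
  then show ?thesis using C(2) y by (simp add: closed_in_def)
qed

text \<open>The weak limit is the limit of elements of almost minimal norm in the convex hulls of the
  tails; no representation of the dual space is needed.\<close>

lemma bounded_imp_weak_limit_on_sequence:
  assumes x: "\<And>n. x n \<in> carr V" "\<And>n. nrm V (x n) \<le> M" and L: "\<And>k. (\<lambda>n. ip (x n) (x k)) \<longlonglongrightarrow> L k"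
  obtains y c where "y \<in> carr V" "\<And>k. ip y (x k) = L k"
    "(\<lambda>n. nrm V (c n - y)) \<longlonglongrightarrow> 0" "\<And>S n. convex_set S \<Longrightarrow> range x \<subseteq> S \<Longrightarrow> c n \<in> S"
proof -
  \<comment> \<open>The convex hull of the tail from \<open>N\<close>, as the intersection of all
    convex sets containing it; properties of its elements are then proved by exhibiting a convex
    set.\<close>
  define H where "H N = \<Inter>{S. convex_set S \<and> (\<forall>n\<ge>N. x n \<in> S)}" for N
  have H_sub: "u \<in> S" if "u \<in> H N" "convex_set S" "\<And>n. n \<ge> N \<Longrightarrow> x n \<in> S" for u S N
    using that by (auto simp: H_def)
  have H_x: "x n \<in> H N" if "n \<ge> N" for n N using that by (auto simp: H_def)
  have H_convex: "convex_set (H N)" for N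
    unfolding H_def convex_set_def by blast
  have H_anti: "u \<in> H N" if "u \<in> H N'" "N \<le> N'" for u N N'
    using that(1) by (rule H_sub[OF _ H_convex]) (use that(2) in \<open>auto intro: H_x\<close>)
  have V_convex: "convex_set (carr V)"
    unfolding convex_set_def by (auto intro: V.add_mem V.scale_mem)
  have H_V: "u \<in> carr V" if "u \<in> H N" for u N
    by (rule H_sub[OF that V_convex]) (rule x(1))
  \<comment> \<open>The squared distance of the origin from the hull. It increases as the tails
    shrink and stays below the squared bound on the norms, hence converges.\<close>
  define d where "d N = (INF u\<in>H N. (nrm V u)\<^sup>2)" for N
  have bdd: "bdd_below ((\<lambda>u. (nrm V u)\<^sup>2) ` H N)" for N
    by (intro bdd_belowI[of _ 0]) auto
  have d_le: "d N \<le> (nrm V u)\<^sup>2" if "u \<in> H N" for u N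
    unfolding d_def by (rule cINF_lower[OF bdd that])
  have d_mono: "d N \<le> d N'" if "N \<le> N'" for N N'
    unfolding d_def using H_x[of N' N'] H_anti[OF _ that] by (intro cINF_superset_mono bdd) auto
  have d_bound: "d N \<le> M\<^sup>2" for N
    using d_le[OF H_x[of N N]] power_mono[OF x(2)[of N], of 2] by (simp add: nrm_Lp_nonneg)
  obtain l where "d \<longlonglongrightarrow> l"
    by (rule incseq_convergent[of d "M\<^sup>2"]) (use d_bound d_mono in \<open>auto simp: incseq_def\<close>)
  then have "convergent d" by (rule convergentI)
  then have dC: "Cauchy d" by (rule convergent_Cauchy)
  have "\<exists>u\<in>H N. (nrm V u)\<^sup>2 < d N + 1 / real (Suc N)" for N
    using cINF_less_iff[OF _ bdd, of N "d N + 1 / real (Suc N)"] H_x[of N N] unfolding d_def[symmetric] by auto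
  then obtain c where c: "\<And>N. c N \<in> H N" "\<And>N. (nrm V (c N))\<^sup>2 < d N + 1 / real (Suc N)"
    by metis
  note cV = H_V[OF c(1)]
  \<comment> \<open>Parallelogram law: the midpoint of \<open>c m\<close> and \<open>c n\<close>
    lies in the hull of the tail from \<open>m\<close>, so its squared norm is at least
    \<open>d m\<close>.\<close>
  have par: "(nrm V (c m - c n))\<^sup>2 \<le> 2 * (d n - d m) + 4 / real (Suc m)" if "m \<le> n" for m n
  proof -
    have "(\<lambda>s. (1 - 1/2) * c m s + 1/2 * c n s) \<in> H m"
      by (rule convex_setD[OF H_convex c(1) H_anti[OF c(1) that]]) auto
    from d_le[OF this] have "d m \<le> (nrm V (\<lambda>s. 1/2 * (c m s + c n s)))\<^sup>2"
      by (simp add: distrib_left)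
    also have "\<dots> = (nrm V (\<lambda>s. c m s + c n s))\<^sup>2 / 4"
      unfolding V.nrm_scale[OF V.add_mem[OF cV cV], of "1/2" m n] by (simp add: power_mult_distrib power_divide)
    finally have "4 * d m \<le> (nrm V (\<lambda>s. c m s + c n s))\<^sup>2" by simp
    then have "(nrm V (c m - c n))\<^sup>2 \<le> 2 * (nrm V (c m))\<^sup>2 + 2 * (nrm V (c n))\<^sup>2 - 4 * d m"
      using nrm_diff_sq[OF cV cV, of m n] nrm_add_sq[OF cV cV, of m n] by linarith
    also have "\<dots> \<le> 2 * (d m + 1 / real (Suc m)) + 2 * (d n + 1 / real (Suc n)) - 4 * d m"
      by (intro diff_right_mono add_mono mult_left_mono less_imp_le[OF c(2)]) auto
    also have "\<dots> \<le> 2 * (d n - d m) + 4 / real (Suc m)"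
      using that frac_le[of 1 1 "real (Suc m)" "real (Suc n)"] by simp
    finally show ?thesis .
  qed
  have Cauchy: "\<exists>N. \<forall>m\<ge>N. \<forall>n\<ge>N. nrm V (c m - c n) \<le> e" if e: "e > 0" for e
  proof -
    obtain N1 where N1: "\<And>m n. m \<ge> N1 \<Longrightarrow> n \<ge> N1 \<Longrightarrow> norm (d m - d n) < e\<^sup>2 / 4"
      using CauchyD[OF dC, of "e\<^sup>2 / 4"] e by auto
    obtain N2 where N2: "8 / e\<^sup>2 < real N2" using reals_Archimedean2 by blast
    have le: "nrm V (c m - c n) \<le> e" if "m \<ge> max N1 N2" "m \<le> n" for m n
    proof -
      have "8 / e\<^sup>2 < real (Suc m)" using N2 that by simp
      then have "4 / real (Suc m) < e\<^sup>2 / 2" using e by (simp add: field_simps)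
      moreover have "d n - d m < e\<^sup>2 / 4"
      proof -
        have "norm (d n - d m) < e\<^sup>2 / 4" using that by (intro N1) auto
        then show ?thesis using abs_ge_self[of "d n - d m"] unfolding real_norm_def by linarith
      qed
      ultimately have "2 * (d n - d m) + 4 / real (Suc m) \<le> 2 * (e\<^sup>2 / 4) + e\<^sup>2 / 2"
        by (intro add_mono mult_left_mono less_imp_le) auto
      then have "(nrm V (c m - c n))\<^sup>2 \<le> e\<^sup>2" using order_trans[OF par[OF that(2)]] by simp
      then show ?thesis by (rule power2_le_imp_le) (use e in simp)
    qed
    have "nrm V (c m - c n) \<le> e" if "m \<ge> max N1 N2" "n \<ge> max N1 N2" for m n
      using le[of m n] le[of n m] that V.nrm_diff_commute[OF cV cV, of m n] by linarith
    then show ?thesis by blast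
  qed
  obtain y where y: "y \<in> carr V" "(\<lambda>n. nrm V (c n - y)) \<longlonglongrightarrow> 0"
    by (rule L2_complete[OF cV Cauchy]) blast
  have "ip y (x k) = L k" for k
  proof (rule LIMSEQ_unique)
    show "(\<lambda>n. ip (c n) (x k)) \<longlonglongrightarrow> L k"
    proof (rule LIMSEQ_I)
      fix e :: real assume e: "e > 0"
      obtain N where N: "\<And>n. n \<ge> N \<Longrightarrow> norm (ip (x n) (x k) - L k) < e"
        using LIMSEQ_D[OF L e] by blast
      \<comment> \<open>A convex slab that contains a tail, hence the hull of that tail and the
        points \<open>c n\<close> from there on.\<close>
      define S where "S = {u \<in> carr V. \<bar>ip u (x k) - L k\<bar> < e}"
      have "convex_set S"
        unfolding convex_set_def
      proof (intro ballI)
        fix u v c assume uv: "u \<in> S" "v \<in> S" "c \<in> {0..1::real}"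
        have "ip (\<lambda>s. (1 - c) * u s + c * v s) (x k) - L k = (1 - c) * (ip u (x k) - L k) + c * (ip v (x k) - L k)"
        proof -
          have uvV: "u \<in> carr V" "v \<in> carr V" using uv by (auto simp: S_def)
          have "ip (\<lambda>s. (1 - c) * u s + c * v s) (x k) = (1 - c) * ip u (x k) + c * ip v (x k)"
            using ip_add[OF V.scale_mem[OF uvV(1)] V.scale_mem[OF uvV(2)] x(1), of "1 - c" c k]
            unfolding ip_scale .
          then show ?thesis by (simp add: algebra_simps)
        qed
        moreover have "\<bar>(1 - c) * (ip u (x k) - L k) + c * (ip v (x k) - L k)\<bar> < e"
          using convex_bound_lt[of "\<bar>ip u (x k) - L k\<bar>" e "\<bar>ip v (x k) - L k\<bar>" "1 - c" c] uv
            abs_triangle_ineq[of "(1 - c) * (ip u (x k) - L k)" "c * (ip v (x k) - L k)"]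
          by (auto simp: S_def abs_mult)
        ultimately show "(\<lambda>s. (1 - c) * u s + c * v s) \<in> S"
          using uv by (auto simp: S_def intro!: V.add_mem V.scale_mem)
      qed
      then have "c n \<in> S" if "n \<ge> N" for n
        using H_sub[OF c(1)[of n], of S] N x(1) that by (auto simp: S_def)
      then show "\<exists>N. \<forall>n\<ge>N. norm (ip (c n) (x k) - L k) < e"
        by (auto simp: S_def)
    qed
    have "(\<lambda>n. ip (c n - y) (x k)) \<longlonglongrightarrow> 0"
    proof (rule Lim_null_comparison)
      show "\<forall>\<^sub>F n in sequentially. norm (ip (c n - y) (x k)) \<le> nrm V (c n - y) * nrm V (x k)"
        using ip_le[OF V.diff_mem[OF cV y(1)] x(1)] by simp
      show "(\<lambda>n. nrm V (c n - y) * nrm V (x k)) \<longlonglongrightarrow> 0"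
        using tendsto_mult_right[OF y(2)] by simp
    qed
    then show "(\<lambda>n. ip (c n) (x k)) \<longlonglongrightarrow> ip y (x k)"
      using ip_diff[OF cV y(1) x(1)] by (simp add: LIM_zero_iff)
  qed
  moreover have "c n \<in> S" if "convex_set S" "range x \<subseteq> S" for S n
    by (rule H_sub[OF c(1) that(1)]) (use that(2) in auto)
  ultimately show ?thesis using that[of y c] y by blast
qed

text \<open>A general functional \<open>l\<close> is treated by Mazur's theorem instead of a
  representing vector: if \<open>l\<close> reached l(y) + e along a subsequence, the convex set of
  such points would come arbitrarily close to \<open>y\<close>, against the continuity of
  \<open>l\<close>.\<close>

lemma weak_sequential_compactness:
  assumes x: "\<And>n. x n \<in> carr V" "\<And>n. nrm V (x n) \<le> M"
  obtains r y where "strict_mono (r :: nat \<Rightarrow> nat)" "y \<in> carr V" "weakly_converges V (\<lambda>n. x (r n)) y"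
proof -
  have M: "M \<ge> 0" using x(2)[of 0] nrm_Lp_nonneg[of D 2 "x 0"] by linarith
  have b: "norm (ip (x n) (x k)) \<le> M\<^sup>2" for n k
    using ip_le[OF x(1) x(1), of n k] mult_mono[OF x(2)[of n] x(2)[of k] M nrm_Lp_nonneg]
    by (simp add: power2_eq_square)
  \<comment> \<open>A diagonal argument: along one subsequence the inner products with all members
    of the sequence converge.\<close>
  obtain r where r: "strict_mono (r :: nat \<Rightarrow> nat)" "\<And>k. \<exists>l. (\<lambda>n. ip (x (r n)) (x k)) \<longlonglongrightarrow> l"
    by (rule function_convergent_subsequence[where f="\<lambda>n k. ip (x n) (x k)" and S=UNIV and M="M\<^sup>2"])
      (use b in auto)
  define z where "z n = x (r n)" for n
  have z: "\<And>n. z n \<in> carr V" "\<And>n. nrm V (z n) \<le> M" using x by (auto simp: z_def)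
  have "\<exists>l. (\<lambda>n. ip (z n) (z k)) \<longlonglongrightarrow> l" for k using r(2)[of "r k"] by (simp add: z_def)
  then obtain L where L: "\<And>k. (\<lambda>n. ip (z n) (z k)) \<longlonglongrightarrow> L k" by metis
  obtain y c where y: "y \<in> carr V" "\<And>k. ip y (z k) = L k"
    and c: "(\<lambda>n. nrm V (c n - y)) \<longlonglongrightarrow> 0" "\<And>S n. convex_set S \<Longrightarrow> range z \<subseteq> S \<Longrightarrow> c n \<in> S"
    by (rule bounded_imp_weak_limit_on_sequence[OF z L]) blast
  \<comment> \<open>The vectors against which z n - y tends to zero. They form a convex set
    containing every \<open>z k\<close>, hence every \<open>c k\<close>, and boundedness of the
    sequence lets the limit \<open>y\<close> of the \<open>c k\<close> in as well.\<close>
  define S where "S = {u \<in> carr V. (\<lambda>n. ip (z n - y) u) \<longlonglongrightarrow> 0}"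
  have zS: "z k \<in> S" for k
    using L[of k] z y ip_diff[OF z(1) y(1) z(1)] by (simp add: S_def LIM_zero_iff)
  have S_convex: "convex_set S"
    unfolding convex_set_def
  proof (intro ballI)
    fix u v t assume uv: "u \<in> S" "v \<in> S" "t \<in> {0..1::real}"
    have "(\<lambda>n. (1 - t) * ip (z n - y) u + t * ip (z n - y) v) \<longlonglongrightarrow> (1 - t) * 0 + t * 0"
      using uv by (intro tendsto_intros) (auto simp: S_def)
    moreover have "ip (z n - y) (\<lambda>s. (1 - t) * u s + t * v s) = (1 - t) * ip (z n - y) u + t * ip (z n - y) v" for n
      using uv V.diff_mem[OF z(1) y(1), of n] ip_add[OF V.scale_mem V.scale_mem, of u v "z n - y" "1 - t" t]
      by (simp add: ip_commute[of "z n - y"] ip_scale S_def)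
    ultimately show "(\<lambda>s. (1 - t) * u s + t * v s) \<in> S"
      using uv by (auto simp: S_def intro!: V.add_mem V.scale_mem)
  qed
  have cS: "c n \<in> S" for n by (rule c(2)[OF S_convex]) (use zS in auto)
  then have cV: "c n \<in> carr V" for n by (simp add: S_def)
  have yS: "y \<in> S"
    unfolding S_def
  proof (intro CollectI conjI y(1) LIMSEQ_I)
    fix e :: real assume e: "e > 0"
    define B where "B = M + nrm V y + 1"
    have B: "B > 0" using M by (simp add: B_def nrm_Lp_nonneg add_nonneg_pos)
    have zy: "nrm V (z n - y) \<le> B" for n
      using V.nrm_triangle[OF z(1) V.scale_mem[OF y(1), of "-1"], of n] V.nrm_scale[OF y(1), of "-1"] z(2)[of n]
      by (simp add: fun_diff_def B_def)
    obtain k where k: "nrm V (c k - y) < e / (2 * B)"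
      using LIMSEQ_D[OF c(1), of "e / (2 * B)"] e B by (auto simp: nrm_Lp_nonneg)
    obtain N where N: "\<And>n. n \<ge> N \<Longrightarrow> \<bar>ip (z n - y) (c k)\<bar> < e / 2"
      using LIMSEQ_D[of "\<lambda>n. ip (z n - y) (c k)" 0 "e / 2"] cS[of k] e by (auto simp: S_def)
    have "norm (ip (z n - y) y - 0) < e" if "n \<ge> N" for n
    proof -
      have "\<bar>ip (z n - y) (c k - y)\<bar> \<le> nrm V (z n - y) * nrm V (c k - y)"
        by (intro ip_le V.diff_mem z y(1) cV)
      also have "\<dots> \<le> B * nrm V (c k - y)"
        by (intro mult_right_mono zy nrm_Lp_nonneg)
      also have "\<dots> \<le> B * (e / (2 * B))" using k B by (intro mult_left_mono) auto
      also have "\<dots> = e / 2" using B by simp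
      finally have "\<bar>ip (z n - y) (c k - y)\<bar> \<le> e / 2" .
      moreover have "ip (z n - y) (c k - y) = ip (z n - y) (c k) - ip (z n - y) y"
        by (intro ip_diff_right V.diff_mem z y(1) cV)
      ultimately show ?thesis
        using N[OF that] unfolding real_norm_def diff_0_right by linarith
    qed
    then show "\<exists>N. \<forall>n\<ge>N. norm (ip (z n - y) y - 0) < e" by blast
  qed
  \<comment> \<open>A one-sided estimate for every functional; the other side is the same estimate
    for its negative.\<close>
  have half: "\<forall>\<^sub>F n in sequentially. l (z n) < l y + e"
    if l: "l \<in> carr (dual V)" and e: "e > 0" for l e
  proof (rule ccontr)
    assume "\<not> ?thesis"
    then have "\<exists>\<^sub>F n in sequentially. \<not> l (z n) < l y + e" by (simp add: not_eventually)
    then have "infinite {n. l y + e \<le> l (z n)}"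
      by (simp add: cofinite_eq_sequentially[symmetric] frequently_cofinite not_less)
    from infinite_enumerate[OF this] obtain k :: "nat \<Rightarrow> nat"
      where k: "strict_mono k" "\<And>n. l y + e \<le> l (z (k n))" by auto
    \<comment> \<open>The points of \<open>S\<close> at which \<open>l\<close> is too large.
      Differences of \<open>y\<close> with them can be tested, because \<open>y\<close> also belongs
      to \<open>S\<close>.\<close>
    define E where "E = {u \<in> S. l y + e \<le> l u}"
    have lin: "l (\<lambda>s. (1 - t) * u s + t * v s) = (1 - t) * l u + t * l v" if "u \<in> carr V" "v \<in> carr V" for u v t
      using l that V.scale_mem by (simp add: dual_def)
    have E_convex: "convex_set E"
      unfolding convex_set_def
    proof (intro ballI)
      fix u v t assume uv: "u \<in> E" "v \<in> E" "t \<in> {0..1::real}"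
      then have "(\<lambda>s. (1 - t) * u s + t * v s) \<in> S"
        using S_convex unfolding convex_set_def E_def by blast
      moreover have "(1 - t) * (l y + e) + t * (l y + e) \<le> (1 - t) * l u + t * l v"
        using uv by (intro add_mono mult_left_mono) (auto simp: E_def)
      ultimately show "(\<lambda>s. (1 - t) * u s + t * v s) \<in> E"
        using uv lin[of u v t] by (simp add: E_def S_def algebra_simps)
    qed
    have "\<exists>B. \<forall>u\<in>carr V. \<bar>l u\<bar> \<le> B * nrm V u"
      using l by (simp add: dual_def)
    then obtain B where B: "\<And>u. u \<in> carr V \<Longrightarrow> \<bar>l u\<bar> \<le> B * nrm V u" by blast
    have "\<exists>c\<in>E. nrm V (y - c) < e / (\<bar>B\<bar> + 1)"
    proof (rule Mazur_approx[where x="\<lambda>n. z (k n)" and M=M])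
      show "(\<lambda>n. ip (z (k n) - y) (y - c)) \<longlonglongrightarrow> 0" if "c \<in> E" for c
      proof -
        have cS': "c \<in> S" using that by (simp add: E_def)
        have "(\<lambda>n. ip (z n - y) y - ip (z n - y) c) \<longlonglongrightarrow> 0 - 0"
          using yS cS' by (intro tendsto_diff) (auto simp: S_def)
        then have "(\<lambda>n. ip (z n - y) (y - c)) \<longlonglongrightarrow> 0"
          using cS' by (simp add: ip_diff_right V.diff_mem z y(1) S_def)
        from LIMSEQ_subseq_LIMSEQ[OF this k(1)] show ?thesis by (simp add: o_def)
      qed
    qed (use E_convex zS k(2) z(2) y(1) e in \<open>auto simp: E_def S_def add_pos_nonneg\<close>)
    then obtain c where c: "c \<in> E" "nrm V (y - c) < e / (\<bar>B\<bar> + 1)" by blast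
    have cV': "c \<in> carr V" using c(1) by (simp add: E_def S_def)
    have "l c - l y = l (c - y)"
      by (rule V.dual_diff[OF l cV' y(1), symmetric])
    also have "\<dots> \<le> \<bar>B\<bar> * nrm V (c - y)"
      using B[OF V.diff_mem[OF cV' y(1)]] mult_right_mono[OF abs_ge_self[of B] nrm_Lp_nonneg[of D 2 "c - y"]] by linarith
    also have "\<dots> \<le> \<bar>B\<bar> * (e / (\<bar>B\<bar> + 1))"
      using c(2) V.nrm_diff_commute[OF y(1) cV'] by (intro mult_left_mono) auto
    also have "\<dots> < e" using e by (simp add: field_simps)
    finally show False using c(1) by (simp add: E_def)
  qed
  have "weakly_converges V z y"
    unfolding weakly_converges_def
  proof (intro ballI LIMSEQ_I)
    fix l and e :: real assume l: "l \<in> carr (dual V)" and e: "e > 0"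
    have neg: "(\<lambda>u. - l u) \<in> carr (dual V)"
      using l by (auto simp: dual_def)
    have "\<forall>\<^sub>F n in sequentially. norm (l (z n) - l y) < e"
      using half[OF l e] half[OF neg e] by eventually_elim auto
    then show "\<exists>N. \<forall>n\<ge>N. norm (l (z n) - l y) < e" by (simp add: eventually_sequentially)
  qed
  moreover have "z = (\<lambda>n. x (r n))" by (simp add: z_def fun_eq_iff)
  ultimately show ?thesis using that[OF r(1) y(1)] by simp
qed

end

section \<open>The state equation\<close>

lemma L2_mono_AE:
  assumes "f \<in> borel_measurable (lebesgue_on D)" "h \<in> carr (Lp_space D 2)"
    and "AE s in lebesgue_on D. \<bar>f s\<bar> \<le> \<bar>h s\<bar>"
  shows "f \<in> carr (Lp_space D 2)" "nrm (Lp_space D 2) f \<le> nrm (Lp_space D 2) h"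
proof -
  have h: "integrable (lebesgue_on D) (\<lambda>s. (h s)\<^sup>2)" using assms(2) by (simp add: carr_L2)
  have le: "AE s in lebesgue_on D. (f s)\<^sup>2 \<le> (h s)\<^sup>2"
    using assms(3) by eventually_elim (simp add: abs_le_square_iff)
  have f: "integrable (lebesgue_on D) (\<lambda>s. (f s)\<^sup>2)"
    by (rule Bochner_Integration.integrable_bound[OF h]) (use assms(1) le in auto)
  then show "f \<in> carr (Lp_space D 2)" using assms(1) by (simp add: carr_L2)
  have "(nrm (Lp_space D 2) f)\<^sup>2 \<le> (nrm (Lp_space D 2) h)\<^sup>2"
    unfolding nrm_L2_sq by (rule integral_mono_AE[OF f h le])
  then show "nrm (Lp_space D 2) f \<le> nrm (Lp_space D 2) h"
    by (rule power2_le_imp_le) (rule nrm_Lp_nonneg)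
qed

text \<open>One bound \<open>K\<close> on the inverses serves almost all \<omega>. Its sign is left
  open, which is why estimates use its absolute value.\<close>

locale random_elliptic = sobolev_embedding D q p + prob_space M
  for D q p and M :: "'w measure" +
  fixes a g :: "'w \<Rightarrow> real^2 \<Rightarrow> real" and K :: real
  assumes complete_M: "complete_measure M"
    and g_Linf: "g \<in> Linf M (Lp_space D 2)"
    and iso: "AE \<omega> in M. iso_inverse_bound (W01p D p) (Wm1p D p) (elliptic_op D (a \<omega>)) K"
begin

sublocale P: sobolev D p
  using D_open p_gt_2 by unfold_locales auto

sublocale L2: square_integrable D
  using D_lmeasurable by unfold_locales

section \<open>Sobolev-valued random fields as square-integrable ones\<close>

lemma Wm1p_eq: "Wm1p D p = dual (W01p D q)"
  by (simp add: Wm1p_def q_eq)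

lemma Y_L2:
  assumes "u \<in> carr (W01p D p)"
  shows "u \<in> carr (Lp_space D 2)"
    and "nrm (Lp_space D 2) u \<le> (1 + measure lebesgue D) * nrm (W01p D p) u"
proof -
  show "u \<in> carr (Lp_space D 2)"
    using Lp_subset[OF D_lmeasurable _ _ P.nrm_Lp_le_W01p(1)[OF assms]] p_gt_2 by simp
  have "nrm (Lp_space D 2) u \<le> (1 + measure lebesgue D) * nrm (Lp_space D p) u"
    using Lp_nrm_le[OF D_lmeasurable _ _ P.nrm_Lp_le_W01p(1)[OF assms]] p_gt_2 by simp
  also have "\<dots> \<le> (1 + measure lebesgue D) * nrm (W01p D p) u"
    using P.nrm_Lp_le_W01p(2)[OF assms] by (intro mult_left_mono) auto
  finally show "nrm (Lp_space D 2) u \<le> (1 + measure lebesgue D) * nrm (W01p D p) u" .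
qed

lemma strongly_measurable_Y_L2:
  assumes "strongly_measurable M (W01p D p) f" "AE \<omega> in M. f \<omega> \<in> carr (W01p D p)"
  shows "strongly_measurable M (Lp_space D 2) f"
proof -
  obtain \<sigma> where s: "\<And>n. simple_function M (\<sigma> n)" "\<And>n \<omega>. \<omega> \<in> space M \<Longrightarrow> \<sigma> n \<omega> \<in> carr (W01p D p)"
      "AE \<omega> in M. (\<lambda>n. nrm (W01p D p) (\<sigma> n \<omega> - f \<omega>)) \<longlonglongrightarrow> 0"
    by (rule strongly_measurableE[OF assms(1)]) blast
  have "AE \<omega> in M. (\<lambda>n. nrm (Lp_space D 2) (\<sigma> n \<omega> - f \<omega>)) \<longlonglongrightarrow> 0"
    using s(3) assms(2) AE_space
  proof eventually_elim
    case (elim \<omega>)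
    show ?case
    proof (rule Lim_null_comparison)
      show "\<forall>\<^sub>F n in sequentially. norm (nrm (Lp_space D 2) (\<sigma> n \<omega> - f \<omega>))
          \<le> (1 + measure lebesgue D) * nrm (W01p D p) (\<sigma> n \<omega> - f \<omega>)"
        using Y_L2(2)[OF P.W01p.diff_mem[OF s(2)[OF elim(3)] elim(2)]]
        by (simp add: nrm_Lp_nonneg always_eventually)
      show "(\<lambda>n. (1 + measure lebesgue D) * nrm (W01p D p) (\<sigma> n \<omega> - f \<omega>)) \<longlonglongrightarrow> 0"
        using tendsto_mult_left[OF elim(1)] by simp
    qed
  qed
  then show ?thesis
    unfolding strongly_measurable_def using s(1,2) Y_L2(1) by blast
qed

lemma LinfD:
  assumes "f \<in> Linf M W"
  shows "AE \<omega> in M. f \<omega> \<in> carr W" "strongly_measurable M W f" "\<exists>B. AE \<omega> in M. nrm W (f \<omega>) \<le> B"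
  using assms by (auto simp: Linf_def)

text \<open>A non-integrable integrand would give the Bochner integral the default value 0, so the
  objective has its intended meaning through this integrability. It follows from measurability of
  the norm and an essential bound.\<close>

lemma tracking_integrable:
  assumes f: "f \<in> Linf M (W01p D p)" and h: "h \<in> carr (Lp_space D 2)"
  shows "(\<lambda>\<omega>. nrm (Lp_space D 2) (f \<omega> - h)) \<in> borel_measurable M"
    and "\<exists>B. AE \<omega> in M. nrm (Lp_space D 2) (f \<omega> - h) \<le> B"
    and "integrable M (\<lambda>\<omega>. (nrm (Lp_space D 2) (f \<omega> - h))\<^sup>2)"
proof -
  have c: "AE \<omega> in M. f \<omega> \<in> carr (Lp_space D 2)"
    using LinfD(1)[OF f] by eventually_elim (rule Y_L2(1))
  have "strongly_measurable M (Lp_space D 2) (f - (\<lambda>_. h))"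
    by (rule L2.V.strongly_measurable_diff[OF strongly_measurable_Y_L2[OF LinfD(2,1)[OF f]] c
          L2.V.strongly_measurable_const[OF h]]) (use h in simp)
  moreover have "AE \<omega> in M. (f - (\<lambda>_. h)) \<omega> \<in> carr (Lp_space D 2)"
    using c by eventually_elim (use L2.V.diff_mem[OF _ h] in simp)
  ultimately show m: "(\<lambda>\<omega>. nrm (Lp_space D 2) (f \<omega> - h)) \<in> borel_measurable M"
    using L2.V.nrm_measurable[OF complete_M, of "f - (\<lambda>_. h)"] by simp
  obtain B where B: "AE \<omega> in M. nrm (W01p D p) (f \<omega>) \<le> B" using LinfD(3)[OF f] by blast
  define B' where "B' = (1 + measure lebesgue D) * B + nrm (Lp_space D 2) h"
  have b: "AE \<omega> in M. nrm (Lp_space D 2) (f \<omega> - h) \<le> B'"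
    using B LinfD(1)[OF f]
  proof eventually_elim
    case (elim \<omega>)
    note f2 = Y_L2[OF elim(2)]
    have "nrm (Lp_space D 2) (f \<omega> - h) \<le> nrm (Lp_space D 2) (f \<omega>) + nrm (Lp_space D 2) h"
      using L2.V.nrm_triangle[OF f2(1) L2.V.scale_mem[OF h, of "-1"]] L2.V.nrm_scale[OF h, of "-1"]
      by (simp add: fun_diff_def)
    also have "nrm (Lp_space D 2) (f \<omega>) \<le> (1 + measure lebesgue D) * B"
      by (rule order_trans[OF f2(2)]) (intro mult_left_mono elim(1), simp)
    finally show ?case by (simp add: B'_def)
  qed
  then show "\<exists>B. AE \<omega> in M. nrm (Lp_space D 2) (f \<omega> - h) \<le> B" by blast
  show "integrable M (\<lambda>\<omega>. (nrm (Lp_space D 2) (f \<omega> - h))\<^sup>2)"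
  proof (rule integrable_const_bound[where B="B'\<^sup>2"])
    show "AE \<omega> in M. norm ((nrm (Lp_space D 2) (f \<omega> - h))\<^sup>2) \<le> B'\<^sup>2"
      using b by eventually_elim (simp add: nrm_Lp_nonneg power_mono)
  qed (use m in measurable)
qed

lemma zero_Linf: "(\<lambda>\<omega> s. 0) \<in> Linf M (W01p D p)"
  using P.W01p.strongly_measurable_const[OF P.W01p.zero_mem, of M] P.W01p.zero_mem P.W01p.nrm_zero
  by (auto simp: Linf_def intro!: exI[of _ 0])

text \<open>Collects the two almost sure properties, so that the state equation can be analysed at a
  fixed \<omega>.\<close>

definition admissible :: "'w \<Rightarrow> bool" where
  "admissible \<omega> \<longleftrightarrow> iso_inverse_bound (W01p D p) (Wm1p D p) (elliptic_op D (a \<omega>)) K \<and> g \<omega> \<in> carr (Lp_space D 2)"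

lemma AE_admissible: "AE \<omega> in M. admissible \<omega>"
  using iso LinfD(1)[OF g_Linf] by eventually_elim (simp add: admissible_def)

section \<open>The state equation at a fixed \<omega>\<close>

lemma elliptic_op_mem:
  assumes "admissible \<omega>" "u \<in> carr (W01p D p)"
  shows "elliptic_op D (a \<omega>) u \<in> carr (dual (W01p D q))"
  using assms by (simp add: admissible_def iso_inverse_bound_def Wm1p_eq)

text \<open>\<open>iso_inverse_bound\<close> states linearity only up to dual norm zero; evaluation
  at \<phi> turns this into an identity of numbers.\<close>

lemma elliptic_op_diff:
  assumes \<omega>: "admissible \<omega>" and u: "u \<in> carr (W01p D p)" and v: "v \<in> carr (W01p D p)" and \<phi>: "\<phi> \<in> carr (W01p D q)"
  shows "elliptic_op D (a \<omega>) (u - v) \<phi> = elliptic_op D (a \<omega>) u \<phi> - elliptic_op D (a \<omega>) v \<phi>"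
proof -
  let ?T = "elliptic_op D (a \<omega>)"
  have "\<forall>u\<in>carr (W01p D p). \<forall>v\<in>carr (W01p D p). \<forall>b c.
      nrm (dual (W01p D q)) (?T (\<lambda>s. b * u s + c * v s) - (\<lambda>r. b * ?T u r + c * ?T v r)) = 0"
    using \<omega> unfolding admissible_def iso_inverse_bound_def Wm1p_eq by blast
  from this[rule_format, OF u v, of 1 "-1"]
  have "nrm (dual (W01p D q)) (?T (u - v) - (?T u - ?T v)) = 0"
    by (simp add: fun_diff_def)
  from W01p.nrm_dual_zeroD[OF this elliptic_op_mem[OF \<omega> P.W01p.diff_mem[OF u v]]
      W01p.diff_mem_dual[OF elliptic_op_mem[OF \<omega> u] elliptic_op_mem[OF \<omega> v]] \<phi>]
  show ?thesis by simp
qed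

lemma rhs_mem:
  assumes "admissible \<omega>" "x \<in> carr (Lp_space D 2)"
  shows "(\<lambda>s. x s + g \<omega> s) \<in> carr (Lp_space D 2)"
  using L2.V.add_mem[OF assms(2)] assms(1) by (simp add: admissible_def)

lemma rhs_diff:
  assumes \<omega>: "admissible \<omega>" and x: "x \<in> carr (Lp_space D 2)" "x' \<in> carr (Lp_space D 2)" and \<phi>: "\<phi> \<in> carr (W01p D q)"
  shows "(\<integral>s. (x s + g \<omega> s) * \<phi> s \<partial>lebesgue_on D) - (\<integral>s. (x' s + g \<omega> s) * \<phi> s \<partial>lebesgue_on D) =
     (\<integral>s. (x - x') s * \<phi> s \<partial>lebesgue_on D)"
proof -
  have "(\<integral>s. (x s + g \<omega> s) * \<phi> s \<partial>lebesgue_on D) - (\<integral>s. (x' s + g \<omega> s) * \<phi> s \<partial>lebesgue_on D) =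
      (\<integral>s. (x s + g \<omega> s) * \<phi> s - (x' s + g \<omega> s) * \<phi> s \<partial>lebesgue_on D)"
    by (intro Bochner_Integration.integral_diff[symmetric] L2_mult_integrable rhs_mem[OF \<omega>] x W01p_subset_L2[OF \<phi>])
  also have "\<dots> = (\<integral>s. (x - x') s * \<phi> s \<partial>lebesgue_on D)"
    by (intro Bochner_Integration.integral_cong) (auto simp: algebra_simps)
  finally show ?thesis .
qed

text \<open>The operator maps y - y' to the functional of x - x', so the bound on the inverse
  applies; nothing on the right-hand side depends on \<omega>.\<close>

lemma solution_difference_bound:
  assumes \<omega>: "admissible \<omega>" and x: "x \<in> carr (Lp_space D 2)" "x' \<in> carr (Lp_space D 2)"
    and y: "solves_pde D p (a \<omega>) (\<lambda>s. x s + g \<omega> s) y" "solves_pde D p (a \<omega>) (\<lambda>s. x' s + g \<omega> s) y'"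
  shows "nrm (W01p D p) (y - y') \<le> \<bar>K\<bar> * nrm (dual (W01p D q)) (\<lambda>\<phi>. \<integral>s. (x - x') s * \<phi> s \<partial>lebesgue_on D)"
proof -
  let ?T = "elliptic_op D (a \<omega>)" and ?l = "\<lambda>\<phi>. \<integral>s. (x - x') s * \<phi> s \<partial>lebesgue_on D"
  have yY: "y \<in> carr (W01p D p)" "y' \<in> carr (W01p D p)" using y by (auto simp: solves_pde_def)
  note d = P.W01p.diff_mem[OF yY]
  have l: "?l \<in> carr (dual (W01p D q))"
    by (rule L2_functional_W01p[OF L2.V.diff_mem[OF x]])
  have eq: "?T (y - y') \<phi> = ?l \<phi>" if \<phi>: "\<phi> \<in> carr (W01p D q)" for \<phi>
    using elliptic_op_diff[OF \<omega> yY \<phi>] rhs_diff[OF \<omega> x \<phi>] y \<phi> by (simp add: solves_pde_def q_eq)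
  have "nrm (W01p D p) (y - y') \<le> K * nrm (dual (W01p D q)) (?T (y - y'))"
    using \<omega> d unfolding admissible_def iso_inverse_bound_def Wm1p_eq by blast
  also have "\<dots> \<le> \<bar>K\<bar> * nrm (dual (W01p D q)) (?T (y - y'))"
    using W01p.le_nrm_dual[OF elliptic_op_mem[OF \<omega> d] W01p.zero_mem] W01p.nrm_zero
    by (intro mult_right_mono) auto
  also have "\<dots> \<le> \<bar>K\<bar> * nrm (dual (W01p D q)) ?l"
  proof (intro mult_left_mono W01p.nrm_dual_le)
    show "\<bar>?T (y - y') u\<bar> \<le> nrm (dual (W01p D q)) ?l" if "u \<in> carr (W01p D q)" "nrm (W01p D q) u \<le> 1" for u
      unfolding eq[OF that(1)] using l that by (rule W01p.le_nrm_dual)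
  qed simp
  finally show ?thesis .
qed

lemma solution_exists:
  assumes \<omega>: "admissible \<omega>" and x: "x \<in> carr (Lp_space D 2)"
  shows "\<exists>y. solves_pde D p (a \<omega>) (\<lambda>s. x s + g \<omega> s) y"
proof -
  let ?T = "elliptic_op D (a \<omega>)" and ?l = "\<lambda>\<phi>. \<integral>s. (x s + g \<omega> s) * \<phi> s \<partial>lebesgue_on D"
  have l: "?l \<in> carr (dual (W01p D q))"
    by (rule L2_functional_W01p[OF rhs_mem[OF \<omega> x]])
  have "\<forall>w\<in>carr (dual (W01p D q)). \<exists>u\<in>carr (W01p D p). nrm (dual (W01p D q)) (?T u - w) = 0"
    using \<omega> unfolding admissible_def iso_inverse_bound_def Wm1p_eq by blast
  with l obtain y where y: "y \<in> carr (W01p D p)" "nrm (dual (W01p D q)) (?T y - ?l) = 0" by blast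
  from W01p.nrm_dual_zeroD[OF y(2) elliptic_op_mem[OF \<omega> y(1)] l] y(1) show ?thesis
    by (auto simp: solves_pde_def q_eq)
qed

text \<open>Continuity of the operator handles the left-hand side. On the right, \<phi> belongs to
  L^2 by the Sobolev embedding, so weak convergence of the controls is enough.\<close>

lemma solves_pde_limit:
  assumes \<omega>: "admissible \<omega>" and x: "\<And>k. X k \<in> carr (Lp_space D 2)" "x \<in> carr (Lp_space D 2)"
    and weak: "\<And>v. v \<in> carr (Lp_space D 2) \<Longrightarrow> (\<lambda>k. L2.ip (X k - x) v) \<longlonglongrightarrow> 0"
    and y: "\<And>k. solves_pde D p (a \<omega>) (\<lambda>s. X k s + g \<omega> s) (Y k)" "y \<in> carr (W01p D p)"
    and lim: "(\<lambda>k. nrm (W01p D p) (Y k - y)) \<longlonglongrightarrow> 0"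
  shows "solves_pde D p (a \<omega>) (\<lambda>s. x s + g \<omega> s) y"
  unfolding solves_pde_def
proof (intro conjI ballI y(2))
  let ?T = "elliptic_op D (a \<omega>)"
  fix \<phi> assume "\<phi> \<in> carr (W01p D (p / (p - 1)))"
  then have \<phi>: "\<phi> \<in> carr (W01p D q)" by (simp add: q_eq)
  have Y: "Y k \<in> carr (W01p D p)" for k using y(1) by (simp add: solves_pde_def)
  note d = P.W01p.diff_mem[OF Y y(2)]
  obtain B where B: "\<And>u. u \<in> carr (W01p D p) \<Longrightarrow> nrm (dual (W01p D q)) (?T u) \<le> B * nrm (W01p D p) u"
    using \<omega> unfolding admissible_def iso_inverse_bound_def Wm1p_eq by blast
  have "(\<lambda>k. ?T (Y k - y) \<phi>) \<longlonglongrightarrow> 0"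
  proof (rule Lim_null_comparison)
    show "\<forall>\<^sub>F k in sequentially. norm (?T (Y k - y) \<phi>) \<le> B * nrm (W01p D p) (Y k - y) * (nrm (W01p D q) \<phi> + 1)"
    proof (rule always_eventually, rule allI)
      fix k
      have "norm (?T (Y k - y) \<phi>) \<le> nrm (dual (W01p D q)) (?T (Y k - y)) * (nrm (W01p D q) \<phi> + 1)"
        using W01p.abs_le_nrm_dual[OF elliptic_op_mem[OF \<omega> d] \<phi>] by simp
      also have "\<dots> \<le> B * nrm (W01p D p) (Y k - y) * (nrm (W01p D q) \<phi> + 1)"
        using B[OF d] W01p.nrm_nonneg[OF \<phi>] by (intro mult_right_mono) auto
      finally show "norm (?T (Y k - y) \<phi>) \<le> B * nrm (W01p D p) (Y k - y) * (nrm (W01p D q) \<phi> + 1)" .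
    qed
    have "(\<lambda>k. B * nrm (W01p D p) (Y k - y) * (nrm (W01p D q) \<phi> + 1)) \<longlonglongrightarrow> B * 0 * (nrm (W01p D q) \<phi> + 1)"
      by (intro tendsto_intros lim)
    then show "(\<lambda>k. B * nrm (W01p D p) (Y k - y) * (nrm (W01p D q) \<phi> + 1)) \<longlonglongrightarrow> 0" by simp
  qed
  moreover have eq: "?T (Y k - y) \<phi> = L2.ip (X k - x) \<phi> + (\<integral>s. (x s + g \<omega> s) * \<phi> s \<partial>lebesgue_on D) - ?T y \<phi>" for k
    using elliptic_op_diff[OF \<omega> Y y(2) \<phi>, of k] rhs_diff[OF \<omega> x(1) x(2) \<phi>, of k] y(1)[of k] \<phi>
    by (simp add: solves_pde_def q_eq L2.ip_def)
  moreover have "(\<lambda>k. L2.ip (X k - x) \<phi> + (\<integral>s. (x s + g \<omega> s) * \<phi> s \<partial>lebesgue_on D) - ?T y \<phi>)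
      \<longlonglongrightarrow> 0 + (\<integral>s. (x s + g \<omega> s) * \<phi> s \<partial>lebesgue_on D) - ?T y \<phi>"
    by (intro tendsto_intros weak W01p_subset_L2[OF \<phi>])
  ultimately have "0 + (\<integral>s. (x s + g \<omega> s) * \<phi> s \<partial>lebesgue_on D) - ?T y \<phi> = 0"
    by (intro LIMSEQ_unique) (simp_all only: eq)
  then show "?T y \<phi> = (\<integral>s. (x s + g \<omega> s) * \<phi> s \<partial>lebesgue_on D)" by simp
qed

section \<open>From weak convergence of controls to uniform convergence of states\<close>

lemma weakly_converges_ip:
  assumes "weakly_converges (Lp_space D 2) X x" "\<And>n. X n \<in> carr (Lp_space D 2)" "x \<in> carr (Lp_space D 2)"
    and v: "v \<in> carr (Lp_space D 2)"
  shows "(\<lambda>n. L2.ip (X n - x) v) \<longlonglongrightarrow> 0"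
proof -
  have "(\<lambda>n. L2.ip (X n) v) \<longlonglongrightarrow> L2.ip x v"
    unfolding L2.ip_def by (rule bspec[OF assms(1)[unfolded weakly_converges_def] L2_functional[OF v]])
  then show ?thesis
    using L2.ip_diff[OF assms(2,3) v] by (simp add: LIM_zero)
qed

text \<open>The limit state is found by solving the equation for the weak limit of the controls at
  each \<omega>, not as an abstract limit of the states; no completeness of the Bochner space
  enters.\<close>

lemma accumulation_point_exists:
  assumes x: "\<And>n. xs n \<in> carr (Lp_space D 2)" "\<And>n. nrm (Lp_space D 2) (xs n) \<le> B"
    and y: "\<And>n. ys n \<in> Linf M (W01p D p)" "\<And>n. AE \<omega> in M. solves_pde D p (a \<omega>) (\<lambda>s. xs n s + g \<omega> s) (ys n \<omega>)"
  shows "\<exists>x y. weak_strong_accumulation_point M D p xs ys x y"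
proof -
  obtain r x where r: "strict_mono (r :: nat \<Rightarrow> nat)" and xL: "x \<in> carr (Lp_space D 2)"
    and wc: "weakly_converges (Lp_space D 2) (\<lambda>n. xs (r n)) x"
    by (rule L2.weak_sequential_compactness[where x=xs and M=B, OF x]) blast
  define F where "F n = xs (r n) - x" for n
  have FV: "F n \<in> carr (Lp_space D 2)" for n
    unfolding F_def by (rule L2.V.diff_mem[OF x(1) xL])
  have Fb: "nrm (Lp_space D 2) (F n) \<le> B + nrm (Lp_space D 2) x" for n
    using L2.V.nrm_triangle[OF x(1) L2.V.scale_mem[OF xL, of "-1"], of "r n"] L2.V.nrm_scale[OF xL, of "-1"] x(2)[of "r n"]
    by (simp add: F_def fun_diff_def)
  have Fw: "(\<lambda>n. \<integral>s. F n s * v s \<partial>lebesgue_on D) \<longlonglongrightarrow> 0" if "v \<in> carr (Lp_space D 2)" for v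
    using weakly_converges_ip[OF wc x(1) xL that] by (simp add: F_def L2.ip_def)
  define l where "l n = (\<lambda>\<phi>. \<integral>s. F n s * \<phi> s \<partial>lebesgue_on D)" for n
  \<comment> \<open>The distance of the controls from their weak limit in the dual norm: a
    deterministic sequence.\<close>
  define \<epsilon> where "\<epsilon> n = nrm (dual (W01p D q)) (l n)" for n
  have ld: "l n \<in> carr (dual (W01p D q))" for n
    unfolding l_def by (rule L2_functional_W01p[OF FV])
  have \<epsilon>0: "\<epsilon> n \<ge> 0" for n
    using W01p.le_nrm_dual[OF ld W01p.zero_mem, of n] W01p.nrm_zero by (simp add: \<epsilon>_def)
  have \<epsilon>: "\<epsilon> \<longlonglongrightarrow> 0"
  proof (rule LIMSEQ_I)
    fix e :: real assume e: "e > 0"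
    have "\<forall>\<^sub>F n in sequentially. \<forall>u\<in>carr (W01p D q). nrm (W01p D q) u \<le> 1 \<longrightarrow> \<bar>\<integral>s. F n s * u s \<partial>lebesgue_on D\<bar> \<le> e / 2"
      using e by (intro weak_null_imp_uniformly_null[OF FV Fb Fw]) auto
    then have "\<forall>\<^sub>F n in sequentially. norm (\<epsilon> n - 0) < e"
    proof eventually_elim
      case (elim n)
      then have "\<epsilon> n \<le> e / 2"
        unfolding \<epsilon>_def l_def by (intro W01p.nrm_dual_le) auto
      then show ?case using \<epsilon>0[of n] e by simp
    qed
    then show "\<exists>N. \<forall>n\<ge>N. norm (\<epsilon> n - 0) < e" by (simp add: eventually_sequentially)
  qed
  have K\<epsilon>: "(\<lambda>n. \<bar>K\<bar> * \<epsilon> n) \<longlonglongrightarrow> 0" using tendsto_mult_left[OF \<epsilon>, of "\<bar>K\<bar>"] by simp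
  \<comment> \<open>The choice is made separately at each \<omega>, so measurability has to be
    derived afterwards, from the uniform convergence of the measurable states.\<close>
  define y where "y \<omega> = (SOME v. solves_pde D p (a \<omega>) (\<lambda>s. x s + g \<omega> s) v)" for \<omega>
  have y_pde: "AE \<omega> in M. solves_pde D p (a \<omega>) (\<lambda>s. x s + g \<omega> s) (y \<omega>)"
    using AE_admissible
  proof eventually_elim
    case (elim \<omega>)
    show ?case unfolding y_def by (rule someI_ex[OF solution_exists[OF elim xL]])
  qed
  then have yY: "AE \<omega> in M. y \<omega> \<in> carr (W01p D p)"
    by eventually_elim (simp add: solves_pde_def)
  have bound: "AE \<omega> in M. nrm (W01p D p) (ys (r n) \<omega> - y \<omega>) \<le> \<bar>K\<bar> * \<epsilon> n" for n
    using AE_admissible y_pde assms(4)[of "r n"]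
  proof eventually_elim
    case (elim \<omega>)
    show ?case
      unfolding \<epsilon>_def l_def F_def by (rule solution_difference_bound[OF elim(1) x(1) xL elim(3,2)])
  qed
  note ysL = LinfD[OF assms(3)]
  have ym: "strongly_measurable M (W01p D p) y"
    by (rule P.W01p.strongly_measurable_uniform_limit[OF prob_space_axioms complete_M ysL(2,1) yY bound K\<epsilon>])
  have y_Linf: "y \<in> Linf M (W01p D p)"
  proof -
    obtain B' where B': "AE \<omega> in M. nrm (W01p D p) (ys (r 0) \<omega>) \<le> B'" using ysL(3) by blast
    have "AE \<omega> in M. nrm (W01p D p) (y \<omega>) \<le> B' + \<bar>K\<bar> * \<epsilon> 0"
      using B' bound[of 0] yY ysL(1)[of "r 0"]
    proof eventually_elim
      case (elim \<omega>)
      then show ?case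
        using P.W01p.nrm_le_diff[OF elim(3,4)] P.W01p.nrm_diff_commute[OF elim(3,4)] by linarith
    qed
    then show ?thesis using ym yY by (auto simp: Linf_def)
  qed
  have "(\<lambda>n. Linf_norm M (W01p D p) (ys (r n) - y)) \<longlonglongrightarrow> 0"
  proof (rule tendsto_sandwich[OF _ _ tendsto_const])
    have m: "(\<lambda>\<omega>. ereal (nrm (W01p D p) ((ys (r n) - y) \<omega>))) \<in> borel_measurable M" for n
    proof -
      have "AE \<omega> in M. (ys (r n) - y) \<omega> \<in> carr (W01p D p)"
        using ysL(1)[of "r n"] yY by eventually_elim (simp add: P.W01p.diff_mem)
      from P.W01p.nrm_measurable[OF complete_M P.W01p.strongly_measurable_diff[OF ysL(2,1) ym yY] this]
      show ?thesis by measurable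
    qed
    have "(\<lambda>n. ereal (\<bar>K\<bar> * \<epsilon> n)) \<longlonglongrightarrow> ereal 0" using K\<epsilon> by (rule tendsto_ereal)
    then show "(\<lambda>n. ereal (\<bar>K\<bar> * \<epsilon> n)) \<longlonglongrightarrow> 0" by (simp add: zero_ereal_def)
    show "\<forall>\<^sub>F n in sequentially. Linf_norm M (W01p D p) (ys (r n) - y) \<le> ereal (\<bar>K\<bar> * \<epsilon> n)"
    proof (rule always_eventually, rule allI)
      fix n show "Linf_norm M (W01p D p) (ys (r n) - y) \<le> ereal (\<bar>K\<bar> * \<epsilon> n)"
        unfolding Linf_norm_def
      proof (rule esssup_I[OF m])
        show "AE \<omega> in M. ereal (nrm (W01p D p) ((ys (r n) - y) \<omega>)) \<le> ereal (\<bar>K\<bar> * \<epsilon> n)"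
          using bound[of n] by eventually_elim simp
      qed
    qed
    show "\<forall>\<^sub>F n in sequentially. 0 \<le> Linf_norm M (W01p D p) (ys (r n) - y)"
    proof (rule always_eventually, rule allI)
      fix n
      \<comment> \<open>The inequality does not involve \<omega>, so on a probability space its
        almost sure validity is its validity.\<close>
      have "AE \<omega> in M. 0 \<le> Linf_norm M (W01p D p) (ys (r n) - y)"
        using esssup_AE[of "\<lambda>\<omega>. ereal (nrm (W01p D p) ((ys (r n) - y) \<omega>))" M] ysL(1)[of "r n"] yY
        unfolding Linf_norm_def
      proof eventually_elim
        case (elim \<omega>)
        have "0 \<le> ereal (nrm (W01p D p) ((ys (r n) - y) \<omega>))"
          using P.W01p.nrm_nonneg[OF P.W01p.diff_mem[OF elim(2,3)]] by simp
        then show ?case using elim(1) by (rule order_trans)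
      qed
      then show "0 \<le> Linf_norm M (W01p D p) (ys (r n) - y)" by (simp add: AE_const)
    qed
  qed
  then have "weak_strong_accumulation_point M D p xs ys x y"
    unfolding weak_strong_accumulation_point_def using xL y_Linf r wc by blast
  then show ?thesis by blast
qed

text \<open>Replaces convergence in the extended reals by explicit almost sure bounds, the form used
  at a fixed \<omega> and in dominated convergence. The indices tend to infinity because N k \<ge>
  k.\<close>

lemma Linf_norm_tendsto_imp_subseq:
  assumes "\<And>n. ys n \<in> Linf M (W01p D p)" "y \<in> Linf M (W01p D p)"
    and lim: "(\<lambda>n. Linf_norm M (W01p D p) (ys n - y)) \<longlonglongrightarrow> 0"
  obtains N :: "nat \<Rightarrow> nat" where "filterlim N at_top sequentially"
    "\<And>k. AE \<omega> in M. nrm (W01p D p) (ys (N k) \<omega> - y \<omega>) \<le> 1 / real (Suc k)"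
proof -
  have "\<exists>n\<ge>k. Linf_norm M (W01p D p) (ys n - y) < ereal (1 / real (Suc k))" for k
  proof -
    have "\<forall>\<^sub>F n in sequentially. Linf_norm M (W01p D p) (ys n - y) < ereal (1 / real (Suc k))"
      by (rule order_tendstoD(2)[OF lim]) simp
    then have "\<forall>\<^sub>F n in sequentially. n \<ge> k \<and> Linf_norm M (W01p D p) (ys n - y) < ereal (1 / real (Suc k))"
      using eventually_ge_at_top[of k] by eventually_elim simp
    from eventually_happens[OF this] show ?thesis by auto
  qed
  then obtain N where N: "\<And>k. N k \<ge> k" "\<And>k. Linf_norm M (W01p D p) (ys (N k) - y) < ereal (1 / real (Suc k))"
    by metis
  show ?thesis
  proof (rule that[of N])
    show "filterlim N at_top sequentially"
      by (rule filterlim_at_top_mono[OF filterlim_ident]) (use N(1) in simp)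
    fix k
    show "AE \<omega> in M. nrm (W01p D p) (ys (N k) \<omega> - y \<omega>) \<le> 1 / real (Suc k)"
      using esssup_AE[of "\<lambda>\<omega>. ereal (nrm (W01p D p) ((ys (N k) - y) \<omega>))" M]
    proof eventually_elim
      case (elim \<omega>)
      have "ereal (nrm (W01p D p) ((ys (N k) - y) \<omega>)) < ereal (1 / real (Suc k))"
        using le_less_trans[OF elim N(2)[of k, unfolded Linf_norm_def]] .
      then show ?case by simp
    qed
  qed
qed

text \<open>The positive part of y - \<psi> is dominated by |Y k - y| + |Z k| for every
  \<open>k\<close>. The norm of this majorant tends to zero, so the positive part has norm
  0.\<close>

lemma pointwise_bound_limit:
  assumes y: "y \<in> carr (Lp_space D 2)" "\<psi> \<in> carr (Lp_space D 2)"
    and Y: "\<And>k. Y k \<in> carr (Lp_space D 2)" "\<And>k. Z k \<in> carr (Lp_space D 2)"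
    and le: "\<And>k. AE s in lebesgue_on D. Y k s \<le> \<psi> s + Z k s"
    and lim: "(\<lambda>k. nrm (Lp_space D 2) (Y k - y)) \<longlonglongrightarrow> 0" "(\<lambda>k. nrm (Lp_space D 2) (Z k)) \<longlonglongrightarrow> 0"
  shows "AE s in lebesgue_on D. y s \<le> \<psi> s"
proof -
  define f where "f s = max 0 (y s - \<psi> s)" for s
  have fm: "f \<in> borel_measurable (lebesgue_on D)"
    using y unfolding f_def by (auto simp: carr_L2)
  have abs: "(\<lambda>s. \<bar>u s\<bar>) \<in> carr (Lp_space D 2)" "nrm (Lp_space D 2) (\<lambda>s. \<bar>u s\<bar>) = nrm (Lp_space D 2) u"
    if "u \<in> carr (Lp_space D 2)" for u
    using that by (auto simp: carr_L2 nrm_Lp)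
  have b: "f \<in> carr (Lp_space D 2) \<and> nrm (Lp_space D 2) f \<le> nrm (Lp_space D 2) (Y k - y) + nrm (Lp_space D 2) (Z k)" for k
  proof -
    note d = L2.V.diff_mem[OF Y(1) y(1), of k]
    have h: "(\<lambda>s. \<bar>(Y k - y) s\<bar> + \<bar>Z k s\<bar>) \<in> carr (Lp_space D 2)"
      by (rule L2.V.add_mem[OF abs(1)[OF d] abs(1)[OF Y(2)]])
    have "AE s in lebesgue_on D. \<bar>f s\<bar> \<le> \<bar>\<bar>(Y k - y) s\<bar> + \<bar>Z k s\<bar>\<bar>"
      using le[of k] by eventually_elim (simp add: f_def)
    note 1 = L2_mono_AE[OF fm h this]
    have "nrm (Lp_space D 2) (\<lambda>s. \<bar>(Y k - y) s\<bar> + \<bar>Z k s\<bar>) \<le> nrm (Lp_space D 2) (Y k - y) + nrm (Lp_space D 2) (Z k)"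
      using L2.V.nrm_triangle[OF abs(1)[OF d] abs(1)[OF Y(2)], of k] abs(2)[OF d] abs(2)[OF Y(2)] by simp
    with 1 show ?thesis by simp
  qed
  have "nrm (Lp_space D 2) f \<le> 0"
    using tendsto_add[OF lim] b by (intro LIMSEQ_le_const[where X="\<lambda>k. nrm (Lp_space D 2) (Y k - y) + nrm (Lp_space D 2) (Z k)"]) auto
  then have "(nrm (Lp_space D 2) f)\<^sup>2 = 0" using nrm_Lp_nonneg[of D 2 f] by simp
  then have "(\<integral>s. (f s)\<^sup>2 \<partial>lebesgue_on D) = 0" by (simp add: nrm_L2_sq)
  then have "AE s in lebesgue_on D. (f s)\<^sup>2 = 0"
    using b[of 0] by (subst (asm) integral_nonneg_eq_0_iff_AE) (auto simp: carr_L2)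
  then show ?thesis by eventually_elim (simp add: f_def)
qed

end

section \<open>The penalized problems\<close>

locale penalized_control = random_elliptic D q p M a g K
  for D q p and M :: "'w measure" and a g K +
  fixes \<psi> :: "'w \<Rightarrow> real^2 \<Rightarrow> real" and y_D :: "real^2 \<Rightarrow> real" and C1 C2 :: "(real^2 \<Rightarrow> real) set" and \<alpha> :: real
  assumes C1: "closed_in (Lp_space D 2) C1" "convex_set C1"
    and C2: "closed_in (W01p D p) C2" "(\<lambda>s. 0) \<in> C2"
    and y_D: "y_D \<in> carr (Lp_space D 2)" and \<alpha>: "\<alpha> > 0"
    and \<psi>: "\<psi> \<in> Linf M (W01p D p)"
begin

text \<open>The assumption that 0 lies in \<open>C2\<close> enters here: zero slack turns every
  feasible pair into a competitor of the penalized problem.\<close>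

lemma feasible_Ps_zero:
  assumes "feasible_P M D p a g \<psi> C1 C2 x y"
  shows "feasible_Ps M D p a g \<psi> C1 C2 x y (\<lambda>\<omega> s. 0)"
  using assms zero_Linf C2(2) by (auto simp: feasible_P_def feasible_Ps_def)

lemma objective_Ps_zero: "objective_Ps M D y_D \<alpha> \<beta> x y (\<lambda>\<omega> s. 0) = objective_P M D y_D \<alpha> x y"
  by (simp add: objective_Ps_def objective_P_def L2.V.nrm_zero)

lemma slack_integrable:
  assumes "z \<in> Linf M (W01p D p)"
  shows "integrable M (\<lambda>\<omega>. (nrm (Lp_space D 2) (z \<omega>))\<^sup>2)"
  using tracking_integrable(3)[OF assms L2.V.zero_mem] by (simp add: fun_diff_def)

lemma objective_Ps_split:
  assumes "y \<in> Linf M (W01p D p)" "z \<in> Linf M (W01p D p)"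
  shows "objective_Ps M D y_D \<alpha> \<beta> x y z = objective_P M D y_D \<alpha> x y +
    \<beta> / 2 * (\<integral>\<omega>. (nrm (Lp_space D 2) (z \<omega>))\<^sup>2 \<partial>M)"
  using tracking_integrable(3)[OF assms(1) y_D] slack_integrable[OF assms(2)]
  by (simp add: objective_Ps_def objective_P_def algebra_simps)

text \<open>Optimality against (x0, y0, 0) bounds tracking, control cost and penalty together by one
  number; each estimate then drops the nonnegative terms that it does not concern.\<close>

lemma solution_Ps_bounds:
  assumes P: "solution_P M D p a g y_D \<psi> C1 C2 \<alpha> x0 y0"
    and Ps: "solution_Ps M D p a g y_D \<psi> C1 C2 \<alpha> \<beta> x y z" and \<beta>: "\<beta> > 0"
  shows "feasible_Ps M D p a g \<psi> C1 C2 x y z"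
    and "objective_P M D y_D \<alpha> x y \<le> objective_P M D y_D \<alpha> x0 y0"
    and "(\<integral>\<omega>. (nrm (Lp_space D 2) (z \<omega>))\<^sup>2 \<partial>M) \<le> 2 * objective_P M D y_D \<alpha> x0 y0 / \<beta>"
    and "(nrm (Lp_space D 2) x)\<^sup>2 \<le> 2 * objective_P M D y_D \<alpha> x0 y0 / \<alpha>"
proof -
  show f: "feasible_Ps M D p a g \<psi> C1 C2 x y z"
    using Ps by (simp add: solution_Ps_def is_arg_min_def)
  have "feasible_P M D p a g \<psi> C1 C2 x0 y0"
    using P by (simp add: solution_P_def is_arg_min_def)
  from feasible_Ps_zero[OF this] Ps
  have "\<not> objective_Ps M D y_D \<alpha> \<beta> x0 y0 (\<lambda>\<omega> s. 0) < objective_Ps M D y_D \<alpha> \<beta> x y z"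
    by (auto simp: solution_Ps_def is_arg_min_def)
  then have le: "objective_P M D y_D \<alpha> x y + \<beta> / 2 * (\<integral>\<omega>. (nrm (Lp_space D 2) (z \<omega>))\<^sup>2 \<partial>M) \<le> objective_P M D y_D \<alpha> x0 y0"
    using f objective_Ps_split[of y z \<beta> x] by (simp add: objective_Ps_zero feasible_Ps_def)
  have nn: "0 \<le> (\<integral>\<omega>. (nrm (Lp_space D 2) (z \<omega>))\<^sup>2 \<partial>M)" by simp
  have x2: "\<alpha> / 2 * (nrm (Lp_space D 2) x)\<^sup>2 \<le> objective_P M D y_D \<alpha> x y"
    by (simp add: objective_P_def)
  then have nn': "0 \<le> objective_P M D y_D \<alpha> x y"
    using \<alpha> by (intro order_trans[OF _ x2]) simp
  have "0 \<le> \<beta> / 2 * (\<integral>\<omega>. (nrm (Lp_space D 2) (z \<omega>))\<^sup>2 \<partial>M)" using nn \<beta> by simp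
  with le show 1: "objective_P M D y_D \<alpha> x y \<le> objective_P M D y_D \<alpha> x0 y0" by linarith
  have "\<beta> / 2 * (\<integral>\<omega>. (nrm (Lp_space D 2) (z \<omega>))\<^sup>2 \<partial>M) \<le> objective_P M D y_D \<alpha> x0 y0" using le nn' by linarith
  then show "(\<integral>\<omega>. (nrm (Lp_space D 2) (z \<omega>))\<^sup>2 \<partial>M) \<le> 2 * objective_P M D y_D \<alpha> x0 y0 / \<beta>"
    using \<beta> by (simp add: pos_le_divide_eq mult.commute)
  have "\<alpha> / 2 * (nrm (Lp_space D 2) x)\<^sup>2 \<le> objective_P M D y_D \<alpha> x0 y0" using x2 1 by linarith
  then show "(nrm (Lp_space D 2) x)\<^sup>2 \<le> 2 * objective_P M D y_D \<alpha> x0 y0 / \<alpha>"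
    using \<alpha> by (simp add: pos_le_divide_eq mult.commute)
qed

text \<open>The limit passage once subsequences are chosen: states and slacks converge almost
  surely, so closedness of the constraints on the state is checked at a fixed \<omega>. Optimality
  follows because the objective at the limit does not exceed the optimal value.\<close>

lemma limit_solves_P:
  assumes P: "solution_P M D p a g y_D \<psi> C1 C2 \<alpha> x0 y0"
    and f: "\<And>k. feasible_Ps M D p a g \<psi> C1 C2 (X k) (Y k) (Z k)"
    and obj: "\<And>k. objective_P M D y_D \<alpha> (X k) (Y k) \<le> objective_P M D y_D \<alpha> x0 y0"
    and xb: "\<And>k. nrm (Lp_space D 2) (X k) \<le> B"
    and x: "x \<in> carr (Lp_space D 2)" and y: "y \<in> Linf M (W01p D p)"
    and weak: "\<And>v. v \<in> carr (Lp_space D 2) \<Longrightarrow> (\<lambda>k. L2.ip (X k - x) v) \<longlonglongrightarrow> 0"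
    and Yy: "\<And>k. AE \<omega> in M. nrm (W01p D p) (Y k \<omega> - y \<omega>) \<le> \<epsilon> k" and \<epsilon>: "\<epsilon> \<longlonglongrightarrow> 0"
    and Z: "AE \<omega> in M. (\<lambda>k. nrm (Lp_space D 2) (Z k \<omega>)) \<longlonglongrightarrow> 0"
  shows "solution_P M D p a g y_D \<psi> C1 C2 \<alpha> x y"
proof -
  define c where "c = 1 + measure lebesgue D"
  have c: "c \<ge> 0" by (simp add: c_def)
  have X: "\<And>k. X k \<in> carr (Lp_space D 2)" "\<And>k. X k \<in> C1"
    and YL: "\<And>k. Y k \<in> Linf M (W01p D p)" and ZL: "\<And>k. Z k \<in> Linf M (W01p D p)"
    using f by (auto simp: feasible_Ps_def)
  \<comment> \<open>Countably many exceptional null sets are united, so that one \<omega> serves all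
    \<open>k\<close>.\<close>
  have "AE \<omega> in M. \<forall>k. Y k \<omega> \<in> carr (W01p D p) \<and> Z k \<omega> \<in> carr (W01p D p) \<and> Y k \<omega> \<in> C2 \<and>
      solves_pde D p (a \<omega>) (\<lambda>s. X k s + g \<omega> s) (Y k \<omega>) \<and>
      (AE s in lebesgue_on D. Y k \<omega> s \<le> \<psi> \<omega> s + Z k \<omega> s) \<and> nrm (W01p D p) (Y k \<omega> - y \<omega>) \<le> \<epsilon> k"
    unfolding AE_all_countable
  proof
    fix k
    have "AE \<omega> in M. Y k \<omega> \<in> C2 \<and> Z k \<omega> \<in> C2"
      "AE \<omega> in M. solves_pde D p (a \<omega>) (\<lambda>s. X k s + g \<omega> s) (Y k \<omega>)"
      "AE \<omega> in M. AE s in lebesgue_on D. Y k \<omega> s \<le> \<psi> \<omega> s + Z k \<omega> s"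
      using f[of k] by (auto simp: feasible_Ps_def)
    then show "AE \<omega> in M. Y k \<omega> \<in> carr (W01p D p) \<and> Z k \<omega> \<in> carr (W01p D p) \<and> Y k \<omega> \<in> C2 \<and>
      solves_pde D p (a \<omega>) (\<lambda>s. X k s + g \<omega> s) (Y k \<omega>) \<and>
      (AE s in lebesgue_on D. Y k \<omega> s \<le> \<psi> \<omega> s + Z k \<omega> s) \<and> nrm (W01p D p) (Y k \<omega> - y \<omega>) \<le> \<epsilon> k"
      using LinfD(1)[OF YL[of k]] LinfD(1)[OF ZL[of k]] Yy[of k] by eventually_elim blast
  qed
  then have lim: "AE \<omega> in M. y \<omega> \<in> C2 \<and> solves_pde D p (a \<omega>) (\<lambda>s. x s + g \<omega> s) (y \<omega>) \<and>
      (AE s in lebesgue_on D. y \<omega> s \<le> \<psi> \<omega> s) \<and>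
      (\<lambda>k. nrm (Lp_space D 2) (Y k \<omega> - y_D)) \<longlonglongrightarrow> nrm (Lp_space D 2) (y \<omega> - y_D)"
    using AE_admissible LinfD(1)[OF y] LinfD(1)[OF \<psi>] Z
  proof eventually_elim
    case (elim \<omega>)
    have Yk: "\<And>k. Y k \<omega> \<in> carr (W01p D p)" "\<And>k. Z k \<omega> \<in> carr (W01p D p)" "\<And>k. Y k \<omega> \<in> C2"
      "\<And>k. solves_pde D p (a \<omega>) (\<lambda>s. X k s + g \<omega> s) (Y k \<omega>)"
      "\<And>k. AE s in lebesgue_on D. Y k \<omega> s \<le> \<psi> \<omega> s + Z k \<omega> s"
      "\<And>k. nrm (W01p D p) (Y k \<omega> - y \<omega>) \<le> \<epsilon> k"
      using elim(1) by blast+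
    note d = P.W01p.diff_mem[OF Yk(1) elim(3)]
    have l: "(\<lambda>k. nrm (W01p D p) (Y k \<omega> - y \<omega>)) \<longlonglongrightarrow> 0"
      by (rule Lim_null_comparison[OF _ \<epsilon>]) (use Yk(6) P.W01p.nrm_nonneg[OF d] in simp)
    have "(\<lambda>k. c * nrm (W01p D p) (Y k \<omega> - y \<omega>)) \<longlonglongrightarrow> c * 0"
      by (intro tendsto_intros l)
    then have cl: "(\<lambda>k. c * nrm (W01p D p) (Y k \<omega> - y \<omega>)) \<longlonglongrightarrow> 0" by simp
    have l2: "(\<lambda>k. nrm (Lp_space D 2) (Y k \<omega> - y \<omega>)) \<longlonglongrightarrow> 0"
    proof (rule Lim_null_comparison[OF always_eventually[OF allI] cl])
      fix k
      show "norm (nrm (Lp_space D 2) (Y k \<omega> - y \<omega>)) \<le> c * nrm (W01p D p) (Y k \<omega> - y \<omega>)"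
        using Y_L2(2)[OF d[of k]] nrm_Lp_nonneg[of D 2 "Y k \<omega> - y \<omega>"] by (simp add: c_def)
    qed
    have "y \<omega> \<in> C2"
    proof -
      have "\<exists>v\<in>C2. nrm (W01p D p) (y \<omega> - v) < e" if e: "e > 0" for e
      proof -
        obtain k where "nrm (W01p D p) (Y k \<omega> - y \<omega>) < e"
          using eventually_happens[OF order_tendstoD(2)[OF l e]] by auto
        then show ?thesis
          using Yk(3)[of k] P.W01p.nrm_diff_commute[OF Yk(1) elim(3), of k] by auto
      qed
      then show ?thesis using C2(1) elim(3) by (simp add: closed_in_def)
    qed
    moreover have "solves_pde D p (a \<omega>) (\<lambda>s. x s + g \<omega> s) (y \<omega>)"
      by (rule solves_pde_limit[where X=X and Y="\<lambda>k. Y k \<omega>", OF elim(2) X(1) x weak Yk(4) elim(3) l])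
    moreover have "AE s in lebesgue_on D. y \<omega> s \<le> \<psi> \<omega> s"
      by (rule pointwise_bound_limit[where Y="\<lambda>k. Y k \<omega>" and Z="\<lambda>k. Z k \<omega>", OF Y_L2(1)[OF elim(3)] Y_L2(1)[OF elim(4)] Y_L2(1)[OF Yk(1)] Y_L2(1)[OF Yk(2)]
            Yk(5) l2 elim(5)])
    moreover have "(\<lambda>k. nrm (Lp_space D 2) (Y k \<omega> - y_D)) \<longlonglongrightarrow> nrm (Lp_space D 2) (y \<omega> - y_D)"
    proof -
      have "norm (nrm (Lp_space D 2) (Y k \<omega> - y_D) - nrm (Lp_space D 2) (y \<omega> - y_D)) \<le> nrm (Lp_space D 2) (Y k \<omega> - y \<omega>)" for k
        using L2.V.nrm_diff_le[OF L2.V.diff_mem[OF Y_L2(1)[OF Yk(1)] y_D] L2.V.diff_mem[OF Y_L2(1)[OF elim(3)] y_D], of k]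
        by (simp add: fun_diff_def)
      then have "(\<lambda>k. nrm (Lp_space D 2) (Y k \<omega> - y_D) - nrm (Lp_space D 2) (y \<omega> - y_D)) \<longlonglongrightarrow> 0"
        by (intro Lim_null_comparison[OF _ l2] always_eventually) simp
      then show ?thesis by (simp add: LIM_zero_iff)
    qed
    ultimately show ?case by blast
  qed
  have xC1: "x \<in> C1"
    by (rule L2.weakly_closed[where x=X and M=B, OF C1(2,1) X(2) xb x weak])
  have feas: "feasible_P M D p a g \<psi> C1 C2 x y"
    unfolding feasible_P_def
  proof (intro conjI x y xC1)
    show "AE \<omega> in M. y \<omega> \<in> C2" using lim by eventually_elim blast
    show "AE \<omega> in M. solves_pde D p (a \<omega>) (\<lambda>s. x s + g \<omega> s) (y \<omega>)" using lim by eventually_elim blast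
    show "AE \<omega> in M. AE s in lebesgue_on D. y \<omega> s \<le> \<psi> \<omega> s" using lim by eventually_elim blast
  qed
  define E where "E u = (\<integral>\<omega>. (nrm (Lp_space D 2) (u \<omega> - y_D))\<^sup>2 \<partial>M)" for u :: "'w \<Rightarrow> real^2 \<Rightarrow> real"
  have E: "(\<lambda>k. E (Y k)) \<longlonglongrightarrow> E y"
  proof -
    obtain B' where B': "AE \<omega> in M. nrm (Lp_space D 2) (y \<omega> - y_D) \<le> B'"
      using tracking_integrable(2)[OF y y_D] by blast
    \<comment> \<open>The convergent sequence \<epsilon> is bounded, which yields a constant
      majorant for the tracking terms.\<close>
    obtain S where S: "\<And>k. \<epsilon> k \<le> S"
      using convergent_imp_Bseq[OF convergentI[OF \<epsilon>]] by (auto simp: Bseq_def abs_le_iff)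
    show ?thesis
      unfolding E_def
    proof (rule integral_dominated_convergence[where w="\<lambda>_. (B' + c * S)\<^sup>2"])
      show "AE \<omega> in M. (\<lambda>k. (nrm (Lp_space D 2) (Y k \<omega> - y_D))\<^sup>2) \<longlonglongrightarrow> (nrm (Lp_space D 2) (y \<omega> - y_D))\<^sup>2"
        using lim by eventually_elim (intro tendsto_power, blast)
      show "AE \<omega> in M. norm ((nrm (Lp_space D 2) (Y k \<omega> - y_D))\<^sup>2) \<le> (B' + c * S)\<^sup>2" for k
        using B' Yy[of k] LinfD(1)[OF YL[of k]] LinfD(1)[OF y]
      proof eventually_elim
        case (elim \<omega>)
        note d = P.W01p.diff_mem[OF elim(3,4)]
        have "nrm (Lp_space D 2) (Y k \<omega> - y_D) \<le> nrm (Lp_space D 2) (Y k \<omega> - y \<omega>) + nrm (Lp_space D 2) (y \<omega> - y_D)"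
          by (rule L2.V.nrm_triangle_diff[OF Y_L2(1)[OF elim(3)] Y_L2(1)[OF elim(4)] y_D])
        also have "nrm (Lp_space D 2) (Y k \<omega> - y \<omega>) \<le> c * S"
          unfolding c_def by (rule order_trans[OF Y_L2(2)[OF d]])
            (intro mult_left_mono order_trans[OF elim(2) S], simp)
        finally have "nrm (Lp_space D 2) (Y k \<omega> - y_D) \<le> B' + c * S" using elim(1) by linarith
        then show ?case by (simp add: power_mono nrm_Lp_nonneg)
      qed
    qed (use tracking_integrable(1)[OF y y_D] tracking_integrable(1)[OF YL y_D] in auto)
  qed
  have ipx: "(\<lambda>k. L2.ip (X k - x) x + (nrm (Lp_space D 2) x)\<^sup>2) \<longlonglongrightarrow> 0 + (nrm (Lp_space D 2) x)\<^sup>2"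
    by (intro tendsto_intros weak x)
  \<comment> \<open>Lower semicontinuity from |X|^2 \<ge> 2 <X, x> - |x|^2: this lower bound is
    affine in \<open>X k\<close>, so it converges under weak convergence.\<close>
  have "(\<lambda>k. 1 / 2 * E (Y k) + \<alpha> / 2 * (2 * (L2.ip (X k - x) x + (nrm (Lp_space D 2) x)\<^sup>2) - (nrm (Lp_space D 2) x)\<^sup>2))
     \<longlonglongrightarrow> 1 / 2 * E y + \<alpha> / 2 * (2 * (0 + (nrm (Lp_space D 2) x)\<^sup>2) - (nrm (Lp_space D 2) x)\<^sup>2)"
    by (intro tendsto_intros E ipx)
  moreover have "1 / 2 * E (Y k) + \<alpha> / 2 * (2 * (L2.ip (X k - x) x + (nrm (Lp_space D 2) x)\<^sup>2) - (nrm (Lp_space D 2) x)\<^sup>2)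
     \<le> objective_P M D y_D \<alpha> x0 y0" for k
  proof -
    have "0 \<le> (nrm (Lp_space D 2) (X k - x))\<^sup>2" by simp
    then have "2 * (L2.ip (X k - x) x + (nrm (Lp_space D 2) x)\<^sup>2) - (nrm (Lp_space D 2) x)\<^sup>2 \<le> (nrm (Lp_space D 2) (X k))\<^sup>2"
      using L2.nrm_diff_sq[OF X(1) x, of k] L2.ip_diff[OF X(1) x x, of k] by (simp add: L2.nrm_sq)
    then have "\<alpha> / 2 * (2 * (L2.ip (X k - x) x + (nrm (Lp_space D 2) x)\<^sup>2) - (nrm (Lp_space D 2) x)\<^sup>2)
        \<le> \<alpha> / 2 * (nrm (Lp_space D 2) (X k))\<^sup>2"
      using \<alpha> by (intro mult_left_mono) auto
    then show ?thesis using obj[of k] by (simp add: objective_P_def E_def)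
  qed
  ultimately have "1 / 2 * E y + \<alpha> / 2 * (2 * (0 + (nrm (Lp_space D 2) x)\<^sup>2) - (nrm (Lp_space D 2) x)\<^sup>2)
     \<le> objective_P M D y_D \<alpha> x0 y0"
    by (intro LIMSEQ_le_const2) auto
  then have "objective_P M D y_D \<alpha> x y \<le> objective_P M D y_D \<alpha> x0 y0"
    by (simp add: objective_P_def E_def)
  then show ?thesis
    using P feas unfolding solution_P_def is_arg_min_def by fastforce
qed

text \<open>Two extractions prepare \<open>limit_solves_P\<close>: \<open>N\<close> gives explicit
  bounds for the states, and \<open>s\<close> makes the slacks tend to zero almost surely, which
  convergence in mean square alone does not provide.\<close>

lemma accumulation_point_solves_P:
  assumes P: "solution_P M D p a g y_D \<psi> C1 C2 \<alpha> x0 y0"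
    and Ps: "\<And>n. solution_Ps M D p a g y_D \<psi> C1 C2 \<alpha> (\<beta> n) (xs n) (ys n) (zs n)"
    and \<beta>: "\<And>n. \<beta> n > 0" "filterlim \<beta> at_top sequentially"
    and acc: "weak_strong_accumulation_point M D p xs ys x y"
  shows "solution_P M D p a g y_D \<psi> C1 C2 \<alpha> x y"
proof -
  note b = solution_Ps_bounds[OF P Ps \<beta>(1)]
  define J where "J = objective_P M D y_D \<alpha> x0 y0"
  have fs: "\<And>n. xs n \<in> carr (Lp_space D 2)" "\<And>n. ys n \<in> Linf M (W01p D p)" "\<And>n. zs n \<in> Linf M (W01p D p)"
    using b(1) by (auto simp: feasible_Ps_def)
  obtain r where x: "x \<in> carr (Lp_space D 2)" and y: "y \<in> Linf M (W01p D p)"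
    and r: "strict_mono (r :: nat \<Rightarrow> nat)" and wc: "weakly_converges (Lp_space D 2) (\<lambda>n. xs (r n)) x"
    and sc: "(\<lambda>n. Linf_norm M (W01p D p) (ys (r n) - y)) \<longlonglongrightarrow> 0"
    using acc unfolding weak_strong_accumulation_point_def by blast
  obtain N where N: "filterlim N at_top sequentially"
    "\<And>k. AE \<omega> in M. nrm (W01p D p) (ys (r (N k)) \<omega> - y \<omega>) \<le> 1 / real (Suc k)"
    by (rule Linf_norm_tendsto_imp_subseq[OF fs(2) y sc]) blast
  define R where "R k = r (N k)" for k
  have R: "filterlim R at_top sequentially"
    unfolding R_def by (rule filterlim_compose[OF filterlim_subseq[OF r] N(1)])
  have z0: "(\<lambda>k. \<integral>\<omega>. norm ((nrm (Lp_space D 2) (zs (R k) \<omega>))\<^sup>2) \<partial>M) \<longlonglongrightarrow> 0"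
  proof (rule tendsto_sandwich[OF _ _ tendsto_const])
    show "\<forall>\<^sub>F k in sequentially. (\<integral>\<omega>. norm ((nrm (Lp_space D 2) (zs (R k) \<omega>))\<^sup>2) \<partial>M) \<le> 2 * J / \<beta> (R k)"
      using b(3) by (simp add: J_def always_eventually)
    show "(\<lambda>k. 2 * J / \<beta> (R k)) \<longlonglongrightarrow> 0"
      by (rule real_tendsto_divide_at_top[OF tendsto_const filterlim_compose[OF \<beta>(2) R]])
  qed simp
  obtain s :: "nat \<Rightarrow> nat" where s: "strict_mono s"
    "AE \<omega> in M. (\<lambda>k. (nrm (Lp_space D 2) (zs (R (s k)) \<omega>))\<^sup>2) \<longlonglongrightarrow> 0"
    using tendsto_L1_AE_subseq[OF slack_integrable[OF fs(3)] z0] by blast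
  have J0: "0 \<le> 2 * J / \<alpha>" using b(4)[of 0] zero_le_power2[of "nrm (Lp_space D 2) (xs 0)"] unfolding J_def by linarith
  show ?thesis
  proof (rule limit_solves_P[OF P b(1,2) _ x y])
    show "nrm (Lp_space D 2) (xs (R (s k))) \<le> sqrt (2 * J / \<alpha>)" for k
      using b(4)[of "R (s k)"] by (intro real_le_rsqrt) (simp add: J_def)
    show "AE \<omega> in M. nrm (W01p D p) (ys (R (s k)) \<omega> - y \<omega>) \<le> 1 / real (Suc (s k))" for k
      using N(2)[of "s k"] by (simp add: R_def)
    show "(\<lambda>k. 1 / real (Suc (s k))) \<longlonglongrightarrow> 0"
      using LIMSEQ_subseq_LIMSEQ[OF LIMSEQ_Suc[OF lim_inverse_n'] s(1)] by (simp add: o_def)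
    show "AE \<omega> in M. (\<lambda>k. nrm (Lp_space D 2) (zs (R (s k)) \<omega>)) \<longlonglongrightarrow> 0"
      using s(2)
    proof eventually_elim
      case (elim \<omega>)
      from tendsto_real_sqrt[OF elim] show ?case by (simp add: nrm_Lp_nonneg)
    qed
    fix v assume v: "v \<in> carr (Lp_space D 2)"
    have "filterlim (\<lambda>k. N (s k)) at_top sequentially"
      by (rule filterlim_compose[OF N(1) filterlim_subseq[OF s(1)]])
    from filterlim_compose[OF weakly_converges_ip[OF wc fs(1) x v] this]
    show "(\<lambda>k. L2.ip (xs (R (s k)) - x) v) \<longlonglongrightarrow> 0" by (simp add: R_def)
  qed
qed

lemma penalized_accumulation:
  assumes P: "\<exists>x y. solution_P M D p a g y_D \<psi> C1 C2 \<alpha> x y"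
    and Ps: "\<And>n. solution_Ps M D p a g y_D \<psi> C1 C2 \<alpha> (\<beta> n) (xs n) (ys n) (zs n)"
    and \<beta>: "\<And>n. \<beta> n > 0" "filterlim \<beta> at_top sequentially"
  shows "(\<exists>x y. weak_strong_accumulation_point M D p xs ys x y) \<and>
    (\<forall>x y. weak_strong_accumulation_point M D p xs ys x y \<longrightarrow> solution_P M D p a g y_D \<psi> C1 C2 \<alpha> x y)"
proof -
  obtain x0 y0 where P0: "solution_P M D p a g y_D \<psi> C1 C2 \<alpha> x0 y0" using P by blast
  note b = solution_Ps_bounds[OF P0 Ps \<beta>(1)]
  have "\<exists>x y. weak_strong_accumulation_point M D p xs ys x y"
  proof (rule accumulation_point_exists)
    show "nrm (Lp_space D 2) (xs n) \<le> sqrt (2 * objective_P M D y_D \<alpha> x0 y0 / \<alpha>)" for n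
      using b(4)[of n] by (rule real_le_rsqrt)
  qed (use b(1) in \<open>auto simp: feasible_Ps_def\<close>)
  then show ?thesis
    using accumulation_point_solves_P[OF P0 Ps \<beta>] by blast
qed

end

theorem theorem4p5:
  fixes M :: "'w measure"
    and D :: "(real^2) set"
    and p t a_min a_max \<alpha> :: real
    and a g \<psi> :: "'w \<Rightarrow> real^2 \<Rightarrow> real"
    and y_D :: "real^2 \<Rightarrow> real"
    and C1 C2 :: "(real^2 \<Rightarrow> real) set"
    and x1 :: "real \<Rightarrow> real^2 \<Rightarrow> real"
    and y z :: "real \<Rightarrow> 'w \<Rightarrow> real^2 \<Rightarrow> real"
    and \<alpha>' :: "nat \<Rightarrow> real"
  assumes "prob_space M" and "complete_measure M"
    and "bounded D" and "lipschitz_domain D"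
    and "g \<in> Linf M (Lp_space D 2)"
    and "0 < a_min"
    and "AE \<omega> in M. AE s in lebesgue_on D. a_min \<le> a \<omega> s \<and> a \<omega> s \<le> a_max"
    and "0 < t" and "t \<le> 1" and "a \<in> Linf M (holder_space D t)"
    and "p > 2"
    and "\<exists>K. AE \<omega> in M. iso_inverse_bound (W01p D p) (Wm1p D p) (elliptic_op D (a \<omega>)) K"
    and "C1 \<noteq> {}" and "closed_in (Lp_space D 2) C1" and "convex_set C1"
    and "C2 \<noteq> {}" and "closed_in (W01p D p) C2" and "convex_set C2"
    and "y_D \<in> carr (Lp_space D 2)"
    and "\<alpha> > 0"
    and "\<psi> \<in> Linf M (W01p D p)"
    and "(\<lambda>s. 0) \<in> C2"
    and "\<exists>x y. solution_P M D p a g y_D \<psi> C1 C2 \<alpha> x y"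
    and "\<And>\<beta>. \<beta> > 0 \<Longrightarrow> solution_Ps M D p a g y_D \<psi> C1 C2 \<alpha> \<beta> (x1 \<beta>) (y \<beta>) (z \<beta>)"
    and "\<And>n. \<alpha>' n > 0"
    and "filterlim \<alpha>' at_top sequentially"
  shows "(\<exists>x_inf y_inf. weak_strong_accumulation_point M D p
            (\<lambda>n. x1 (\<alpha>' n)) (\<lambda>n. y (\<alpha>' n)) x_inf y_inf) \<and>
         (\<forall>x_inf y_inf. weak_strong_accumulation_point M D p
            (\<lambda>n. x1 (\<alpha>' n)) (\<lambda>n. y (\<alpha>' n)) x_inf y_inf \<longrightarrow>
            solution_P M D p a g y_D \<psi> C1 C2 \<alpha> x_inf y_inf)"
proof -
  obtain K where K: "AE \<omega> in M. iso_inverse_bound (W01p D p) (Wm1p D p) (elliptic_op D (a \<omega>)) K"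
    using assms(12) by blast
  have D: "open D" using assms(4) by (simp add: lipschitz_domain_def)
  \<comment> \<open>The conjugate exponent, for which \<open>Wm1p D p\<close> is the dual of
    \<open>W01p D q\<close>.\<close>
  define q where "q = p / (p - 1)"
  have q: "q \<ge> 1" using assms(11) by (simp add: q_def)
  have e: "sobolev_embedding D q p"
    using D q assms(3,11) by unfold_locales (auto simp: q_def)
  interpret penalized_control D q p M a g K \<psi> y_D C1 C2 \<alpha>
    by (intro penalized_control.intro random_elliptic.intro e assms(1) random_elliptic_axioms.intro
        penalized_control_axioms.intro assms(2,5,14,15,17,19,20,21,22) K)
  show ?thesis
    by (rule penalized_accumulation[OF assms(23) assms(24)[OF assms(25)] assms(25,26)])
qed

end
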